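(* Let $\widehat{\mathbf M}=(\hat{\mathbb X},\hat{\mathbb U},\mathbb Y,\hat x_0,\hat{\mathbf t},\hat h)$ be a gMDP, $\psi$ an scLTL formula with DFA $\mathcal A_\psi=(Q,q_0,\Sigma,F,\tau)$, $\delta\ge0$, and $\mu$ a stationary Markov policy on $\widehat{\mathbf M}\otimes\mathcal A_\psi$. Define $$\mathcal S^\mu_\delta:=\max\{\mathbf 1_F(\bar q_0),V^\mu_\infty(\hat x_0,\bar q_0)\},\quad \bar q_0=\tau(q_0,\mathsf L(\hat h(\hat x_0))),\quad V^\mu_\infty=\lim_{l\to\infty}(\mathbf T^\mu_\delta)^l(0).$$ Then $\mathcal S^\mu_\delta$ is a $(0,\delta)$-robust satisfaction probability: for every gMDP $\mathbf M$ with the same metric output space $\mathbb Y$ such that $\widehat{\mathbf M}\preceq^\delta_0\mathbf M$, one can construct a control strategy $\mathbf C$ for $\mathbf M$ with $\mathbb P_{\mathbf C\times\mathbf M}(\boldsymbol\omega\models\psi)\ge\mathcal S^\mu_\delta$.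
   Context: A gMDP is a tuple $\mathbf M=(\mathbb X,\mathbb U,\mathbb Y,x_0,\mathbf t,h)$ with Polish state space $\mathbb X$, Polish input space $\mathbb U$, output space $\mathbb Y$ with metric $\mathbf d_{\mathbb Y}$, initial state $x_0$, conditional stochastic kernel $\mathbf t(\cdot\mid x,u)$ on $\mathbb X$, measurable output map $h:\mathbb X\to\mathbb Y$; executions satisfy $x_{t+1}\sim\mathbf t(\cdot\mid x_t,u_t)$, $y_t=h(x_t)$. A control strategy for $\mathbf M$ is a gMDP $\mathbf C$ with its own (memory) state space, input space $\mathbb X$ and output space $\mathcal P(\mathbb U)$ (universally measurable kernel and output map): it reads the current state of $\mathbf M$ and outputs a distribution from which the input of $\mathbf M$ is drawn; $\mathbb P_{\mathbf C\times\mathbf M}$ is the induced measure on closed-loop output traces. Specifications: $\mathsf{AP}$ finite, $\Sigma=2^{\mathsf{AP}}$, measurable labelling $\mathsf L:\mathbb Y\to\Sigma$, word $\boldsymbol\omega=\mathsf L(y_0)\mathsf L(y_1)\cdots$; $\psi$ is an scLTL formula (syntax $p\mid\neg p\mid\wedge\mid\vee\mid\bigcirc\mid\mathbin{\sf U}$, usual semantics) and $\mathcal A_\psi=(Q,q_0,\Sigma,F,\tau)$ a deterministic finite automaton with accepting set $F$ and transition $\tau:Q\times\Sigma\to Q$ accepting (via a finite run reaching $F$, $q_{i+1}=\tau(q_i,\omega_i)$) exactly the words satisfying $\psi$. The product $\widehat{\mathbf M}\otimes\mathcal A_\psi$ has states $\hat{\mathbb X}\times Q$, inputs $\hat{\mathbb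 U}$, kernel $\bar{\mathbf t}(d\hat x'\times\{q'\}\mid\hat x,q,u)=\mathbf 1_{\{q'\}}(\tau(q,\mathsf L(\hat h(\hat x'))))\hat{\mathbf t}(d\hat x'\mid\hat x,u)$. A stationary Markov policy is a universally measurable $\mu:\hat{\mathbb X}\times Q\to\mathcal P(\hat{\mathbb U})$ used at every step. For $V:\hat{\mathbb X}\times Q\to[0,1]$: $\mathbf T^\mu(V)(\hat x,q)=\int\max\{\mathbf 1_F(q'),V(\hat x',q')\}\bar{\mathbf t}(d\hat x'\times\{q'\}\mid\hat x,q,\mu(\hat x,q))$ and $\mathbf T^\mu_\delta(V)=\mathbf L(\mathbf T^\mu(V)-\delta)$, $\mathbf L(r)=\min(1,\max(0,r))$. Approximate simulation: for gMDPs $\widehat{\mathbf M}$ and $\mathbf M$ with common $(\mathbb Y,\mathbf d_{\mathbb Y})$, $\widehat{\mathbf M}\preceq^\delta_\epsilon\mathbf M$ means there exist an interface function $\mathcal U_v:\hat{\mathbb U}\times\hat{\mathbb X}\times\mathbb X\to\mathcal P(\mathbb U)$, a measurable relation $\mathcal R\subseteq\hat{\mathbb X}\times\mathbb X$, and a Borel measurable kernel $\mathbb W_{\mathbf t}(\cdot\mid\hat u,\hat x,x)$ on $\hat{\mathbb X}\times\mathbb X$ such that $(\hat x_0,x_0)\in\mathcal R$ and for all $(\hat x,x)\in\mathcal R$: $\mathbf d_{\mathbb Y}(\hat h(\hat x),h(x))\le\epsilon$, and for all $\hat u\in\hat{\mathbb U}$ the measure $\mathbb W=\mathbb W_{\mathbf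 t}(\cdot\mid\hat u,\hat x,x)$ satisfies $\mathbb W(\hat A\times\mathbb X)=\hat{\mathbf t}(\hat A\mid\hat x,\hat u)$, $\mathbb W(\hat{\mathbb X}\times A)=\mathbf t(A\mid x,\mathcal U_v(\hat u,\hat x,x))$ for all measurable $\hat A,A$, and $\mathbb W(\mathcal R)\ge1-\delta$. *)

theory Defs
  imports "HOL-Probability.Probability" "HOL-Probability.Projective_Family"
begin

definition univ_sets :: "'a measure \<Rightarrow> 'a set set" where
  "univ_sets S = {A. A \<subseteq> space S \<and>
      (\<forall>P. prob_space P \<and> sets P = sets S \<longrightarrow> A \<in> sets (completion P))}"

definition univ_alg :: "'a measure \<Rightarrow> 'a measure" where
  "univ_alg S = sigma (space S) (univ_sets S)"

definition uext :: "'a measure \<Rightarrow> 'a measure" where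
  "uext P = measure_of (space P) (univ_sets P) (emeasure (completion P))"

record ('x, 'u, 'y) gmdp =
  init :: 'x
  trans :: "'x \<Rightarrow> 'u \<Rightarrow> 'x measure"
  out :: "'x \<Rightarrow> 'y"

definition is_gmdp :: "('x::polish_space, 'u::polish_space, 'y::metric_space) gmdp \<Rightarrow> bool" where
  "is_gmdp M \<longleftrightarrow>
     (\<lambda>(x, u). trans M x u) \<in> measurable borel (prob_algebra borel) \<and>
     out M \<in> measurable borel borel"

definition kmix :: "('x \<Rightarrow> 'u \<Rightarrow> 'z measure) \<Rightarrow> 'x \<Rightarrow> 'u measure \<Rightarrow> 'z measure" where
  "kmix t x \<nu> = \<nu> \<bind> (\<lambda>u. t x u)"

definition approx_sim ::
  "real \<Rightarrow> real \<Rightarrow> ('x::polish_space, 'u::polish_space, 'y::metric_space) gmdp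
     \<Rightarrow> ('xc::polish_space, 'uc::polish_space, 'y) gmdp \<Rightarrow> bool" where
  "approx_sim \<delta> \<epsilon> Mh M \<longleftrightarrow>
    (\<exists>(Uv :: 'u \<Rightarrow> 'x \<Rightarrow> 'xc \<Rightarrow> 'uc measure) (R :: ('x \<times> 'xc) set)
       (W :: 'u \<Rightarrow> 'x \<Rightarrow> 'xc \<Rightarrow> ('x \<times> 'xc) measure).
      (\<forall>u x xc. Uv u x xc \<in> space (prob_algebra borel)) \<and>
      R \<in> sets borel \<and>
      (\<lambda>(u, x, xc). W u x xc) \<in> measurable borel (prob_algebra borel) \<and>
      (init Mh, init M) \<in> R \<and>
      (\<forall>(x, xc) \<in> R.
         dist (out Mh x) (out M xc) \<le> \<epsilon> \<and>
         (\<forall>u. (\<forall>A \<in> sets borel. emeasure (W u x xc) (A \<times> UNIV) = emeasure (trans Mh x u) A) \<and>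
              (\<forall>A \<in> sets borel. emeasure (W u x xc) (UNIV \<times> A)
                                 = emeasure (kmix (trans M) xc (Uv u x xc)) A) \<and>
              measure (W u x xc) R \<ge> 1 - \<delta>)))"

datatype 'ap scltl =
    Prop 'ap
  | NProp 'ap
  | And "'ap scltl" "'ap scltl"
  | Or "'ap scltl" "'ap scltl"
  | Next "'ap scltl"
  | Until "'ap scltl" "'ap scltl"

fun scsat :: "(nat \<Rightarrow> 'ap set) \<Rightarrow> nat \<Rightarrow> 'ap scltl \<Rightarrow> bool" where
  "scsat w i (Prop p) = (p \<in> w i)"
| "scsat w i (NProp p) = (p \<notin> w i)"
| "scsat w i (And a b) = (scsat w i a \<and> scsat w i b)"
| "scsat w i (Or a b) = (scsat w i a \<or> scsat w i b)"
| "scsat w i (Next a) = scsat w (Suc i) a"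
| "scsat w i (Until a b) = (\<exists>j\<ge>i. scsat w j b \<and> (\<forall>k. i \<le> k \<and> k < j \<longrightarrow> scsat w k a))"

primrec dfa_run :: "('q \<Rightarrow> 'ap set \<Rightarrow> 'q) \<Rightarrow> 'q \<Rightarrow> (nat \<Rightarrow> 'ap set) \<Rightarrow> nat \<Rightarrow> 'q" where
  "dfa_run \<tau> q0 w 0 = q0"
| "dfa_run \<tau> q0 w (Suc i) = \<tau> (dfa_run \<tau> q0 w i) (w i)"

definition dfa_accepts :: "'q \<Rightarrow> 'q set \<Rightarrow> ('q \<Rightarrow> 'ap set \<Rightarrow> 'q) \<Rightarrow> (nat \<Rightarrow> 'ap set) \<Rightarrow> bool" where
  "dfa_accepts q0 F \<tau> w \<longleftrightarrow> (\<exists>n. dfa_run \<tau> q0 w n \<in> F)"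

abbreviation XQ :: "('x::topological_space \<times> 'q) measure" where
  "XQ \<equiv> borel \<Otimes>\<^sub>M count_space UNIV"

definition prod_kernel ::
  "('x::topological_space, 'u, 'y) gmdp \<Rightarrow> ('y \<Rightarrow> 'ap set) \<Rightarrow> ('q \<Rightarrow> 'ap set \<Rightarrow> 'q)
     \<Rightarrow> 'x \<times> 'q \<Rightarrow> 'u measure \<Rightarrow> ('x \<times> 'q) measure" where
  "prod_kernel Mh L \<tau> s \<nu> =
     kmix (\<lambda>x u. distr (trans Mh x u) XQ (\<lambda>x'. (x', \<tau> (snd s) (L (out Mh x'))))) (fst s) \<nu>"

text \<open>The operator T^mu (integration against the completed measure, so that universally
  measurable value functions are integrated correctly).\<close>
definition Tmu ::
  "('x::topological_space, 'u, 'y) gmdp \<Rightarrow> ('y \<Rightarrow> 'ap set) \<Rightarrow> 'q set \<Rightarrow> ('q \<Rightarrow> 'ap set \<Rightarrow> 'q)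
     \<Rightarrow> ('x \<times> 'q \<Rightarrow> 'u measure) \<Rightarrow> ('x \<times> 'q \<Rightarrow> real) \<Rightarrow> 'x \<times> 'q \<Rightarrow> real" where
  "Tmu Mh L F \<tau> \<mu> V s =
     (\<integral>s'. max (indicator F (snd s')) (V s') \<partial>completion (prod_kernel Mh L \<tau> s (\<mu> s)))"

definition clip01 :: "real \<Rightarrow> real" where
  "clip01 r = min 1 (max 0 r)"

definition Tmu_delta ::
  "('x::topological_space, 'u, 'y) gmdp \<Rightarrow> ('y \<Rightarrow> 'ap set) \<Rightarrow> 'q set \<Rightarrow> ('q \<Rightarrow> 'ap set \<Rightarrow> 'q)
     \<Rightarrow> ('x \<times> 'q \<Rightarrow> 'u measure) \<Rightarrow> real \<Rightarrow> ('x \<times> 'q \<Rightarrow> real) \<Rightarrow> 'x \<times> 'q \<Rightarrow> real" where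
  "Tmu_delta Mh L F \<tau> \<mu> \<delta> V s = clip01 (Tmu Mh L F \<tau> \<mu> V s - \<delta>)"

definition V_inf ::
  "('x::topological_space, 'u, 'y) gmdp \<Rightarrow> ('y \<Rightarrow> 'ap set) \<Rightarrow> 'q set \<Rightarrow> ('q \<Rightarrow> 'ap set \<Rightarrow> 'q)
     \<Rightarrow> ('x \<times> 'q \<Rightarrow> 'u measure) \<Rightarrow> real \<Rightarrow> 'x \<times> 'q \<Rightarrow> real" where
  "V_inf Mh L F \<tau> \<mu> \<delta> s = lim (\<lambda>l. ((Tmu_delta Mh L F \<tau> \<mu> \<delta> ^^ l) (\<lambda>_. 0)) s)"

definition robust_sat_prob ::
  "('x::topological_space, 'u, 'y) gmdp \<Rightarrow> ('y \<Rightarrow> 'ap set) \<Rightarrow> 'q \<Rightarrow> 'q set \<Rightarrow> ('q \<Rightarrow> 'ap set \<Rightarrow> 'q)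
     \<Rightarrow> ('x \<times> 'q \<Rightarrow> 'u measure) \<Rightarrow> real \<Rightarrow> real" where
  "robust_sat_prob Mh L q0 F \<tau> \<mu> \<delta> =
     (let qb0 = \<tau> q0 (L (out Mh (init Mh)))
      in max (indicator F qb0) (V_inf Mh L F \<tau> \<mu> \<delta> (init Mh, qb0)))"

definition is_policy :: "('x::topological_space \<times> 'q \<Rightarrow> 'u::topological_space measure) \<Rightarrow> bool" where
  "is_policy \<mu> \<longleftrightarrow> \<mu> \<in> measurable (univ_alg XQ) (prob_algebra borel)"

text \<open>A control strategy is a gMDP with memory state space 'm, input space = state space
  of the controlled gMDP and output space = probability measures on its inputs.\<close>
record ('m, 'xc, 'uc) strategy =
  cinit :: 'm
  ctrans :: "'m \<Rightarrow> 'xc \<Rightarrow> 'm measure"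
  cout :: "'m \<Rightarrow> 'uc measure"

definition is_strategy :: "'m measure \<Rightarrow> ('m, 'xc::topological_space, 'uc::topological_space) strategy \<Rightarrow> bool" where
  "is_strategy Mm C \<longleftrightarrow>
     (\<lambda>(m, x). ctrans C m x) \<in> measurable (univ_alg (Mm \<Otimes>\<^sub>M borel)) (prob_algebra Mm) \<and>
     cout C \<in> measurable (univ_alg Mm) (prob_algebra borel)"

definition cl_step ::
  "'m measure \<Rightarrow> ('m, 'xc::topological_space, 'uc) strategy \<Rightarrow> ('xc, 'uc, 'y) gmdp
     \<Rightarrow> 'm \<times> 'xc \<Rightarrow> ('m \<times> 'xc) measure" where
  "cl_step Mm C M z =
     uext (ctrans C (fst z) (snd z)) \<bind> (\<lambda>m'.
       uext (cout C m') \<bind> (\<lambda>u.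
         uext (trans M (snd z) u) \<bind> (\<lambda>x'. return (univ_alg (Mm \<Otimes>\<^sub>M borel)) (m', x'))))"

definition cl_kernels ::
  "'m measure \<Rightarrow> ('m, 'xc::topological_space, 'uc) strategy \<Rightarrow> ('xc, 'uc, 'y) gmdp
     \<Rightarrow> nat \<Rightarrow> (nat \<Rightarrow> 'm \<times> 'xc) \<Rightarrow> ('m \<times> 'xc) measure" where
  "cl_kernels Mm C M i \<omega> =
     (if i = 0 then return (univ_alg (Mm \<Otimes>\<^sub>M borel)) (cinit C, init M)
      else cl_step Mm C M (\<omega> (i - 1)))"

definition cl_path_measure ::
  "'m measure \<Rightarrow> ('m, 'xc::topological_space, 'uc) strategy \<Rightarrow> ('xc, 'uc, 'y) gmdp
     \<Rightarrow> (nat \<Rightarrow> 'm \<times> 'xc) measure" where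
  "cl_path_measure Mm C M =
     projective_family.lim UNIV
       (Ionescu_Tulcea.CI (cl_kernels Mm C M) (\<lambda>_. univ_alg (Mm \<Otimes>\<^sub>M borel)))
       (\<lambda>_. univ_alg (Mm \<Otimes>\<^sub>M borel))"

definition cl_trace_measure ::
  "'m measure \<Rightarrow> ('m, 'xc::topological_space, 'uc) strategy \<Rightarrow> ('xc, 'uc, 'y::topological_space) gmdp
     \<Rightarrow> (nat \<Rightarrow> 'y) measure" where
  "cl_trace_measure Mm C M =
     distr (cl_path_measure Mm C M) (Pi\<^sub>M UNIV (\<lambda>_. borel)) (\<lambda>\<omega> i. out M (snd (\<omega> i)))"

definition sat_prob ::
  "'m measure \<Rightarrow> ('m, 'xc::topological_space, 'uc) strategy \<Rightarrow> ('xc, 'uc, 'y::topological_space) gmdp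
     \<Rightarrow> ('y \<Rightarrow> 'ap set) \<Rightarrow> 'ap scltl \<Rightarrow> real" where
  "sat_prob Mm C M L \<psi> =
     measure (cl_trace_measure Mm C M)
       {ys \<in> space (Pi\<^sub>M UNIV (\<lambda>_. borel)). scsat (\<lambda>i. L (ys i)) 0 \<psi>}"

end

theory Submission
  imports Defs
begin

text \<open>
  The strategy simulates the abstract system: its memory \<open>(x, q, xc)\<close> holds an abstract state,
  the automaton state and the last concrete state. Averaging the coupling kernel over the
  abstract policy gives the joint law of the next pair of states. Observing the next concrete
  state, the strategy samples the next abstract state from the conditional law, so that the
  closed loop reproduces the coupling as long as the pair stays in the relation, where abstract
  and concrete outputs coincide. Leaving the relation costs at most \<open>\<delta>\<close> per step, which is
  exactly what the operator \<open>T\<^sub>\<delta>\<close> subtracts; induction on the horizon bounds the probability of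
  reaching \<open>F\<close> within \<open>l\<close> steps from below by the \<open>l\<close>-th iterate.

  Two measurability problems have to be overcome. The interface function is not assumed to be
  measurable; as the concrete marginal of the coupling is a measurable kernel, the von Neumann
  selection theorem yields a universally measurable replacement. And the conditional law must
  depend measurably on the memory, which requires a disintegration of kernels with a parameter.
\<close>

section \<open>Probability kernels\<close>

lemma prob_algebraD:
  assumes "P \<in> space (prob_algebra S)"
  shows "prob_space P" "sets P = sets S" "space P = space S"
  using assms sets_eq_imp_space_eq[of P S] by (auto simp: space_prob_algebra)

lemma measurable_prob_algebra_cong:
  "P \<in> space (prob_algebra S) \<Longrightarrow> measurable P T = measurable S T"
  by (intro measurable_cong_sets prob_algebraD refl)

lemma return_in_space_prob_algebra:
  "x \<in> space S \<Longrightarrow> return S x \<in> space (prob_algebra S)"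
  by (rule measurable_space[OF measurable_return_prob_space])

lemma distr_in_space_prob_algebra:
  assumes "P \<in> space (prob_algebra S)" "f \<in> measurable S T"
  shows "distr P T f \<in> space (prob_algebra T)"
  by (rule measurable_space[OF measurable_distr_prob_space[OF assms(2)] assms(1)])

lemma bind_in_space_prob_algebra:
  assumes "P \<in> space (prob_algebra S)" "\<kappa> \<in> measurable S (prob_algebra T)"
  shows "P \<bind> \<kappa> \<in> space (prob_algebra T)"
  using prob_space_bind'[OF assms] sets_bind'[OF assms] by (simp add: space_prob_algebra)

lemma measurable_kernel_of_space:
  "P \<in> space (prob_algebra S) \<Longrightarrow> \<kappa> \<in> measurable S (prob_algebra T) \<Longrightarrow>
    \<kappa> \<in> measurable P (subprob_algebra T)"
  by (simp add: measurable_prob_algebra_cong measurable_prob_algebraD)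

lemma nn_integral_bind_prob_algebra:
  assumes "P \<in> space (prob_algebra S)" "\<kappa> \<in> measurable S (prob_algebra T)"
    and "f \<in> borel_measurable T"
  shows "(\<integral>\<^sup>+x. f x \<partial>(P \<bind> \<kappa>)) = (\<integral>\<^sup>+s. \<integral>\<^sup>+x. f x \<partial>\<kappa> s \<partial>P)"
  using assms by (intro nn_integral_bind[where B = T] measurable_kernel_of_space)

lemma distr_bind_prob_algebra:
  assumes P: "P \<in> space (prob_algebra S)" and \<kappa>: "\<kappa> \<in> measurable S (prob_algebra T)"
    and f: "f \<in> measurable T U"
  shows "distr (P \<bind> \<kappa>) U f = P \<bind> (\<lambda>s. distr (\<kappa> s) U f)"
  using prob_space.not_empty[OF prob_algebraD(1)[OF P]]
  by (intro distr_bind[OF measurable_kernel_of_space[OF P \<kappa>] _ f])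

lemma nn_integral_prob_le_1:
  assumes "prob_space P" "\<And>x. f x \<le> 1"
  shows "(\<integral>\<^sup>+x. f x \<partial>P) \<le> 1"
proof -
  have "(\<integral>\<^sup>+x. f x \<partial>P) \<le> (\<integral>\<^sup>+x. 1 \<partial>P)" by (intro nn_integral_mono assms)
  then show ?thesis using prob_space.emeasure_space_1[OF assms(1)] by simp
qed

section \<open>Universal completion\<close>

lemma univ_sets_eq:
  "univ_sets S = {A. A \<subseteq> space S \<and> (\<forall>P\<in>space (prob_algebra S). A \<in> sets (completion P))}"
  by (auto simp: univ_sets_def space_prob_algebra)

lemma univ_sets_completion:
  "A \<in> univ_sets S \<Longrightarrow> P \<in> space (prob_algebra S) \<Longrightarrow> A \<in> sets (completion P)"
  by (simp add: univ_sets_eq)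

lemma univ_sets_cong: "sets S = sets T \<Longrightarrow> univ_sets S = univ_sets T"
  using sets_eq_imp_space_eq[of S T] by (simp add: univ_sets_def)

lemma univ_sets_into_space: "univ_sets S \<subseteq> Pow (space S)"
  by (auto simp: univ_sets_def)

lemma sets_imp_univ_sets: "A \<in> sets S \<Longrightarrow> A \<in> univ_sets S"
  using sets.sets_into_space by (fastforce simp: univ_sets_def)

lemma sigma_algebra_univ_sets: "sigma_algebra (space S) (univ_sets S)"
  unfolding sigma_algebra_iff2
proof (intro conjI ballI allI impI)
  show "univ_sets S \<subseteq> Pow (space S)" by (rule univ_sets_into_space)
  show "{} \<in> univ_sets S" by (simp add: univ_sets_eq)
  show "space S - A \<in> univ_sets S" if "A \<in> univ_sets S" for A
  proof -
    have "space S - A \<in> sets (completion P)" if "P \<in> space (prob_algebra S)" for P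
      using sets.compl_sets[OF univ_sets_completion[OF \<open>A \<in> univ_sets S\<close> that]]
      by (simp add: prob_algebraD(3)[OF that])
    then show ?thesis by (simp add: univ_sets_eq)
  qed
  show "(\<Union>i. A i) \<in> univ_sets S" if "range A \<subseteq> univ_sets S" for A :: "nat \<Rightarrow> _"
  proof -
    have "(\<Union>i. A i) \<in> sets (completion P)" if "P \<in> space (prob_algebra S)" for P
      using \<open>range A \<subseteq> univ_sets S\<close> univ_sets_completion[OF _ that]
      by (intro sets.countable_UN) auto
    then show ?thesis using that by (auto simp: univ_sets_eq)
  qed
qed

lemma space_univ_alg [simp]: "space (univ_alg S) = space S"
  unfolding univ_alg_def by (simp add: space_measure_of univ_sets_into_space)

lemma sets_univ_alg: "sets (univ_alg S) = univ_sets S"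
  unfolding univ_alg_def
  by (simp add: sigma_algebra.sets_measure_of_eq sigma_algebra_univ_sets)

lemma space_uext [simp]: "space (uext P) = space P"
  unfolding uext_def by (simp add: space_measure_of univ_sets_into_space)

lemma sets_uext: "sets (uext P) = univ_sets P"
  unfolding uext_def by (simp add: sigma_algebra.sets_measure_of_eq sigma_algebra_univ_sets)

lemma sets_uext_prob_algebra:
  "P \<in> space (prob_algebra S) \<Longrightarrow> sets (uext P) = univ_sets S"
  by (simp add: sets_uext univ_sets_cong[OF prob_algebraD(2)])

lemma emeasure_uext:
  assumes P: "prob_space P" and A: "A \<in> univ_sets P"
  shows "emeasure (uext P) A = emeasure (completion P) A"
  unfolding uext_def
proof (rule emeasure_measure_of_sigma[OF sigma_algebra_univ_sets _ _ A])
  have "univ_sets P \<subseteq> sets (completion P)"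
    using P by (auto simp: space_prob_algebra intro: univ_sets_completion)
  then show "countably_additive (univ_sets P) (emeasure (completion P))"
    unfolding countably_additive_def by (auto intro!: suminf_emeasure)
qed (simp add: positive_def)

lemma emeasure_uext_sets:
  "prob_space P \<Longrightarrow> A \<in> sets P \<Longrightarrow> emeasure (uext P) A = emeasure P A"
  by (simp add: emeasure_uext sets_imp_univ_sets)

lemma prob_space_uext: "prob_space P \<Longrightarrow> prob_space (uext P)"
  by (rule prob_spaceI) (simp add: emeasure_uext_sets prob_space.emeasure_space_1)

lemma uext_in_space_prob_algebra:
  "P \<in> space (prob_algebra S) \<Longrightarrow> uext P \<in> space (prob_algebra (univ_alg S))"
  using prob_space_uext[OF prob_algebraD(1)]
  by (auto simp: space_prob_algebra sets_univ_alg sets_uext cong: univ_sets_cong)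

lemma emeasure_sandwich_null:
  assumes "A \<in> sets M" "B \<in> sets M" "N \<in> null_sets M" "B \<subseteq> A" "A \<subseteq> B \<union> N"
  shows "emeasure M A = emeasure M B"
proof (rule emeasure_eq_AE)
  show "AE x in M. x \<in> A \<longleftrightarrow> x \<in> B"
    using AE_not_in[OF assms(3)] by eventually_elim (use assms(4,5) in auto)
qed (use assms in auto)

lemma univ_sets_sandwich:
  assumes A: "A \<in> univ_sets S" and P: "P \<in> space (prob_algebra S)"
  obtains B N where "B \<in> sets S" "N \<in> null_sets P" "N \<in> sets S" "B \<subseteq> A" "A \<subseteq> B \<union> N"
    "emeasure (completion P) A = emeasure P B"
proof -
  have A': "A \<in> sets (completion P)" by (rule univ_sets_completion[OF A P])
  obtain N where N: "N \<in> null_sets P" "null_part P A \<subseteq> N" using null_part[OF A'] by blast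
  show thesis
  proof (rule that[of "main_part P A" N])
    show "main_part P A \<in> sets S" "N \<in> sets S"
      using main_part_sets[OF A'] N(1) prob_algebraD(2)[OF P] by auto
    show "emeasure (completion P) A = emeasure P (main_part P A)"
      by (rule emeasure_completion[OF A'])
  qed (use N main_part_null_part_Un[OF A'] in auto)
qed

lemma uext_eqI:
  assumes Q: "prob_space Q" and sets_P: "sets P = univ_sets Q"
    and eq: "\<And>A. A \<in> sets Q \<Longrightarrow> emeasure P A = emeasure Q A"
  shows "P = uext Q"
proof (rule measure_eqI)
  show "sets P = sets (uext Q)" by (simp add: sets_uext sets_P)
  fix A assume "A \<in> sets P"
  then have A: "A \<in> univ_sets Q" by (simp add: sets_P)
  have "Q \<in> space (prob_algebra Q)" using Q by (simp add: space_prob_algebra)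
  from univ_sets_sandwich[OF A this] obtain B N where B: "B \<in> sets Q" "B \<subseteq> A" "A \<subseteq> B \<union> N"
    and N: "N \<in> null_sets Q" and completion_A: "emeasure (completion Q) A = emeasure Q B"
    by metis
  have "emeasure P A = emeasure P B"
    using A B N
    by (intro emeasure_sandwich_null[of A P B N])
       (auto simp: sets_P sets_imp_univ_sets eq null_sets_def)
  then show "emeasure P A = emeasure (uext Q) A"
    by (simp add: emeasure_uext[OF Q A] completion_A eq B)
qed

lemma univ_sets_univ_alg: "univ_sets (univ_alg S) = univ_sets S"
proof (intro equalityI subsetI)
  fix A assume A: "A \<in> univ_sets (univ_alg S)"
  have "A \<in> sets (completion P)" if P: "P \<in> space (prob_algebra S)" for P
  proof -
    obtain B N where sandwich: "B \<in> univ_sets S" "N \<in> univ_sets S" "B \<subseteq> A" "A \<subseteq> B \<union> N"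
      and N: "N \<in> null_sets (uext P)"
      using univ_sets_sandwich[OF A uext_in_space_prob_algebra[OF P]] by (metis sets_univ_alg)
    have "N \<in> univ_sets P" using sandwich(2) univ_sets_cong[OF prob_algebraD(2)[OF P]] by simp
    then have "emeasure (completion P) N = 0"
      using N emeasure_uext[OF prob_algebraD(1)[OF P]] by (simp add: null_sets_def)
    then have "N \<in> null_sets (completion P)"
      using univ_sets_completion[OF sandwich(2) P] by (simp add: null_sets_def)
    then have "A - B \<in> sets (completion P)"
      using completion.complete2[of "A - B" N] sandwich by auto
    then have "B \<union> (A - B) \<in> sets (completion P)"
      using univ_sets_completion[OF sandwich(1) P] by blast
    then show ?thesis using sandwich(3) by (simp add: Un_absorb1)
  qed
  then show "A \<in> univ_sets S" using A by (simp add: univ_sets_eq)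
next
  fix A assume "A \<in> univ_sets S"
  then show "A \<in> univ_sets (univ_alg S)" by (intro sets_imp_univ_sets) (simp add: sets_univ_alg)
qed

lemma univ_alg_idem: "univ_alg (univ_alg S) = univ_alg S"
  by (simp add: univ_alg_def[of "univ_alg S"] univ_sets_univ_alg univ_alg_def[symmetric])

subsection \<open>Universally measurable functions\<close>

lemma measurable_univ_algI:
  assumes "f \<in> space S \<rightarrow> space T"
    and "\<And>P. P \<in> space (prob_algebra S) \<Longrightarrow> f \<in> measurable (completion P) T"
  shows "f \<in> measurable (univ_alg S) T"
proof (rule measurableI)
  show "f x \<in> space T" if "x \<in> space (univ_alg S)" for x using assms(1) that by auto
  fix A assume A: "A \<in> sets T"
  have "f -` A \<inter> space S \<in> sets (completion P)" if "P \<in> space (prob_algebra S)" for P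
    using measurable_sets[OF assms(2)[OF that] A] by (simp add: prob_algebraD(3)[OF that])
  then show "f -` A \<inter> space (univ_alg S) \<in> sets (univ_alg S)"
    by (simp add: sets_univ_alg univ_sets_eq)
qed

lemma measurable_univ_algI1: "f \<in> measurable S T \<Longrightarrow> f \<in> measurable (univ_alg S) T"
  by (auto simp: measurable_def sets_univ_alg sets_imp_univ_sets)

lemma measurable_univ_alg_univ_alg:
  assumes f: "f \<in> measurable S T"
  shows "f \<in> measurable (univ_alg S) (univ_alg T)"
proof (rule measurable_univ_algI)
  show "f \<in> space S \<rightarrow> space (univ_alg T)" using measurable_space[OF f] by auto
  fix P assume P: "P \<in> space (prob_algebra S)"
  define D where "D = distr P T f"
  have D: "D \<in> space (prob_algebra T)" unfolding D_def by (rule distr_in_space_prob_algebra[OF P f])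
  have measurable_f: "f \<in> measurable P T" using f by (simp add: measurable_prob_algebra_cong[OF P])
  have "f \<in> measurable (completion P) (completion D)"
  proof (rule completion.measurable_completion2)
    show "f \<in> measurable (completion P) D"
      using measurable_completion[OF measurable_f] by (simp add: D_def)
    have "null_sets (distr (completion P) D f) = null_sets D"
      by (simp add: null_sets_def D_def distr_completion[OF measurable_f]
          distr_cong[OF refl sets_distr refl])
    then show "null_sets D \<subseteq> null_sets (distr (completion P) D f)" by simp
  qed
  then show "f \<in> measurable (completion P) (univ_alg T)"
    using univ_sets_completion[OF _ D] by (auto simp: measurable_def sets_univ_alg D_def)
qed

lemma measurable_compose_univ_alg:
  "f \<in> measurable S T \<Longrightarrow> g \<in> measurable (univ_alg T) U \<Longrightarrow> (\<lambda>x. g (f x)) \<in> measurable (univ_alg S) U"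
  by (rule measurable_compose[OF measurable_univ_alg_univ_alg])

lemma measurable_Pair_univ_alg:
  assumes "s \<in> space S" and g: "g \<in> measurable (univ_alg (S \<Otimes>\<^sub>M T)) U"
  shows "(\<lambda>t. g (s, t)) \<in> measurable (univ_alg T) U"
  using measurable_compose_univ_alg[OF measurable_Pair1' g] assms(1) by simp

lemma measurable_univ_alg_pair:
  "(\<lambda>z. z) \<in> measurable (univ_alg (S \<Otimes>\<^sub>M T)) (univ_alg S \<Otimes>\<^sub>M T)"
  using measurable_Pair[OF measurable_univ_alg_univ_alg[OF measurable_fst]
      measurable_univ_algI1[OF measurable_snd], of S T] by simp

lemma measurable_completion_AE:
  assumes f: "f \<in> measurable (completion P) T" and AE: "AE x in P. f x = g x"
    and g: "\<And>x. x \<in> space P \<Longrightarrow> g x \<in> space T"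
  shows "g \<in> measurable (completion P) T"
proof (rule measurableI)
  show "g x \<in> space T" if "x \<in> space (completion P)" for x using g that by simp
  fix A assume A: "A \<in> sets T"
  have "AE x in completion P. x \<in> f -` A \<inter> space P \<longleftrightarrow> x \<in> g -` A \<inter> space P"
    using AE_completion[OF AE] by eventually_elim auto
  from completion.in_sets_AE[OF this] show "g -` A \<inter> space (completion P) \<in> sets (completion P)"
    using measurable_sets[OF f A] by simp
qed

lemma measurable_uext_cong:
  "P \<in> space (prob_algebra S) \<Longrightarrow> measurable (uext P) T = measurable (univ_alg S) T"
  by (intro measurable_cong_sets refl) (simp add: sets_uext_prob_algebra sets_univ_alg)

subsection \<open>Integration against the universal completion\<close>

lemma uext_subalgebra:
  assumes "prob_space P"
  shows "sets (uext P) \<subseteq> sets (completion P)" "space (uext P) = space (completion P)"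
    "\<And>A. A \<in> sets (uext P) \<Longrightarrow> emeasure (uext P) A = emeasure (completion P) A"
  using assms univ_sets_completion[of _ P P] emeasure_uext[OF assms]
  by (auto simp: sets_uext space_prob_algebra)

lemma integral_uext:
  fixes f :: "'a \<Rightarrow> real"
  assumes P: "P \<in> space (prob_algebra S)" and f: "f \<in> borel_measurable (univ_alg S)"
  shows "(\<integral>x. f x \<partial>uext P) = (\<integral>x. f x \<partial>completion P)"
  using f unfolding measurable_uext_cong[OF P, symmetric]
  by (rule integral_subalgebra[OF _ uext_subalgebra[OF prob_algebraD(1)[OF P]]])

lemma nn_integral_uext:
  assumes P: "P \<in> space (prob_algebra S)" and f: "f \<in> borel_measurable S"
  shows "(\<integral>\<^sup>+x. f x \<partial>uext P) = (\<integral>\<^sup>+x. f x \<partial>P)"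
proof -
  have "f \<in> borel_measurable (uext P)"
    using measurable_univ_algI1[OF f] by (simp add: measurable_uext_cong[OF P])
  then have "(\<integral>\<^sup>+x. f x \<partial>uext P) = (\<integral>\<^sup>+x. f x \<partial>completion P)"
    by (rule nn_integral_subalgebra[OF _ uext_subalgebra[OF prob_algebraD(1)[OF P]]])
  also have "\<dots> = (\<integral>\<^sup>+x. f x \<partial>P)"
    by (rule nn_integral_completion)
  finally show ?thesis .
qed

lemma uext_return: "x \<in> space S \<Longrightarrow> uext (return S x) = return (univ_alg S) x"
  by (intro uext_eqI[symmetric] prob_space_return)
     (simp_all add: sets_univ_alg sets_imp_univ_sets cong: univ_sets_cong)

lemma uext_distr:
  assumes P: "P \<in> space (prob_algebra S)" and f: "f \<in> measurable S T"
  shows "uext (distr P T f) = distr (uext P) (univ_alg T) f"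
proof (rule uext_eqI[symmetric])
  show "prob_space (distr P T f)"
    by (rule prob_algebraD(1)[OF distr_in_space_prob_algebra[OF P f]])
  show "sets (distr (uext P) (univ_alg T) f) = univ_sets (distr P T f)"
    by (simp add: sets_univ_alg cong: univ_sets_cong)
  fix A assume "A \<in> sets (distr P T f)"
  then have A: "A \<in> sets T" by simp
  have measurable_f: "f \<in> measurable P T" using f by (simp add: measurable_prob_algebra_cong[OF P])
  have measurable_f_uext: "f \<in> measurable (uext P) (univ_alg T)"
    unfolding measurable_uext_cong[OF P] by (rule measurable_univ_alg_univ_alg[OF f])
  show "emeasure (distr (uext P) (univ_alg T) f) A = emeasure (distr P T f) A"
    using A measurable_sets[OF measurable_f A] prob_algebraD(1)[OF P]
    by (simp add: emeasure_distr[OF measurable_f_uext] emeasure_distr[OF measurable_f]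
        emeasure_uext_sets
        sets_univ_alg sets_imp_univ_sets)
qed

lemma nn_integral_uext_distr:
  assumes P: "P \<in> space (prob_algebra S)" and f: "f \<in> measurable S T"
    and g: "g \<in> borel_measurable (univ_alg T)"
  shows "(\<integral>\<^sup>+y. g y \<partial>uext (distr P T f)) = (\<integral>\<^sup>+x. g (f x) \<partial>uext P)"
  unfolding uext_distr[OF P f]
  using g measurable_univ_alg_univ_alg[OF f]
  by (intro nn_integral_distr) (simp_all add: measurable_uext_cong[OF P])

lemma nn_integral_bind_uext:
  assumes P: "P \<in> space (prob_algebra S)" and \<kappa>: "\<kappa> \<in> measurable (univ_alg S) (prob_algebra T)"
    and f: "f \<in> borel_measurable T"
  shows "(\<integral>\<^sup>+x. f x \<partial>(uext P \<bind> \<kappa>)) = (\<integral>\<^sup>+s. \<integral>\<^sup>+x. f x \<partial>\<kappa> s \<partial>uext P)"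
  by (rule nn_integral_bind_prob_algebra[OF uext_in_space_prob_algebra[OF P] \<kappa> f])

lemma uext_bind_borel_kernel:
  assumes P: "P \<in> space (prob_algebra S)" and \<kappa>: "\<kappa> \<in> measurable S (prob_algebra T)"
  shows "uext P \<bind> \<kappa> = P \<bind> \<kappa>"
proof (rule measure_eqI)
  note uP = uext_in_space_prob_algebra[OF P] and u\<kappa> = measurable_univ_algI1[OF \<kappa>]
  show "sets (uext P \<bind> \<kappa>) = sets (P \<bind> \<kappa>)"
    by (simp add: sets_bind'[OF P \<kappa>] sets_bind'[OF uP u\<kappa>])
  fix A assume "A \<in> sets (uext P \<bind> \<kappa>)"
  then have A: "A \<in> sets T" by (simp add: sets_bind'[OF uP u\<kappa>])
  show "emeasure (uext P \<bind> \<kappa>) A = emeasure (P \<bind> \<kappa>) A"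
    unfolding emeasure_bind_prob_algebra[OF uP u\<kappa> A] emeasure_bind_prob_algebra[OF P \<kappa> A]
    by (intro nn_integral_uext[OF P]
        measurable_emeasure_kernel[OF measurable_prob_algebraD[OF \<kappa>] A])
qed

subsection \<open>Universally measurable kernels\<close>

lemma AE_emeasure_uext_kernel:
  assumes P: "P \<in> space (prob_algebra S)" and \<kappa>: "\<kappa> \<in> measurable S (prob_algebra T)"
    and A: "A \<in> univ_sets T"
  obtains B where "B \<in> sets T" "AE s in P. emeasure (\<kappa> s) B = emeasure (uext (\<kappa> s)) A"
proof -
  obtain B N where sandwich: "B \<in> sets T" "N \<in> sets T" "B \<subseteq> A" "A \<subseteq> B \<union> N"
    and null: "N \<in> null_sets (P \<bind> \<kappa>)"
    by (rule univ_sets_sandwich[OF A bind_in_space_prob_algebra[OF P \<kappa>]])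
  have "AE s in P. AE x in \<kappa> s. x \<notin> N"
    using AE_not_in[OF null] sandwich(2)
    by (subst (asm) AE_bind[OF measurable_kernel_of_space[OF P \<kappa>]]) auto
  then have "AE s in P. emeasure (\<kappa> s) B = emeasure (uext (\<kappa> s)) A"
  proof (rule AE_mp[OF _ AE_I2], intro impI)
    fix s assume "s \<in> space P" and AE: "AE x in \<kappa> s. x \<notin> N"
    then have \<kappa>s: "\<kappa> s \<in> space (prob_algebra T)"
      using measurable_space[OF \<kappa>] prob_algebraD(3)[OF P] by simp
    note [simp] = prob_algebraD(1,2)[OF \<kappa>s] sets_uext_prob_algebra[OF \<kappa>s]
    have "N \<in> null_sets (\<kappa> s)" using AE sandwich(2) by (subst AE_iff_null_sets) auto
    then have "N \<in> null_sets (uext (\<kappa> s))"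
      using sandwich(2) by (simp add: null_sets_def emeasure_uext_sets sets_imp_univ_sets)
    then have "emeasure (uext (\<kappa> s)) A = emeasure (uext (\<kappa> s)) B"
      using A sandwich by (intro emeasure_sandwich_null[of A _ B N])
         (simp_all add: sets_imp_univ_sets)
    then show "emeasure (\<kappa> s) B = emeasure (uext (\<kappa> s)) A"
      using sandwich(1) by (simp add: emeasure_uext_sets)
  qed
  with sandwich(1) show thesis by (rule that)
qed

lemma measurable_uext_kernel:
  assumes \<kappa>: "\<kappa> \<in> measurable S (prob_algebra T)"
  shows "(\<lambda>s. uext (\<kappa> s)) \<in> measurable (univ_alg S) (prob_algebra (univ_alg T))"
proof (rule measurable_prob_algebraI)
  have uext_\<kappa>: "uext (\<kappa> s) \<in> space (prob_algebra (univ_alg T))" if "s \<in> space S" for s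
    by (rule uext_in_space_prob_algebra[OF measurable_space[OF \<kappa> that]])
  then show "prob_space (uext (\<kappa> s))" if "s \<in> space (univ_alg S)" for s
    using that by (simp add: prob_algebraD(1)[OF uext_\<kappa>])
  show "(\<lambda>s. uext (\<kappa> s)) \<in> measurable (univ_alg S) (subprob_algebra (univ_alg T))"
  proof (rule measurable_subprob_algebra)
    show "subprob_space (uext (\<kappa> s))" "sets (uext (\<kappa> s)) = sets (univ_alg T)"
      if "s \<in> space (univ_alg S)" for s
      using that prob_algebraD[OF uext_\<kappa>] by (simp_all add: prob_space_imp_subprob_space)
    fix A assume "A \<in> sets (univ_alg T)"
    then have A: "A \<in> univ_sets T" by (simp add: sets_univ_alg)
    show "(\<lambda>s. emeasure (uext (\<kappa> s)) A) \<in> borel_measurable (univ_alg S)"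
    proof (rule measurable_univ_algI)
      fix P assume P: "P \<in> space (prob_algebra S)"
      obtain B where B: "B \<in> sets T"
        and AE: "AE s in P. emeasure (\<kappa> s) B = emeasure (uext (\<kappa> s)) A"
        by (rule AE_emeasure_uext_kernel[OF P \<kappa> A])
      have "(\<lambda>s. emeasure (\<kappa> s) B) \<in> borel_measurable (completion P)"
        by (intro measurable_completion measurable_emeasure_kernel[OF _ B]
            measurable_kernel_of_space[OF P \<kappa>])
      then show "(\<lambda>s. emeasure (uext (\<kappa> s)) A) \<in> borel_measurable (completion P)"
        using AE by (rule measurable_completion_AE) simp
    qed simp
  qed
qed

lemma measurable_uext_univ_kernel:
  "\<kappa> \<in> measurable (univ_alg S) (prob_algebra T) \<Longrightarrow>
    (\<lambda>s. uext (\<kappa> s)) \<in> measurable (univ_alg S) (prob_algebra (univ_alg T))"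
  using measurable_uext_kernel[of \<kappa> "univ_alg S" T] by (simp add: univ_alg_idem)

lemma uext_bind:
  assumes P: "P \<in> space (prob_algebra S)" and \<kappa>: "\<kappa> \<in> measurable S (prob_algebra T)"
  shows "uext P \<bind> (\<lambda>s. uext (\<kappa> s)) = uext (P \<bind> \<kappa>)"
proof (rule uext_eqI)
  note uP = uext_in_space_prob_algebra[OF P] and u\<kappa> = measurable_uext_kernel[OF \<kappa>]
  show "prob_space (P \<bind> \<kappa>)" by (rule prob_space_bind'[OF P \<kappa>])
  show "sets (uext P \<bind> (\<lambda>s. uext (\<kappa> s))) = univ_sets (P \<bind> \<kappa>)"
    by (simp add: sets_bind'[OF uP u\<kappa>] sets_univ_alg univ_sets_cong[OF sets_bind'[OF P \<kappa>]])
  fix A assume "A \<in> sets (P \<bind> \<kappa>)"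
  then have A: "A \<in> sets T" by (simp add: sets_bind'[OF P \<kappa>])
  have "emeasure (uext P \<bind> (\<lambda>s. uext (\<kappa> s))) A = (\<integral>\<^sup>+s. emeasure (uext (\<kappa> s)) A \<partial>uext P)"
    using A by (intro emeasure_bind_prob_algebra[OF uP u\<kappa>])
       (simp add: sets_univ_alg sets_imp_univ_sets)
  also have "\<dots> = (\<integral>\<^sup>+s. emeasure (\<kappa> s) A \<partial>uext P)"
    using prob_algebraD[OF measurable_space[OF \<kappa>]] prob_algebraD(3)[OF P] A
    by (intro nn_integral_cong emeasure_uext_sets) auto
  also have "\<dots> = (\<integral>\<^sup>+s. emeasure (\<kappa> s) A \<partial>P)"
    by (intro nn_integral_uext[OF P]
        measurable_emeasure_kernel[OF measurable_prob_algebraD[OF \<kappa>] A])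
  also have "\<dots> = emeasure (P \<bind> \<kappa>) A" by (rule emeasure_bind_prob_algebra[OF P \<kappa> A, symmetric])
  finally show "emeasure (uext P \<bind> (\<lambda>s. uext (\<kappa> s))) A = emeasure (P \<bind> \<kappa>) A" .
qed

lemma measurable_distr_Pair_univ_alg:
  assumes \<kappa>: "\<kappa> \<in> measurable (univ_alg S) (prob_algebra T)"
  shows "(\<lambda>s. distr (\<kappa> s) (S \<Otimes>\<^sub>M T) (Pair s)) \<in> measurable (univ_alg S) (prob_algebra (S \<Otimes>\<^sub>M T))"
proof (rule measurable_distr_prob_space2[OF \<kappa>])
  have "(\<lambda>z. (fst z, snd z)) \<in> measurable (univ_alg S \<Otimes>\<^sub>M T) (S \<Otimes>\<^sub>M T)"
    by (intro measurable_Pair measurable_snd measurable_compose[OF measurable_fst]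
        measurable_univ_algI1)
       simp
  then show "(\<lambda>(s, t). (s, t)) \<in> measurable (univ_alg S \<Otimes>\<^sub>M T) (S \<Otimes>\<^sub>M T)" by simp
qed

lemma uext_distr_Pair:
  assumes "\<kappa> \<in> measurable (univ_alg S) (prob_algebra T)" "s \<in> space S"
  shows "uext (distr (\<kappa> s) (S \<Otimes>\<^sub>M T) (Pair s)) = distr (uext (\<kappa> s)) (univ_alg (S \<Otimes>\<^sub>M T)) (Pair s)"
  using assms by (intro uext_distr[where S = T] measurable_space[OF assms(1)]) auto

text \<open>Since \<open>univ_alg (S \<Otimes>\<^sub>M T)\<close> is finer than \<open>univ_alg S \<Otimes>\<^sub>M T\<close>, the library lemmas on
  kernels depending on a parameter do not apply; pushing the kernel forward to the product removes
  the parameter.\<close>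

lemma measurable_bind_uext:
  assumes \<kappa>: "\<kappa> \<in> measurable (univ_alg S) (prob_algebra T)"
    and f: "(\<lambda>(s, t). f s t) \<in> measurable (univ_alg (S \<Otimes>\<^sub>M T)) (prob_algebra U)"
  shows "(\<lambda>s. uext (\<kappa> s) \<bind> f s) \<in> measurable (univ_alg S) (prob_algebra U)"
proof -
  have "(\<lambda>s. uext (distr (\<kappa> s) (S \<Otimes>\<^sub>M T) (Pair s)) \<bind> (\<lambda>(s, t). f s t))
      \<in> measurable (univ_alg S) (prob_algebra U)"
    by (rule measurable_bind_prob_space[OF
          measurable_uext_univ_kernel[OF measurable_distr_Pair_univ_alg[OF \<kappa>]] f])
  also have "?this \<longleftrightarrow> ?thesis"
  proof (rule measurable_cong)
    fix s assume "s \<in> space (univ_alg S)"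
    then have s: "s \<in> space S" by simp
    have \<kappa>s: "\<kappa> s \<in> space (prob_algebra T)" using measurable_space[OF \<kappa>] s by simp
    have "Pair s \<in> measurable (uext (\<kappa> s)) (univ_alg (S \<Otimes>\<^sub>M T))"
      using s by (simp add: measurable_uext_cong[OF \<kappa>s] measurable_univ_alg_univ_alg)
    then show "uext (distr (\<kappa> s) (S \<Otimes>\<^sub>M T) (Pair s)) \<bind> (\<lambda>(s, t). f s t) = uext (\<kappa> s) \<bind> f s"
      using prob_space.not_empty[OF prob_algebraD(1)[OF \<kappa>s]]
      by (simp add: uext_distr_Pair[OF \<kappa> s] bind_distr[OF _ measurable_prob_algebraD[OF f]])
  qed
  finally show ?thesis .
qed

section \<open>Measurable selection\<close>

lemma dense_sequence:
  obtains d :: "nat \<Rightarrow> 'e::{metric_space, second_countable_topology}"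
  where "\<And>x r. r > 0 \<Longrightarrow> \<exists>i. dist (d i) x < r"
proof -
  obtain D :: "'e set" where D: "countable D" "\<And>X. open X \<Longrightarrow> X \<noteq> {} \<Longrightarrow> \<exists>d\<in>D. d \<in> X"
    using countable_dense_setE by blast
  show thesis
  proof (rule that[of "from_nat_into D"])
    fix x :: 'e and r :: real assume "r > 0"
    then obtain y where "y \<in> D" "dist y x < r"
      using D(2)[of "ball x r"] by (auto simp: dist_commute)
    moreover then obtain i where "from_nat_into D i = y"
      using from_nat_into_surj[OF D(1)] by blast
    ultimately show "\<exists>i. dist (from_nat_into D i) x < r" by auto
  qed
qed

lemma convergent_subseq_of_finite_nets:
  fixes e :: "nat \<Rightarrow> 'e::complete_space"
  assumes nets: "\<And>r. r > 0 \<Longrightarrow> \<exists>k. finite k \<and> (\<forall>\<^sub>F n in sequentially. e n \<in> (\<Union>x\<in>k. cball x r))"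
  obtains l \<phi> where "strict_mono \<phi>" "(e \<circ> \<phi>) \<longlonglongrightarrow> l"
proof -
  have "\<exists>k. finite k \<and> closure (range e) \<subseteq> (\<Union>x\<in>k. ball x r)" if r: "r > 0" for r :: real
  proof -
    obtain k m where k: "finite k" "\<And>n. n \<ge> m \<Longrightarrow> e n \<in> (\<Union>x\<in>k. cball x (r/2))"
      using nets[of "r/2"] r by (auto simp: eventually_sequentially)
    let ?k = "k \<union> e ` {..<m}"
    have "e n \<in> (\<Union>x\<in>?k. cball x (r/2))" for n
    proof (cases "n < m")
      case True
      then show ?thesis using r by (intro UN_I[of "e n"]) auto
    next
      case False
      then have "e n \<in> (\<Union>x\<in>k. cball x (r/2))" using k(2) by simp
      then show ?thesis by blast
    qed
    moreover have "closed (\<Union>x\<in>?k. cball x (r/2))" using k(1) by (intro closed_UN) auto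
    ultimately have "closure (range e) \<subseteq> (\<Union>x\<in>?k. cball x (r/2))"
      by (intro closure_minimal image_subsetI)
    also have "\<dots> \<subseteq> (\<Union>x\<in>?k. ball x r)" using r by (intro UN_mono) auto
    finally show ?thesis using k(1) by (intro exI[of _ ?k]) auto
  qed
  then have "compact (closure (range e))"
    by (simp add: compact_eq_totally_bounded complete_eq_closed)
  then show thesis
    using closure_subset[of "range e"] that
    unfolding compact_eq_seq_compact_metric seq_compact_def by (metis range_subsetD)
qed

lemma closed_section_limit:
  fixes C :: "('z::metric_space \<times> 'e::complete_space) set"
  assumes C: "closed C" and X: "\<And>n. closed (X n)" "decseq X"
    and nets: "\<And>n. \<exists>k. finite k \<and> X (Suc n) \<subseteq> (\<Union>x\<in>k. cball x (1/2^n))"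
    and p: "\<And>n. p n \<in> C" "\<And>n. snd (p n) \<in> X n" "(\<lambda>n. fst (p n)) \<longlonglongrightarrow> z"
  obtains e where "(z, e) \<in> C" "\<And>n. e \<in> X n"
proof -
  have late: "\<forall>\<^sub>F m in sequentially. snd (p m) \<in> X n" for n
    using p(2) decseqD[OF X(2)] by (intro eventually_sequentiallyI[of n]) blast
  have "\<exists>k. finite k \<and> (\<forall>\<^sub>F m in sequentially. snd (p m) \<in> (\<Union>x\<in>k. cball x r))"
    if r: "r > 0" for r :: real
  proof -
    obtain n where n: "(1/2)^n < r" using real_arch_pow_inv[OF r, of "1/2"] by auto
    obtain k where k: "finite k" "X (Suc n) \<subseteq> (\<Union>x\<in>k. cball x (1/2^n))" using nets by blast
    have net: "X (Suc n) \<subseteq> (\<Union>x\<in>k. cball x r)" using k(2) n by (force simp: power_divide)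
    from late[of "Suc n"] have "\<forall>\<^sub>F m in sequentially. snd (p m) \<in> (\<Union>x\<in>k. cball x r)"
      by eventually_elim (use net in blast)
    with k(1) show ?thesis by blast
  qed
  then obtain e \<phi> where \<phi>: "strict_mono \<phi>" and e: "((\<lambda>n. snd (p n)) \<circ> \<phi>) \<longlonglongrightarrow> e"
    using convergent_subseq_of_finite_nets[of "\<lambda>n. snd (p n)"] by blast
  have "(\<lambda>n. (fst (p (\<phi> n)), snd (p (\<phi> n)))) \<longlonglongrightarrow> (z, e)"
    using LIMSEQ_subseq_LIMSEQ[OF p(3) \<phi>] e by (intro tendsto_Pair) (simp_all add: o_def)
  then have "(z, e) \<in> C" using C p(1) closed_sequentially[of C "\<lambda>n. p (\<phi> n)"] by simp
  moreover have "e \<in> X n" for n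
    using X(1) eventually_subseq[OF \<phi> late[of n]] e
    by (intro Lim_in_closed_set[where f = "(\<lambda>n. snd (p n)) \<circ> \<phi>" and F = sequentially]) simp_all
  ultimately show thesis by (rule that)
qed

subsection \<open>Projections of closed sets are universally measurable\<close>

definition proj_over :: "('z \<times> 'e) set \<Rightarrow> 'e set \<Rightarrow> 'z set" where
  "proj_over C X = fst ` (C \<inter> UNIV \<times> X)"

lemma mem_proj_over: "z \<in> proj_over C X \<longleftrightarrow> (\<exists>e\<in>X. (z, e) \<in> C)"
  by (force simp: proj_over_def)

lemma proj_over_UNIV: "proj_over C UNIV = fst ` C"
  by (simp add: proj_over_def)

lemma proj_over_mono: "X \<subseteq> Y \<Longrightarrow> proj_over C X \<subseteq> proj_over C Y"
  unfolding proj_over_def by blast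

lemma outer_measure_of_incseq_approx:
  assumes P: "finite_measure P" and A: "incseq A" "(\<Union>k. A k) \<subseteq> space P" and \<epsilon>: "\<epsilon> > 0"
  shows "\<exists>k. outer_measure_of P (\<Union>k. A k) \<le> outer_measure_of P (A k) + ennreal \<epsilon>"
proof -
  have "outer_measure_of P (\<Union>k. A k) \<le> outer_measure_of P (space P)"
    by (rule outer_measure_of_mono[OF A(2)])
  then have "outer_measure_of P (\<Union>k. A k) \<noteq> \<top>"
    using finite_measure.emeasure_finite[OF P] by (auto simp: top_unique)
  moreover have SUP: "outer_measure_of P (\<Union>k. A k) = (SUP k. outer_measure_of P (A k))"
    using A by (intro SUP_outer_measure_of_incseq[symmetric]) auto
  ultimately obtain k where "outer_measure_of P (\<Union>k. A k) < outer_measure_of P (A k) + ennreal \<epsilon>"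
    using SUP_approx_ennreal[OF \<epsilon> UNIV_not_empty SUP] by auto
  then show ?thesis using less_imp_le by blast
qed

lemma ennreal_geometric_loss:
  fixes a :: "nat \<Rightarrow> ennreal"
  assumes "0 \<le> \<epsilon>" and loss: "\<And>n. a n \<le> a (Suc n) + ennreal (\<epsilon> / 2^Suc n)"
  shows "a 0 \<le> a n + ennreal \<epsilon>"
proof -
  have "a 0 \<le> a n + ennreal (\<epsilon> * (1 - 1/2^n))"
  proof (induction n)
    case (Suc n)
    have "a 0 \<le> (a (Suc n) + ennreal (\<epsilon> / 2^Suc n)) + ennreal (\<epsilon> * (1 - 1/2^n))"
      using Suc loss[of n] by (meson add_right_mono order_trans)
    also have "\<dots> = a (Suc n) + ennreal (\<epsilon> / 2^Suc n + \<epsilon> * (1 - 1/2^n))"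
      using \<open>0 \<le> \<epsilon>\<close> by (simp add: add.assoc ennreal_plus)
    also have "\<epsilon> / 2^Suc n + \<epsilon> * (1 - 1/2^n) = \<epsilon> * (1 - 1/2^Suc n)" by (simp add: field_simps)
    finally show ?case .
  qed simp
  also have "\<dots> \<le> a n + ennreal \<epsilon>"
    using \<open>0 \<le> \<epsilon>\<close> by (intro add_left_mono ennreal_leI) (simp add: mult_left_le)
  finally show ?thesis .
qed

lemma outer_measure_proj_over_refine:
  fixes C :: "('z::topological_space \<times> 'e) set"
  assumes P: "P \<in> space (prob_algebra (borel :: 'z measure))" and \<epsilon>: "\<epsilon> > 0"
    and B: "incseq B" "(\<Union>k. B k) = UNIV"
  shows "\<exists>k. outer_measure_of P (proj_over C X)
      \<le> outer_measure_of P (proj_over C (X \<inter> B k)) + ennreal \<epsilon>"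
proof -
  have "proj_over C X = (\<Union>k. proj_over C (X \<inter> B k))"
    using B(2) by (simp add: set_eq_iff mem_proj_over) blast
  moreover have "incseq (\<lambda>k. proj_over C (X \<inter> B k))"
    using B(1) unfolding incseq_def by (intro allI impI proj_over_mono Int_mono order_refl) simp
  ultimately show ?thesis
    using outer_measure_of_incseq_approx[of P "\<lambda>k. proj_over C (X \<inter> B k)" \<epsilon>]
      prob_space.finite_measure[OF prob_algebraD(1)[OF P]] prob_algebraD(3)[OF P] \<epsilon>
    by auto
qed

lemma outer_measure_proj_over_scheme:
  fixes C :: "('z::topological_space \<times> 'e::polish_space) set"
  assumes P: "P \<in> space (prob_algebra (borel :: 'z measure))" and \<epsilon>: "\<epsilon> > 0"
  obtains X where "\<And>n. closed (X n)" "decseq X"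
    "\<And>n. \<exists>k. finite k \<and> X (Suc n) \<subseteq> (\<Union>x\<in>k. cball x (1/2^n))"
    "\<And>n. outer_measure_of P (fst ` C) \<le> outer_measure_of P (proj_over C (X n)) + ennreal \<epsilon>"
proof -
  obtain d :: "nat \<Rightarrow> 'e" where d: "\<And>x r. r > 0 \<Longrightarrow> \<exists>i. dist (d i) x < r"
    using dense_sequence by blast
  define B where "B n k = (\<Union>i\<le>k. cball (d i) (1/2^n))" for n k :: nat
  let ?\<mu> = "\<lambda>X. outer_measure_of P (proj_over C X)"
  have refine: "\<exists>k. ?\<mu> X \<le> ?\<mu> (X \<inter> B n k) + ennreal (\<epsilon> / 2^Suc n)" for X n
  proof -
    have "\<exists>k. x \<in> B n k" for x
    proof -
      obtain i where "dist (d i) x < 1/2^n" using d[of "1/2^n" x] by auto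
      then show ?thesis by (intro exI[of _ i]) (auto simp: B_def intro!: bexI[of _ i])
    qed
    then have "(\<Union>k. B n k) = UNIV" by blast
    moreover have "incseq (B n)" unfolding incseq_def B_def by fastforce
    ultimately show ?thesis using outer_measure_proj_over_refine[OF P, of "\<epsilon> / 2^Suc n" "B n"] \<epsilon>
      by simp
  qed
  have "\<exists>X. \<forall>n. (closed (X n) \<and> (n = 0 \<longrightarrow> X n = UNIV)) \<and>
    (\<exists>k. X (Suc n) = X n \<inter> B n k \<and> ?\<mu> (X n) \<le> ?\<mu> (X (Suc n)) + ennreal (\<epsilon> / 2^Suc n))"
  proof (rule dependent_nat_choice)
    fix X :: "'e set" and n :: nat assume "closed X \<and> (n = 0 \<longrightarrow> X = UNIV)"
    moreover have "closed (B n k)" for k unfolding B_def by (intro closed_UN) auto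
    moreover obtain k where "?\<mu> X \<le> ?\<mu> (X \<inter> B n k) + ennreal (\<epsilon> / 2^Suc n)"
      using refine[of X n] by blast
    ultimately show "\<exists>Y. (closed Y \<and> (Suc n = 0 \<longrightarrow> Y = UNIV)) \<and>
      (\<exists>k. Y = X \<inter> B n k \<and> ?\<mu> X \<le> ?\<mu> Y + ennreal (\<epsilon> / 2^Suc n))"
      by (intro exI[of _ "X \<inter> B n k"] conjI exI[of _ k]) (simp_all add: closed_Int)
  qed auto
  then obtain X k where X: "\<And>n. closed (X n)" "X 0 = UNIV" "\<And>n. X (Suc n) = X n \<inter> B n (k n)"
    and loss: "\<And>n. ?\<mu> (X n) \<le> ?\<mu> (X (Suc n)) + ennreal (\<epsilon> / 2^Suc n)"
    by metis
  show thesis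
  proof (rule that[of X])
    show "\<exists>k. finite k \<and> X (Suc n) \<subseteq> (\<Union>x\<in>k. cball x (1/2^n))" for n
      by (rule exI[of _ "d ` {..k n}"]) (auto simp: X(3) B_def)
    show "outer_measure_of P (fst ` C) \<le> ?\<mu> (X n) + ennreal \<epsilon>" for n
      using ennreal_geometric_loss[of \<epsilon> "\<lambda>n. ?\<mu> (X n)" n] loss \<epsilon> by (simp add: X(2) proj_over_UNIV)
    show "decseq X" by (rule decseq_SucI) (simp add: X(3))
  qed (rule X(1))
qed

lemma INT_closure_proj_over_subset:
  fixes C :: "('z::metric_space \<times> 'e::polish_space) set"
  assumes C: "closed C" and X: "\<And>n. closed (X n)" "decseq X"
    "\<And>n. \<exists>k. finite k \<and> X (Suc n) \<subseteq> (\<Union>x\<in>k. cball x (1/2^n))"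
  shows "(\<Inter>n. closure (proj_over C (X n))) \<subseteq> fst ` C"
proof
  fix z assume "z \<in> (\<Inter>n. closure (proj_over C (X n)))"
  then have z: "z \<in> closure (proj_over C (X n))" for n by blast
  have "\<exists>p. p \<in> C \<and> snd p \<in> X n \<and> dist (fst p) z < inverse (real (Suc n))" for n
  proof -
    obtain y where "y \<in> proj_over C (X n)" "dist y z < inverse (real (Suc n))"
      using z[of n] unfolding closure_approachable
      by (metis inverse_positive_iff_positive of_nat_0_less_iff zero_less_Suc)
    then obtain e where "e \<in> X n" "(y, e) \<in> C" by (auto simp: mem_proj_over)
    then show ?thesis using \<open>dist y z < _\<close> by (intro exI[of _ "(y, e)"]) simp
  qed
  then obtain p where p: "\<And>n. p n \<in> C" "\<And>n. snd (p n) \<in> X n"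
    and dist_p: "\<And>n. dist (fst (p n)) z < inverse (real (Suc n))"
    by metis
  have "(\<lambda>n. fst (p n)) \<longlonglongrightarrow> z"
    unfolding tendsto_dist_iff[of "\<lambda>n. fst (p n)"]
    by (rule Lim_null_comparison[OF _ LIMSEQ_inverse_real_of_nat])
       (use dist_p in \<open>auto intro!: always_eventually less_imp_le\<close>)
  then obtain e where "(z, e) \<in> C" using closed_section_limit[OF C X p] by blast
  then show "z \<in> fst ` C" by force
qed

text \<open>Capacitability: the projection is exhausted from inside by projections of compact pieces,
  cut out by finitely many small balls on every scale, and those are closed.\<close>

lemma proj_closed_inner_approx:
  fixes C :: "('z::metric_space \<times> 'e::polish_space) set"
  assumes C: "closed C" and P: "P \<in> space (prob_algebra borel)" and \<epsilon>: "\<epsilon> > 0"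
  obtains K where "closed K" "K \<subseteq> fst ` C" "outer_measure_of P (fst ` C) \<le> emeasure P K + ennreal \<epsilon>"
proof -
  interpret prob_space P by (rule prob_algebraD(1)[OF P])
  obtain X where X: "\<And>n. closed (X n)" "decseq X"
      "\<And>n. \<exists>k. finite k \<and> X (Suc n) \<subseteq> (\<Union>x\<in>k. cball x (1/2^n))"
    and outer_X: "\<And>n. outer_measure_of P (fst ` C)
        \<le> outer_measure_of P (proj_over C (X n)) + ennreal \<epsilon>"
    by (rule outer_measure_proj_over_scheme[OF P \<epsilon>]) blast
  define K where "K n = closure (proj_over C (X n))" for n
  have K_sets: "K n \<in> sets P" for n using prob_algebraD(2)[OF P] by (simp add: K_def)
  have dec_K: "decseq K"
    unfolding decseq_def K_def using decseqD[OF X(2)]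
    by (intro allI impI closure_mono proj_over_mono)
  show thesis
  proof (rule that[of "\<Inter>n. K n"])
    show "closed (\<Inter>n. K n)" by (auto simp: K_def)
    show "(\<Inter>n. K n) \<subseteq> fst ` C" unfolding K_def by (rule INT_closure_proj_over_subset[OF C X])
    have "outer_measure_of P (fst ` C) - ennreal \<epsilon> \<le> emeasure P (K n)" for n
    proof -
      have "outer_measure_of P (proj_over C (X n)) \<le> outer_measure_of P (K n)"
        unfolding K_def by (intro outer_measure_of_mono closure_subset)
      then have "outer_measure_of P (fst ` C) \<le> emeasure P (K n) + ennreal \<epsilon>"
        using outer_X[of n] outer_measure_of_eq[OF K_sets[of n]]
        by (metis add_right_mono order_trans)
      then show ?thesis by (simp add: ennreal_minus_le_iff add.commute)
    qed
    then have "outer_measure_of P (fst ` C) - ennreal \<epsilon> \<le> (INF n. emeasure P (K n))"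
      by (rule INF_greatest)
    also have "\<dots> = emeasure P (\<Inter>n. K n)"
      using K_sets by (intro INF_emeasure_decseq[OF _ dec_K]) auto
    finally show "outer_measure_of P (fst ` C) \<le> emeasure P (\<Inter>n. K n) + ennreal \<epsilon>"
      by (simp add: ennreal_minus_le_iff add.commute)
  qed
qed

lemma sets_completion_inner_approx:
  assumes P: "finite_measure P" and A: "A \<subseteq> space P"
    and inner: "\<And>\<epsilon>. \<epsilon> > 0 \<Longrightarrow> \<exists>K\<in>sets P. K \<subseteq> A \<and> outer_measure_of P A \<le> emeasure P K + ennreal \<epsilon>"
  shows "A \<in> sets (completion P)"
proof -
  interpret finite_measure P by (rule P)
  have "\<exists>K\<in>sets P. K \<subseteq> A \<and> outer_measure_of P A \<le> emeasure P K + ennreal (inverse (Suc n))" for n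
    by (rule inner) simp
  then obtain K where K: "\<And>n. K n \<in> sets P" "\<And>n. K n \<subseteq> A"
    "\<And>n. outer_measure_of P A \<le> emeasure P (K n) + ennreal (inverse (Suc n))"
    by metis
  define U where "U = (\<Union>n. K n)"
  have U: "U \<in> sets P" "U \<subseteq> A" using K by (auto simp: U_def)
  obtain E where E: "E \<in> sets P" "A \<subseteq> E" "outer_measure_of P A = emeasure P E"
    using outer_measure_of_attain[OF A] by blast
  have "emeasure P E \<le> emeasure P U + ennreal \<epsilon>" if \<epsilon>: "\<epsilon> > 0" for \<epsilon> :: real
  proof -
    obtain n where "inverse (real (Suc n)) < \<epsilon>" using reals_Archimedean[OF \<epsilon>] by blast
    moreover have "emeasure P (K n) \<le> emeasure P U"
      using U by (intro emeasure_mono) (auto simp: U_def)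
    ultimately show ?thesis
      using K(3)[of n] unfolding E(3) by (meson add_mono ennreal_leI less_imp_le order_trans)
  qed
  then have "emeasure P E \<le> emeasure P U" by (rule ennreal_le_epsilon)
  then have "emeasure P (E - U) = 0"
    using U E by (subst emeasure_Diff) (auto intro: diff_eq_0_ennreal simp: less_top[symmetric])
  then have "E - U \<in> null_sets P" using E(1) U(1) by (intro null_setsI sets.Diff)
  moreover have "A = U \<union> (A - U)" "A - U \<subseteq> E - U" using U(2) E(2) by auto
  ultimately show ?thesis using U(1) by (intro sets_completionI[of A U "A - U" "E - U"])
qed

theorem fst_image_closed_univ_sets:
  fixes C :: "('z::metric_space \<times> 'e::polish_space) set"
  assumes "closed C"
  shows "fst ` C \<in> univ_sets borel"
proof -
  have "fst ` C \<in> sets (completion P)" if P: "P \<in> space (prob_algebra borel)" for P :: "'z measure"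
  proof (rule sets_completion_inner_approx)
    show "finite_measure P" by (rule prob_space.finite_measure[OF prob_algebraD(1)[OF P]])
    show "\<exists>K\<in>sets P. K \<subseteq> fst ` C \<and> outer_measure_of P (fst ` C) \<le> emeasure P K + ennreal \<epsilon>"
      if "\<epsilon> > 0" for \<epsilon>
      using proj_closed_inner_approx[OF assms P that] prob_algebraD(2)[OF P] by (metis borel_closed)
  qed (simp add: prob_algebraD(3)[OF P])
  then show ?thesis by (simp add: univ_sets_eq)
qed

subsection \<open>Analytic sets\<close>

definition analytic :: "'p::topological_space set \<Rightarrow> bool" where
  "analytic G \<longleftrightarrow> (\<exists>C :: ('p \<times> (nat \<Rightarrow> nat discrete)) set. closed C \<and> G = fst ` C)"

lemma analytic_closed: "closed A \<Longrightarrow> analytic A"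
  unfolding analytic_def by (intro exI[of _ "A \<times> UNIV"]) (auto intro: closed_Times)

lemma continuous_on_snd_coord:
  "continuous_on UNIV (\<lambda>x :: 'a::topological_space \<times> ('i \<Rightarrow> 'b::topological_space). snd x j)"
  by (rule continuous_on_product_then_coordinatewise[OF continuous_on_snd[OF continuous_on_id]])

lemma closed_reindex_vimage:
  fixes C :: "('a::topological_space \<times> ('i \<Rightarrow> 'b::topological_space)) set" and \<phi> :: "'i \<Rightarrow> 'j"
  assumes "closed C"
  shows "closed {x. (fst x, \<lambda>i. snd x (\<phi> i)) \<in> C}"
proof -
  have "continuous_on UNIV (\<lambda>x :: 'a \<times> ('j \<Rightarrow> 'b). (fst x, \<lambda>i. snd x (\<phi> i)))"
    by (intro continuous_on_Pair continuous_on_fst continuous_on_id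
        continuous_on_coordinatewise_then_product continuous_on_snd_coord)
  from closed_vimage[OF assms this] show ?thesis by (simp add: vimage_def)
qed

lemma analytic_UN:
  assumes "\<And>n::nat. analytic (A n)"
  shows "analytic (\<Union>n. A n)"
proof -
  obtain C :: "nat \<Rightarrow> ('a \<times> (nat \<Rightarrow> nat discrete)) set"
    where C: "\<And>n. closed (C n)" "\<And>n. A n = fst ` C n"
    using assms unfolding analytic_def by metis
  define D where "D = (\<Inter>n. {x. snd x 0 \<noteq> discrete n} \<union> {x. (fst x, \<lambda>i. snd x (Suc i)) \<in> C n})"
  have "closed D"
    unfolding D_def
  proof (intro closed_INT ballI closed_Un closed_reindex_vimage C(1))
    fix n :: nat
    have "closed (- {discrete n})" by (simp add: open_discrete closed_def)
    from closed_vimage[OF this continuous_on_snd_coord[of 0]]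
    show "closed {x :: 'a \<times> (nat \<Rightarrow> nat discrete). snd x 0 \<noteq> discrete n}" by (simp add: vimage_def)
  qed
  moreover have "(\<Union>n. A n) = fst ` D"
  proof (intro set_eqI iffI)
    fix p assume "p \<in> (\<Union>n. A n)"
    then obtain n b where "(p, b) \<in> C n" by (auto simp: C(2))
    then have "(p, case_nat (discrete n) b) \<in> D" by (auto simp: D_def discrete_inject)
    then show "p \<in> fst ` D" by force
  next
    fix p assume "p \<in> fst ` D"
    then obtain b where b: "(p, b) \<in> D" by auto
    obtain n where "b 0 = discrete n" by (cases "b 0")
    then have "(p, \<lambda>i. b (Suc i)) \<in> C n" using b by (auto simp: D_def)
    then show "p \<in> (\<Union>n. A n)" by (force simp: C(2))
  qed
  ultimately show ?thesis unfolding analytic_def by blast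
qed

lemma analytic_INT:
  assumes "\<And>n::nat. analytic (A n)"
  shows "analytic (\<Inter>n. A n)"
proof -
  obtain C :: "nat \<Rightarrow> ('a \<times> (nat \<Rightarrow> nat discrete)) set"
    where C: "\<And>n. closed (C n)" "\<And>n. A n = fst ` C n"
    using assms unfolding analytic_def by metis
  define D where "D = (\<Inter>n. {x. (fst x, \<lambda>k. snd x (prod_encode (n, k))) \<in> C n})"
  have "closed D" unfolding D_def by (intro closed_INT ballI closed_reindex_vimage C(1))
  moreover have "(\<Inter>n. A n) = fst ` D"
  proof (intro set_eqI iffI)
    fix p assume "p \<in> (\<Inter>n. A n)"
    then have "\<exists>b. (p, b) \<in> C n" for n using C(2)[of n] by (auto simp: image_iff) force
    then obtain b where "\<And>n. (p, b n) \<in> C n" by metis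
    then have "(p, \<lambda>j. b (fst (prod_decode j)) (snd (prod_decode j))) \<in> D" by (simp add: D_def)
    then show "p \<in> fst ` D" by force
  next
    fix p assume "p \<in> fst ` D"
    then obtain b where "\<And>n. (p, \<lambda>k. b (prod_encode (n, k))) \<in> C n" by (auto simp: D_def)
    then show "p \<in> (\<Inter>n. A n)" by (force simp: C(2))
  qed
  ultimately show ?thesis unfolding analytic_def by blast
qed

lemma analytic_open:
  fixes U :: "'p::metric_space set"
  assumes "open U"
  shows "analytic U"
proof (cases "U = UNIV")
  case True
  then show ?thesis by (simp add: analytic_closed)
next
  case False
  then have infdist_pos: "x \<in> U \<longleftrightarrow> 0 < infdist x (- U)" for x
    using in_closed_iff_infdist_zero[of "- U" x] infdist_nonneg[of x "- U"] \<open>open U\<close>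
    by (auto simp: closed_Compl less_le)
  have "U = (\<Union>n. {x. inverse (real (Suc n)) \<le> infdist x (- U)})"
  proof (intro set_eqI iffI)
    fix x assume "x \<in> U"
    then obtain n where "inverse (real (Suc n)) < infdist x (- U)"
      using reals_Archimedean infdist_pos by blast
    then show "x \<in> (\<Union>n. {x. inverse (real (Suc n)) \<le> infdist x (- U)})" by (auto intro: less_imp_le)
  next
    fix x assume "x \<in> (\<Union>n. {x. inverse (real (Suc n)) \<le> infdist x (- U)})"
    then obtain n where "inverse (real (Suc n)) \<le> infdist x (- U)" by blast
    moreover have "0 < inverse (real (Suc n))" by simp
    ultimately show "x \<in> U" unfolding infdist_pos by linarith
  qed
  also have "analytic \<dots>"
    by (intro analytic_UN analytic_closed closed_Collect_le continuous_intros)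
  finally show ?thesis .
qed

lemma borel_imp_analytic:
  fixes G :: "'p::metric_space set"
  assumes "G \<in> sets borel"
  shows "analytic G"
proof -
  have "G \<in> sigma_sets UNIV {S. open S}" using assms by (simp add: borel_def)
  then have "analytic G \<and> analytic (- G)"
  proof induction
    case (Basic a)
    then show ?case by (simp add: analytic_open analytic_closed closed_Compl)
  next
    case Empty
    show ?case by (simp add: analytic_closed)
  next
    case (Compl a)
    then show ?case by (simp add: Compl_eq_Diff_UNIV[symmetric])
  next
    case (Union a)
    then have "analytic (\<Union>n. a n)" "analytic (\<Inter>n. - a n)" by (auto intro: analytic_UN analytic_INT)
    then show ?case by simp
  qed
  then show ?thesis ..
qed

subsection \<open>Selection\<close>

lemma measurable_branch:
  fixes A :: "nat list \<Rightarrow> 'z set"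
  assumes A[measurable]: "\<And>l. A l \<in> sets M"
    and extend: "\<And>l z. z \<in> A l \<Longrightarrow> \<exists>i. z \<in> A (i # l)"
  obtains branch :: "'z \<Rightarrow> nat \<Rightarrow> nat list"
  where "\<And>z n. \<exists>i. branch z (Suc n) = i # branch z n"
    "\<And>n. (\<lambda>z. branch z n) \<in> measurable M (count_space UNIV)"
    "\<And>z n. length (branch z n) = n" "\<And>z n. z \<in> A [] \<Longrightarrow> z \<in> A (branch z n)"
proof -
  define branch where "branch z = rec_nat [] (\<lambda>_ l. (LEAST i. z \<in> A (i # l)) # l)" for z
  have branch_0: "branch z 0 = []" for z by (simp add: branch_def)
  have branch_Suc: "branch z (Suc n) = (LEAST i. z \<in> A (i # branch z n)) # branch z n" for z n
    by (simp add: branch_def)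
  show thesis
  proof (rule that[of branch])
    show "(\<lambda>z. branch z n) \<in> measurable M (count_space UNIV)" for n
    proof (induction n)
      case (Suc n)
      have "(\<lambda>z. (LEAST i. z \<in> A (i # l)) # l) \<in> measurable M (count_space UNIV)" for l
        by measurable
      then show ?case unfolding branch_Suc by (rule measurable_compose_countable[OF _ Suc])
    qed (simp add: branch_0)
    show "length (branch z n) = n" for z n by (induction n) (simp_all add: branch_0 branch_Suc)
    show "z \<in> A (branch z n)" if "z \<in> A []" for z n
      using that
    proof (induction n)
      case (Suc n)
      then have "z \<in> A (branch z n)" by simp
      then show ?case unfolding branch_Suc by (rule LeastI_ex[OF extend])
    qed (simp add: branch_0)
  qed (simp add: branch_Suc)
qed

lemma closed_section_limit_of_centres:
  fixes C :: "('z::metric_space \<times> 'e::polish_space) set"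
  assumes C: "closed C" and X: "\<And>n. closed (X n)" "\<And>n. X (Suc n) = X n \<inter> cball (c n) (1/2^n)"
    and z: "\<And>n. z \<in> proj_over C (X n)"
  shows "\<exists>e. (z, e) \<in> C \<and> c \<longlonglongrightarrow> e"
proof -
  have "\<exists>e. (z, e) \<in> C \<and> e \<in> X n" for n using z[of n] by (auto simp: mem_proj_over)
  then obtain e where e: "\<And>n. (z, e n) \<in> C" "\<And>n. e n \<in> X n" by metis
  have "\<exists>k. finite k \<and> X (Suc n) \<subseteq> (\<Union>x\<in>k. cball x (1/2^n))" for n
    by (rule exI[of _ "{c n}"]) (simp add: X(2))
  moreover have "decseq X" by (rule decseq_SucI) (simp add: X(2))
  ultimately obtain l where l: "(z, l) \<in> C" "\<And>n. l \<in> X n"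
    using closed_section_limit[where X = X and p = "\<lambda>n. (z, e n)" and z = z, OF C X(1)] e by auto
  have "dist (c n) l \<le> (1/2)^n" for n using l(2)[of "Suc n"] by (simp add: X(2) power_divide)
  then have "(\<lambda>n. dist (c n) l) \<longlonglongrightarrow> 0"
    by (intro Lim_null_comparison[OF _ LIMSEQ_realpow_zero[of "1/2"]] always_eventually) simp_all
  with l(1) show ?thesis by (auto simp: tendsto_dist_iff[of c])
qed

primrec ball_scheme :: "(nat \<Rightarrow> 'e::metric_space) \<Rightarrow> nat list \<Rightarrow> 'e set" where
  "ball_scheme d [] = UNIV"
| "ball_scheme d (i # l) = ball_scheme d l \<inter> cball (d i) (1/2^length l)"

lemma closed_ball_scheme: "closed (ball_scheme d l)"
  by (induction l) auto

lemma sets_proj_over_ball_scheme: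
  fixes C :: "('z::metric_space \<times> 'e::polish_space) set"
  assumes "closed C"
  shows "proj_over C (ball_scheme d l) \<in> sets (univ_alg borel)"
  unfolding sets_univ_alg proj_over_def
  by (intro fst_image_closed_univ_sets closed_Int assms closed_Times closed_ball_scheme closed_UNIV)

lemma proj_over_ball_scheme_extend:
  assumes d: "\<And>x r. r > 0 \<Longrightarrow> \<exists>i. dist (d i) x < r" and z: "z \<in> proj_over C (ball_scheme d l)"
  shows "\<exists>i. z \<in> proj_over C (ball_scheme d (i # l))"
proof -
  obtain e where "e \<in> ball_scheme d l" "(z, e) \<in> C" using z by (auto simp: mem_proj_over)
  moreover obtain i where "dist (d i) e < 1/2^length l" using d[of "1/2^length l" e] by auto
  ultimately show ?thesis by (intro exI[of _ i]) (auto simp: mem_proj_over)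
qed

lemma closed_selection:
  fixes C :: "('z::metric_space \<times> 'e::polish_space) set"
  assumes C: "closed C"
  obtains s where "s \<in> measurable (univ_alg borel) borel" "\<And>z. z \<in> fst ` C \<Longrightarrow> (z, s z) \<in> C"
proof -
  obtain d :: "nat \<Rightarrow> 'e" where d: "\<And>x r. r > 0 \<Longrightarrow> \<exists>i. dist (d i) x < r"
    using dense_sequence by blast
  obtain branch
    where branch_Suc: "\<And>z n. \<exists>i. branch z (Suc n) = i # branch z n"
      and branch_measurable: "\<And>n. (\<lambda>z. branch z n) \<in> measurable (univ_alg borel) (count_space UNIV)"
      and length_branch: "\<And>z n. length (branch z n) = n"
      and branch: "\<And>z n. z \<in> fst ` C \<Longrightarrow> z \<in> proj_over C (ball_scheme d (branch z n))"
    using measurable_branch[OF sets_proj_over_ball_scheme[OF C] proj_over_ball_scheme_extend[OF d]]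
    by (metis ball_scheme.simps(1) proj_over_UNIV)
  define centre where "centre n z = (if z \<in> fst ` C then d (hd (branch z (Suc n))) else d 0)"
    for n z
  have ball_scheme_branch_Suc: "ball_scheme d (branch z (Suc n))
      = ball_scheme d (branch z n) \<inter> cball (d (hd (branch z (Suc n)))) (1/2^n)" for z n
    using branch_Suc[of z n] by (force simp: length_branch)
  have "\<exists>e. (z \<in> fst ` C \<longrightarrow> (z, e) \<in> C) \<and> (\<lambda>n. centre n z) \<longlonglongrightarrow> e" for z
  proof (cases "z \<in> fst ` C")
    case True
    then show ?thesis
      using closed_section_limit_of_centres[OF C closed_ball_scheme ball_scheme_branch_Suc branch]
      by (simp add: centre_def)
  qed (auto simp: centre_def)
  then obtain s where s: "\<And>z. z \<in> fst ` C \<Longrightarrow> (z, s z) \<in> C" "\<And>z. (\<lambda>n. centre n z) \<longlonglongrightarrow> s z" by metis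
  have "fst ` C \<in> sets (univ_alg borel)"
    using fst_image_closed_univ_sets[OF C] by (simp add: sets_univ_alg)
  moreover have "(\<lambda>z. d (hd (branch z (Suc n)))) \<in> borel_measurable (univ_alg borel)" for n
    by (rule measurable_compose[OF branch_measurable]) simp
  ultimately have "centre n \<in> borel_measurable (univ_alg borel)" for n
    unfolding centre_def by measurable
  then have "s \<in> borel_measurable (univ_alg borel)"
    by (rule borel_measurable_LIMSEQ_metric[OF _ s(2)])
  with s(1) show thesis by (intro that)
qed

instance prod :: (polish_space, polish_space) polish_space ..

theorem Jankov_von_Neumann:
  fixes G :: "('z::polish_space \<times> 'e::polish_space) set"
  assumes "G \<in> sets borel"
  obtains s where "s \<in> measurable (univ_alg borel) borel" "\<And>z e. (z, e) \<in> G \<Longrightarrow> (z, s z) \<in> G"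
proof -
  obtain C :: "(('z \<times> 'e) \<times> (nat \<Rightarrow> nat discrete)) set" where C: "closed C" "G = fst ` C"
    using borel_imp_analytic[OF assms] by (auto simp: analytic_def)
  define C' where "C' = {x. ((fst x, fst (snd x)), snd (snd x)) \<in> C}"
  have "closed C'"
    unfolding C'_def
    using closed_vimage[OF C(1), of "\<lambda>x. ((fst x, fst (snd x)), snd (snd x))"]
    by (simp add: vimage_def continuous_intros)
  then obtain s where s: "s \<in> measurable (univ_alg borel) borel" "\<And>z. z \<in> fst ` C' \<Longrightarrow> (z, s z) \<in> C'"
    by (rule closed_selection) blast
  show thesis
  proof (rule that[of "\<lambda>z. fst (s z)"])
    show "(\<lambda>z. fst (s z)) \<in> borel_measurable (univ_alg borel)"
      by (rule measurable_compose[OF s(1)])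
         (intro borel_measurable_continuous_onI continuous_intros)
    fix z e assume "(z, e) \<in> G"
    then obtain b where "(z, (e, b)) \<in> C'" by (auto simp: C(2) C'_def)
    then have "(z, s z) \<in> C'" by (intro s(2)) force
    then show "(z, fst (s z)) \<in> G" by (force simp: C'_def C(2))
  qed
qed

section \<open>Countably generated spaces\<close>

lemma finite_measure_eqI_Int_stable:
  assumes E: "Int_stable E" "E \<subseteq> Pow \<Omega>" and M: "finite_measure M"
    and sets: "sets M = sigma_sets \<Omega> E" "sets N = sigma_sets \<Omega> E"
    and total: "emeasure M \<Omega> = emeasure N \<Omega>"
    and eq: "\<And>A. A \<in> E \<Longrightarrow> emeasure M A = emeasure N A"
  shows "M = N"
proof (rule measure_eqI_generator_eq[where E = "insert \<Omega> E" and \<Omega> = \<Omega> and A = "\<lambda>_. \<Omega>"])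
  show "Int_stable (insert \<Omega> E)" using E by (auto simp: Int_stable_def Int_absorb1 Int_absorb2)
  have "sigma_sets \<Omega> (insert \<Omega> E) = sigma_sets \<Omega> E"
    using E(2) by (intro sigma_sets_eqI) (auto intro: sigma_sets_top)
  then show "sets M = sigma_sets \<Omega> (insert \<Omega> E)" "sets N = sigma_sets \<Omega> (insert \<Omega> E)"
    by (simp_all add: sets)
  show "emeasure M \<Omega> \<noteq> \<infinity>" using finite_measure.emeasure_finite[OF M] by simp
qed (use E total eq in auto)

lemma prob_measure_eqI_Int_stable:
  assumes "Int_stable E" "E \<subseteq> Pow (space S)" "sets S = sigma_sets (space S) E"
    and P: "P \<in> space (prob_algebra S)" and Q: "Q \<in> space (prob_algebra S)"
    and eq: "\<And>A. A \<in> E \<Longrightarrow> emeasure P A = emeasure Q A"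
  shows "P = Q"
proof (rule finite_measure_eqI_Int_stable[OF assms(1,2) _ _ _ _ eq])
  show "finite_measure P" by (rule prob_space.finite_measure[OF prob_algebraD(1)[OF P]])
  show "sets P = sigma_sets (space S) E" "sets Q = sigma_sets (space S) E"
    using assms(3) prob_algebraD(2)[OF P] prob_algebraD(2)[OF Q] by simp_all
  show "emeasure P (space S) = emeasure Q (space S)"
    using in_space_prob_algebra[OF P] in_space_prob_algebra[OF Q] by simp
qed

lemma countable_Int_stable_generator:
  obtains U :: "nat \<Rightarrow> 'a::second_countable_topology set"
  where "Int_stable (range U)" "sets borel = sigma_sets UNIV (range U)"
proof -
  obtain B :: "'a set set" where B: "countable B" "topological_basis B"
    using ex_countable_basis by blast
  define E where "E = Inter ` {F. finite F \<and> F \<subseteq> B}"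
  have "countable E" unfolding E_def by (intro countable_image countable_Collect_finite_subset B(1))
  moreover have "UNIV \<in> E" unfolding E_def by (rule image_eqI[of _ _ "{}"]) auto
  ultimately have range_E: "range (from_nat_into E) = E"
    by (intro range_from_nat_into) auto
  have "Int_stable E"
  proof (rule Int_stableI)
    fix X Y assume "X \<in> E" "Y \<in> E"
    then obtain F G where "finite F" "F \<subseteq> B" "X = \<Inter>F" "finite G" "G \<subseteq> B" "Y = \<Inter>G"
      by (auto simp: E_def)
    then have "finite (F \<union> G)" "F \<union> G \<subseteq> B" "X \<inter> Y = \<Inter>(F \<union> G)" by auto
    then show "X \<inter> Y \<in> E" unfolding E_def by blast
  qed
  moreover have "sets borel = sigma_sets UNIV E"
  proof (rule antisym)
    have "B \<subseteq> E"
      unfolding E_def by (intro subsetI image_eqI[of _ _ "{b}" for b]) auto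
    then have "sigma_sets UNIV B \<subseteq> sigma_sets UNIV E" by (rule sigma_sets_mono')
    then show "sets borel \<subseteq> sigma_sets UNIV E"
      unfolding borel_eq_countable_basis[OF B] by (simp only: sets_measure_of Pow_UNIV subset_UNIV)
    have "E \<subseteq> sets borel"
      using topological_basis_open[OF B(2)] by (auto simp: E_def intro!: borel_open open_Inter)
    then show "sigma_sets UNIV E \<subseteq> sets borel" using sets.sigma_sets_subset[of E borel] by simp
  qed
  ultimately show thesis using that[of "from_nat_into E"] by (simp add: range_E)
qed

lemma measurable_kernel_eq:
  fixes \<kappa> \<rho> :: "'z \<Rightarrow> 'a::second_countable_topology measure"
  assumes \<kappa>: "\<kappa> \<in> measurable M (prob_algebra borel)" and \<rho>: "\<rho> \<in> measurable M (prob_algebra borel)"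
  shows "{z \<in> space M. \<kappa> z = \<rho> z} \<in> sets M"
proof -
  obtain U :: "nat \<Rightarrow> 'a set" where U: "Int_stable (range U)"
      "sets borel = sigma_sets UNIV (range U)"
    by (rule countable_Int_stable_generator)
  have sets_U: "U n \<in> sets borel" for n unfolding U(2) by blast
  have "\<kappa> z = \<rho> z \<longleftrightarrow> (\<forall>n. emeasure (\<kappa> z) (U n) = emeasure (\<rho> z) (U n))" if "z \<in> space M" for z
    using prob_measure_eqI_Int_stable[of "range U" borel "\<kappa> z" "\<rho> z"] U
      measurable_space[OF \<kappa> that] measurable_space[OF \<rho> that]
    by auto
  then have "{z \<in> space M. \<kappa> z = \<rho> z}
      = {z \<in> space M. \<forall>n. emeasure (\<kappa> z) (U n) = emeasure (\<rho> z) (U n)}" by blast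
  also have "\<dots> \<in> sets M"
  proof -
    have [measurable]: "(\<lambda>z. emeasure (\<kappa> z) (U n)) \<in> borel_measurable M"
      "(\<lambda>z. emeasure (\<rho> z) (U n)) \<in> borel_measurable M" for n
      using \<kappa> \<rho> by (auto intro: measurable_emeasure_kernel measurable_prob_algebraD sets_U)
    show ?thesis by measurable
  qed
  finally show ?thesis .
qed

section \<open>Embedding Polish spaces into the unit interval\<close>

definition cantor_code :: "(nat \<Rightarrow> bool) \<Rightarrow> real" where
  "cantor_code a = (\<Sum>n. of_bool (a n) / 3 ^ Suc n)"

definition cantor_digit :: "nat \<Rightarrow> real \<Rightarrow> bool" where
  "cantor_digit n r \<longleftrightarrow> 1 \<le> 3 * ((\<lambda>r. frac (3 * r)) ^^ n) r"

lemma ternary_sums: "(\<lambda>n. 1 / 3 ^ Suc n :: real) sums (1/2)"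
  using sums_mult[OF geometric_sums[of "1/3::real"], of "1/3"] by (simp add: power_divide)

lemma summable_cantor_code: "summable (\<lambda>n. of_bool (a n) / 3 ^ Suc n :: real)"
  by (rule summable_comparison_test'[OF sums_summable[OF ternary_sums], of 0]) auto

lemma cantor_code_bounds: "0 \<le> cantor_code a" "cantor_code a \<le> 1/2"
proof -
  show "0 \<le> cantor_code a"
    unfolding cantor_code_def by (intro suminf_nonneg summable_cantor_code) simp
  have "cantor_code a \<le> (\<Sum>n. 1 / 3 ^ Suc n)"
    unfolding cantor_code_def
    by (intro suminf_le summable_cantor_code sums_summable[OF ternary_sums]) simp
  then show "cantor_code a \<le> 1/2" using sums_unique[OF ternary_sums] by simp
qed

lemma cantor_code_shift: "3 * cantor_code a = of_bool (a 0) + cantor_code (\<lambda>n. a (Suc n))"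
proof -
  have "(\<Sum>n. of_bool (a (Suc n)) / 3 ^ Suc (Suc n)) = cantor_code a - of_bool (a 0) / 3"
    using suminf_split_head[OF summable_cantor_code[of a]] by (simp add: cantor_code_def)
  moreover have "(\<Sum>n. of_bool (a (Suc n)) / 3 ^ Suc (Suc n)) = cantor_code (\<lambda>n. a (Suc n)) / 3"
    using suminf_divide[OF summable_cantor_code[of "\<lambda>n. a (Suc n)"], of 3]
    by (simp add: cantor_code_def mult.commute)
  ultimately show ?thesis by simp
qed

lemma cantor_digit_code: "cantor_digit n (cantor_code a) \<longleftrightarrow> a n"
proof -
  have "frac (3 * cantor_code a) = cantor_code (\<lambda>n. a (Suc n))" for a
    unfolding cantor_code_shift[of a] using cantor_code_bounds[of "\<lambda>n. a (Suc n)"]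
    by (cases "a 0") (simp_all add: frac_eq frac_1_eq add.commute[of 1])
  then have "((\<lambda>r. frac (3 * r)) ^^ n) (cantor_code a) = cantor_code (\<lambda>k. a (k + n))"
    by (induction n) simp_all
  then show ?thesis
    using cantor_code_shift[of "\<lambda>k. a (k + n)"] cantor_code_bounds[of "\<lambda>k. a (Suc k + n)"]
    by (cases "a n") (simp_all add: cantor_digit_def)
qed

lemma measurable_cantor_digit [measurable]: "Measurable.pred borel (cantor_digit n)"
proof -
  have "(\<lambda>r::real. frac (3 * r)) \<in> borel_measurable borel" unfolding frac_def by measurable
  then have "((\<lambda>r::real. frac (3 * r)) ^^ n) \<in> borel_measurable borel"
    by (induction n) (auto intro: measurable_compose simp: comp_def)
  then show ?thesis unfolding cantor_digit_def[abs_def] by measurable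
qed

lemma measurable_cantor_code:
  assumes [measurable]: "\<And>n. Measurable.pred M (\<lambda>x. b x n)"
  shows "(\<lambda>x. cantor_code (b x)) \<in> borel_measurable M"
  unfolding cantor_code_def by measurable

lemma measurable_pointwise_limit_inverse:
  fixes c :: "nat \<Rightarrow> 'b \<Rightarrow> 'a::polish_space"
  assumes c[measurable]: "\<And>k. c k \<in> borel_measurable M"
    and lim: "\<And>x. (\<lambda>k. c k (f x)) \<longlonglongrightarrow> x"
  obtains g where "g \<in> borel_measurable M" "\<And>x. f x \<in> space M \<Longrightarrow> g (f x) = x"
proof -
  define S where "S = {r \<in> space M. Cauchy (\<lambda>k. c k r)}"
  have [measurable]: "S \<in> sets M" unfolding S_def by measurable
  define g where "g r = (if r \<in> S then lim (\<lambda>k. c k r) else undefined)" for r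
  show thesis
  proof (rule that[of g])
    show "g \<in> borel_measurable M"
    proof (rule borel_measurable_LIMSEQ_metric)
      show "(\<lambda>r. if r \<in> S then c k r else undefined) \<in> borel_measurable M" for k by measurable
      show "(\<lambda>k. if r \<in> S then c k r else undefined) \<longlonglongrightarrow> g r" for r
        by (auto simp: g_def S_def Cauchy_convergent_iff convergent_LIMSEQ_iff)
    qed
    show "g (f x) = x" if "f x \<in> space M" for x
      using that limI[OF lim[of x]] LIMSEQ_imp_Cauchy[OF lim[of x]] by (simp add: g_def S_def)
  qed
qed

text \<open>A point is coded by recording to which of the balls of radius \<open>1/2\<^sup>k\<close> around the points of a
  dense sequence it belongs.\<close>

theorem polish_embedding_unit_interval:
  obtains f :: "'a::polish_space \<Rightarrow> real" and g :: "real \<Rightarrow> 'a"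
  where "f \<in> borel_measurable borel" "g \<in> borel_measurable borel" "\<And>x. g (f x) = x"
    "\<And>x. f x \<in> {0..1}"
proof -
  obtain d :: "nat \<Rightarrow> 'a" where d: "\<And>x r. r > 0 \<Longrightarrow> \<exists>i. dist (d i) x < r"
    using dense_sequence by blast
  define near where "near x n = (case prod_decode n of (k, i) \<Rightarrow> dist (d i) x < 1/2^k)" for x n
  define f where "f x = cantor_code (near x)" for x
  define centre where "centre k r = d (LEAST i. cantor_digit (prod_encode (k, i)) r)" for k r
  have "dist (centre k (f x)) x < 1/2^k" for k x
  proof -
    have digit: "cantor_digit (prod_encode (k, i)) (f x) \<longleftrightarrow> dist (d i) x < 1/2^k" for i
      by (simp add: f_def cantor_digit_code near_def)
    show ?thesis using LeastI_ex[OF d[of "1/2^k" x]] by (simp add: centre_def digit)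
  qed
  then have "(\<lambda>k. dist (centre k (f x)) x) \<longlonglongrightarrow> 0" for x
    by (intro Lim_null_comparison[OF _ LIMSEQ_realpow_zero[of "1/2"]] always_eventually)
       (simp_all add: power_divide less_imp_le)
  then have lim: "(\<lambda>k. centre k (f x)) \<longlonglongrightarrow> x" for x
    by (simp add: tendsto_dist_iff[of "\<lambda>k. centre k (f x)"])
  have "centre k \<in> borel_measurable borel" for k
    unfolding centre_def by (rule measurable_compose[of _ _ "count_space UNIV"]) measurable
  then obtain g where g: "g \<in> borel_measurable borel" "\<And>x. g (f x) = x"
    using measurable_pointwise_limit_inverse[of centre borel f] lim by auto
  have "open {x. near x n}" for n
    unfolding near_def by (cases "prod_decode n") (auto intro!: open_Collect_less continuous_intros)
  then have "f \<in> borel_measurable borel"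
    unfolding f_def by (intro measurable_cantor_code) (simp add: pred_def)
  moreover have "f x \<in> {0..1}" for x using cantor_code_bounds[of "near x"] by (simp add: f_def)
  ultimately show thesis using g by (intro that)
qed

section \<open>Distribution functions on the unit interval\<close>

definition unit_cdf :: "(rat \<Rightarrow> real) \<Rightarrow> bool" where
  "unit_cdf e \<longleftrightarrow> (\<forall>r s. r \<le> s \<longrightarrow> e r \<le> e s) \<and> (\<forall>r<0. e r = 0) \<and> (\<forall>r\<ge>1. e r = 1) \<and>
    (\<forall>r k. \<exists>s>r. e s < e r + inverse (real (Suc k)))"

definition cdf_extension :: "(rat \<Rightarrow> real) \<Rightarrow> real \<Rightarrow> real" where
  "cdf_extension e x = (INF r\<in>{r. x < real_of_rat r}. e r)"

text \<open>The value at sequences that are not distribution functions is chosen only to make the map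
  measurable.\<close>

definition unit_cdf_measure :: "(rat \<Rightarrow> real) \<Rightarrow> real measure" where
  "unit_cdf_measure e = (if unit_cdf e then interval_measure (cdf_extension e) else return borel 0)"

lemma unit_cdfD:
  assumes "unit_cdf e"
  shows "r \<le> s \<Longrightarrow> e r \<le> e s" "r < 0 \<Longrightarrow> e r = 0" "1 \<le> r \<Longrightarrow> e r = 1"
    "0 < \<epsilon> \<Longrightarrow> \<exists>s>r. e s < e r + \<epsilon>"
proof -
  show "r \<le> s \<Longrightarrow> e r \<le> e s" "r < 0 \<Longrightarrow> e r = 0" "1 \<le> r \<Longrightarrow> e r = 1"
    using assms by (simp_all add: unit_cdf_def)
  assume "0 < \<epsilon>"
  then obtain k where "inverse (real (Suc k)) < \<epsilon>" using reals_Archimedean by blast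
  moreover obtain s where "s > r" "e s < e r + inverse (real (Suc k))"
    using assms unfolding unit_cdf_def by blast
  ultimately show "\<exists>s>r. e s < e r + \<epsilon>" by (intro exI[of _ s]) auto
qed

lemma unit_cdfI:
  assumes "\<And>r s. r \<le> s \<Longrightarrow> e r \<le> e s" "\<And>r. r < 0 \<Longrightarrow> e r = 0" "\<And>r. 1 \<le> r \<Longrightarrow> e r = 1"
    and "\<And>r \<epsilon>. 0 < \<epsilon> \<Longrightarrow> \<exists>s>r. e s < e r + \<epsilon>"
  shows "unit_cdf e"
  using assms by (simp add: unit_cdf_def)

lemma unit_cdf_bounds:
  assumes "unit_cdf e"
  shows "0 \<le> e r" "e r \<le> 1"
  using unit_cdfD(1)[OF assms, of "min r (-1)" r] unit_cdfD(2)[OF assms, of "min r (-1)"]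
    unit_cdfD(1)[OF assms, of r "max r 1"] unit_cdfD(3)[OF assms, of "max r 1"]
  by simp_all

lemma ex_real_of_rat_gt: "{r. x < real_of_rat r} \<noteq> {}"
  using of_rat_dense[of x "x + 1"] by auto

context
  fixes e :: "rat \<Rightarrow> real"
  assumes e: "unit_cdf e"
begin

lemma bdd_below_unit_cdf: "bdd_below (e ` A)"
  using unit_cdf_bounds[OF e] by (intro bdd_belowI[of _ 0]) auto

lemma cdf_extension_mono: "x \<le> y \<Longrightarrow> cdf_extension e x \<le> cdf_extension e y"
  unfolding cdf_extension_def
  by (intro cINF_superset_mono bdd_below_unit_cdf ex_real_of_rat_gt) auto

lemma cdf_extension_right_continuous: "continuous (at_right x) (cdf_extension e)"
proof (subst continuous_at_right_real_increasing, fact cdf_extension_mono, intro allI impI)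
  fix \<epsilon> :: real assume "0 < \<epsilon>"
  then obtain r where r: "x < real_of_rat r" "e r < cdf_extension e x + \<epsilon>"
    using cINF_less_iff[OF ex_real_of_rat_gt bdd_below_unit_cdf, of x "cdf_extension e x + \<epsilon>"]
    by (auto simp: cdf_extension_def)
  define \<eta> where "\<eta> = (real_of_rat r - x) / 2"
  have \<eta>: "\<eta> > 0" "x + \<eta> < real_of_rat r" using r(1) by (auto simp: \<eta>_def field_simps)
  then have "cdf_extension e (x + \<eta>) \<le> e r"
    unfolding cdf_extension_def by (intro cINF_lower bdd_below_unit_cdf) simp
  with \<eta>(1) r(2) show "\<exists>\<eta>>0. cdf_extension e (x + \<eta>) - cdf_extension e x < \<epsilon>" by force
qed

lemma cdf_extension_of_rat: "cdf_extension e (real_of_rat r) = e r"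
proof (rule antisym)
  show "e r \<le> cdf_extension e (real_of_rat r)"
    unfolding cdf_extension_def
    by (intro cINF_greatest ex_real_of_rat_gt) (auto simp: of_rat_less intro: unit_cdfD(1)[OF e])
  show "cdf_extension e (real_of_rat r) \<le> e r"
  proof (rule field_le_epsilon)
    fix \<epsilon> :: real assume "0 < \<epsilon>"
    then obtain s where s: "s > r" "e s < e r + \<epsilon>" using unit_cdfD(4)[OF e] by blast
    have "cdf_extension e (real_of_rat r) \<le> e s"
      unfolding cdf_extension_def
      using s(1) by (intro cINF_lower bdd_below_unit_cdf) (simp add: of_rat_less)
    with s(2) show "cdf_extension e (real_of_rat r) \<le> e r + \<epsilon>" by linarith
  qed
qed

lemma cdf_extension_outside:
  "x < 0 \<Longrightarrow> cdf_extension e x = 0" "1 \<le> x \<Longrightarrow> cdf_extension e x = 1"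
proof -
  have nonneg: "0 \<le> cdf_extension e x" and le_1: "cdf_extension e x \<le> 1"
    using unit_cdf_bounds[OF e] ex_real_of_rat_gt[of x] bdd_below_unit_cdf
    unfolding cdf_extension_def by (auto intro!: cINF_greatest intro: cINF_lower2)
  show "cdf_extension e x = 0" if neg: "x < 0"
  proof -
    obtain r where r: "x < real_of_rat r" "real_of_rat r < 0" using of_rat_dense[OF neg] by auto
    then have "cdf_extension e x \<le> e r"
      using cdf_extension_mono[of x "real_of_rat r"] by (simp add: cdf_extension_of_rat)
    then show ?thesis using nonneg unit_cdfD(2)[OF e, of r] r(2) by simp
  qed
  show "cdf_extension e x = 1" if "1 \<le> x"
    using cdf_extension_mono[OF that] cdf_extension_of_rat[of 1] le_1 unit_cdfD(3)[OF e, of 1]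
    by simp
qed

lemma unit_cdf_measure_eq:
  "real_distribution (unit_cdf_measure e)" "cdf (unit_cdf_measure e) = cdf_extension e"
proof -
  have "\<forall>\<^sub>F x in at_bot. cdf_extension e x = 0"
    using eventually_gt_at_bot[of 0] by eventually_elim (rule cdf_extension_outside)
  then have bot: "(cdf_extension e \<longlongrightarrow> 0) at_bot" by (rule tendsto_eventually)
  have "\<forall>\<^sub>F x in at_top. cdf_extension e x = 1"
    using eventually_ge_at_top[of 1] by eventually_elim (rule cdf_extension_outside)
  then have top: "(cdf_extension e \<longlongrightarrow> 1) at_top" by (rule tendsto_eventually)
  show "real_distribution (unit_cdf_measure e)"
    using e by (simp add: unit_cdf_measure_def real_distribution_interval_measure
        cdf_extension_mono cdf_extension_right_continuous bot top)
  show "cdf (unit_cdf_measure e) = cdf_extension e"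
    using e by (simp add: unit_cdf_measure_def cdf_interval_measure
        cdf_extension_mono cdf_extension_right_continuous bot)
qed

lemma emeasure_unit_cdf_measure: "emeasure (unit_cdf_measure e) {..real_of_rat r} = ennreal (e r)"
proof -
  interpret real_distribution "unit_cdf_measure e" by (rule unit_cdf_measure_eq)
  have "measure (unit_cdf_measure e) {..real_of_rat r} = e r"
    using fun_cong[OF unit_cdf_measure_eq(2), of "real_of_rat r"]
    by (simp add: cdf_def cdf_extension_of_rat)
  then show ?thesis by (simp add: emeasure_eq_measure)
qed

end

lemma unit_cdf_measure_in_space_prob_algebra: "unit_cdf_measure e \<in> space (prob_algebra borel)"
proof (cases "unit_cdf e")
  case True
  interpret real_distribution "unit_cdf_measure e" by (rule unit_cdf_measure_eq[OF True])
  show ?thesis by (simp add: space_prob_algebra prob_space_axioms)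
next
  case False
  then show ?thesis by (simp add: unit_cdf_measure_def return_in_space_prob_algebra)
qed

lemma Int_stable_rat_rays: "Int_stable (range (\<lambda>r. {..real_of_rat r}))"
proof (rule Int_stableI_image)
  fix r s :: rat
  show "\<exists>t\<in>UNIV. {..real_of_rat r} \<inter> {..real_of_rat s} = {..real_of_rat t}"
    by (rule bexI[of _ "min r s"]) (auto simp: min_def of_rat_less_eq)
qed

lemma borel_eq_sigma_rat_rays: "borel = sigma UNIV (range (\<lambda>r. {..real_of_rat r}))"
proof (rule borel_eq_sigmaI1[OF borel_eq_atMost])
  fix X :: "real set" assume "X \<in> range atMost"
  then obtain a where "X = {..a}" by blast
  also have "\<dots> = (\<Inter>r\<in>{r. a < real_of_rat r}. {..real_of_rat r})"
  proof (intro equalityI subsetI)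
    fix y assume y: "y \<in> (\<Inter>r\<in>{r. a < real_of_rat r}. {..real_of_rat r})"
    show "y \<in> {..a}"
    proof (rule ccontr)
      assume "y \<notin> {..a}"
      then obtain r where "a < real_of_rat r" "real_of_rat r < y" using of_rat_dense[of a y] by auto
      then show False using y by force
    qed
  qed auto
  also have "\<dots> \<in> sets (sigma UNIV (range (\<lambda>r. {..real_of_rat r})))"
    using ex_real_of_rat_gt by (intro sets.countable_INT') auto
  finally show "X \<in> sets (sigma UNIV (range (\<lambda>r. {..real_of_rat r})))" .
qed auto

lemma sets_borel_eq_rat_rays: "sets borel = sigma_sets UNIV (range (\<lambda>r. {..real_of_rat r}))"
  by (subst borel_eq_sigma_rat_rays) simp

lemma measurable_unit_cdf: "Measurable.pred borel unit_cdf"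
proof -
  have [measurable]: "(\<lambda>e :: rat \<Rightarrow> real. e r) \<in> borel_measurable borel" for r
    by (rule measurable_product_coordinates)
  have [measurable]: "Measurable.pred borel (\<lambda>e :: rat \<Rightarrow> real. e r \<le> e s)" for r s
    using borel_measurable_le[of "\<lambda>e. e r" borel "\<lambda>e. e s"] by (simp add: pred_def)
  show ?thesis unfolding unit_cdf_def by measurable
qed

lemma measurable_unit_cdf_measure: "unit_cdf_measure \<in> measurable borel (prob_algebra borel)"
proof (rule measurable_prob_algebra_generated[OF sets_borel_eq_rat_rays Int_stable_rat_rays])
  show "prob_space (unit_cdf_measure e)" "sets (unit_cdf_measure e) = sets borel" for e
    by (rule prob_algebraD[OF unit_cdf_measure_in_space_prob_algebra])+
  fix A :: "real set" assume "A \<in> range (\<lambda>r. {..real_of_rat r})"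
  then obtain r where A: "A = {..real_of_rat r}" by blast
  have "emeasure (unit_cdf_measure e) A = (if unit_cdf e then ennreal (e r) else indicator A 0)"
      for e
    using emeasure_unit_cdf_measure by (simp add: A unit_cdf_measure_def)
  moreover have "(\<lambda>e. if unit_cdf e then ennreal (e r) else indicator A 0) \<in> borel_measurable borel"
    using measurable_product_coordinates[of r] measurable_unit_cdf
    by (intro measurable_If) (auto simp: pred_def)
  ultimately show "(\<lambda>e. emeasure (unit_cdf_measure e) A) \<in> borel_measurable borel" by simp
qed simp

lemma less_0_of_le_of_rat: "x \<le> real_of_rat r \<Longrightarrow> r < 0 \<Longrightarrow> x < 0"
  by (meson le_less_trans of_rat_less_0_iff)

lemma le_of_rat_of_le_1: "x \<le> 1 \<Longrightarrow> 1 \<le> r \<Longrightarrow> x \<le> real_of_rat r"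
  by (rule order_trans[of x 1]) simp_all

lemma unit_cdf_of_prob_measure:
  fixes \<nu> :: "real measure"
  assumes \<nu>: "\<nu> \<in> space (prob_algebra borel)" and supp: "measure \<nu> {0..1} = 1"
  shows "unit_cdf (\<lambda>r. measure \<nu> {..real_of_rat r})"
proof -
  interpret real_distribution \<nu>
    using prob_algebraD[OF \<nu>] by (simp add: real_distribution_def real_distribution_axioms_def)
  have "unit_cdf (\<lambda>r. cdf \<nu> (real_of_rat r))"
  proof (rule unit_cdfI)
    show "cdf \<nu> (real_of_rat r) \<le> cdf \<nu> (real_of_rat s)" if "r \<le> s" for r s
      using that by (intro cdf_nondecreasing) (simp add: of_rat_less_eq)
    show "cdf \<nu> (real_of_rat r) = 0" if "r < 0" for r
    proof -
      have "{..real_of_rat r} \<subseteq> space \<nu> - {0..1}" using less_0_of_le_of_rat[OF _ that] by fastforce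
      then have "cdf \<nu> (real_of_rat r) \<le> measure \<nu> (space \<nu> - {0..1})"
        unfolding cdf_def by (intro finite_measure_mono) auto
      also have "\<dots> = 0" using supp by (subst prob_compl) auto
      finally show ?thesis using cdf_nonneg[of "real_of_rat r"] by simp
    qed
    show "cdf \<nu> (real_of_rat r) = 1" if "1 \<le> r" for r
    proof -
      have "measure \<nu> {0..1} \<le> cdf \<nu> (real_of_rat r)"
        unfolding cdf_def using that by (intro finite_measure_mono) auto
      then show ?thesis using supp cdf_bounded_prob[of "real_of_rat r"] by simp
    qed
    fix r and \<epsilon> :: real assume "0 < \<epsilon>"
    then obtain \<eta> where \<eta>: "\<eta> > 0" "cdf \<nu> (real_of_rat r + \<eta>) - cdf \<nu> (real_of_rat r) < \<epsilon>"
      using continuous_at_right_real_increasing[of "cdf \<nu>" "real_of_rat r"]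
      by (auto simp: cdf_is_right_cont cdf_nondecreasing)
    obtain s where s: "real_of_rat r < real_of_rat s" "real_of_rat s < real_of_rat r + \<eta>"
      using of_rat_dense[of "real_of_rat r" "real_of_rat r + \<eta>"] \<eta>(1) by auto
    then have "cdf \<nu> (real_of_rat s) \<le> cdf \<nu> (real_of_rat r + \<eta>)" by (intro cdf_nondecreasing) simp
    with s(1) \<eta>(2) show "\<exists>s>r. cdf \<nu> (real_of_rat s) < cdf \<nu> (real_of_rat r) + \<epsilon>"
      by (intro exI[of _ s]) (simp add: of_rat_less)
  qed
  then show ?thesis by (simp add: cdf_def)
qed

theorem polish_prob_measure_coding:
  obtains decode :: "(rat \<Rightarrow> real) \<Rightarrow> 'a::polish_space measure"
  where "decode \<in> measurable borel (prob_algebra borel)"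
    "\<And>\<nu>. \<nu> \<in> space (prob_algebra borel) \<Longrightarrow> \<exists>e. decode e = \<nu>"
proof -
  obtain f :: "'a \<Rightarrow> real" and g where f: "f \<in> borel_measurable borel"
    and g: "g \<in> borel_measurable borel"
    and g_f: "\<And>x. g (f x) = x" and f_bounds: "\<And>x. f x \<in> {0..1}"
    using polish_embedding_unit_interval by blast
  show thesis
  proof (rule that[of "\<lambda>e. distr (unit_cdf_measure e) borel g"])
    show "(\<lambda>e. distr (unit_cdf_measure e) borel g) \<in> borel \<rightarrow>\<^sub>M prob_algebra borel"
      by (rule measurable_compose[OF measurable_unit_cdf_measure measurable_distr_prob_space[OF g]])
    fix \<nu> :: "'a measure" assume \<nu>: "\<nu> \<in> space (prob_algebra borel)"
    interpret prob_space \<nu> by (rule prob_algebraD[OF \<nu>])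
    have f\<nu>: "f \<in> borel_measurable \<nu>" using f by (simp add: measurable_prob_algebra_cong[OF \<nu>])
    let ?D = "distr \<nu> borel f"
    have D: "?D \<in> space (prob_algebra borel)" by (rule distr_in_space_prob_algebra[OF \<nu> f])
    have "f -` {0..1} \<inter> space \<nu> = space \<nu>" using f_bounds by auto
    then have "measure ?D {0..1} = 1" using f\<nu> prob_space by (subst measure_distr) auto
    from unit_cdf_of_prob_measure[OF D this]
    have cdf_D: "unit_cdf (\<lambda>r. measure ?D {..real_of_rat r})" .
    have "unit_cdf_measure (\<lambda>r. measure ?D {..real_of_rat r}) = ?D"
    proof (rule prob_measure_eqI_Int_stable[OF Int_stable_rat_rays _ _
          unit_cdf_measure_in_space_prob_algebra D])
      show "sets borel = sigma_sets (space borel) (range (\<lambda>r. {..real_of_rat r}))"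
        by (simp add: sets_borel_eq_rat_rays)
      interpret D: prob_space ?D by (rule prob_algebraD[OF D])
      show "emeasure (unit_cdf_measure (\<lambda>r. measure ?D {..real_of_rat r})) A = emeasure ?D A"
        if "A \<in> range (\<lambda>r. {..real_of_rat r})" for A
        using that by (auto simp: emeasure_unit_cdf_measure[OF cdf_D] D.emeasure_eq_measure)
    qed simp
    moreover have "distr ?D borel g = \<nu>"
      using g f\<nu> prob_algebraD(2)[OF \<nu>] by (simp add: distr_distr o_def g_f distr_id2)
    ultimately show "\<exists>e. distr (unit_cdf_measure e) borel g = \<nu>" by metis
  qed
qed

section \<open>Radon-Nikodym derivatives of kernels\<close>

lemma (in prob_space) square_expectation_abs_le:
  fixes f :: "'a \<Rightarrow> real"
  assumes "f \<in> borel_measurable M" "integrable M (\<lambda>x. (f x)\<^sup>2)"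
  shows "(expectation (\<lambda>x. \<bar>f x\<bar>))\<^sup>2 \<le> expectation (\<lambda>x. (f x)\<^sup>2)"
proof -
  have "integrable M f" by (rule square_integrable_imp_integrable[OF assms])
  then have "variance (\<lambda>x. \<bar>f x\<bar>) = expectation (\<lambda>x. (f x)\<^sup>2) - (expectation (\<lambda>x. \<bar>f x\<bar>))\<^sup>2"
    using assms(2) by (subst variance_eq) simp_all
  then show ?thesis using variance_positive[of "\<lambda>x. \<bar>f x\<bar>"] by simp
qed

lemma (in prob_space) emeasure_density_bounded:
  fixes f :: "'a \<Rightarrow> real"
  assumes [measurable]: "f \<in> borel_measurable M" "B \<in> sets M" and f: "\<And>x. 0 \<le> f x" "\<And>x. f x \<le> 1"
  shows "integrable M (\<lambda>x. f x * indicator B x)"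
    and "emeasure (density M (\<lambda>x. ennreal (f x))) B = ennreal (\<integral>x. f x * indicator B x \<partial>M)"
proof -
  show int: "integrable M (\<lambda>x. f x * indicator B x)"
    using f by (intro integrable_const_bound[where B = 1] AE_I2) (auto split: split_indicator)
  have "emeasure (density M (\<lambda>x. ennreal (f x))) B = (\<integral>\<^sup>+x. ennreal (f x * indicator B x) \<partial>M)"
    by (subst emeasure_density) (auto intro!: nn_integral_cong split: split_indicator)
  also have "\<dots> = ennreal (\<integral>x. f x * indicator B x \<partial>M)"
    using f by (intro nn_integral_eq_integral[OF int]) auto
  finally show "emeasure (density M (\<lambda>x. ennreal (f x))) B = ennreal (\<integral>x. f x * indicator B x \<partial>M)" .
qed

lemma AE_convergent_of_summable_increments:
  fixes f :: "nat \<Rightarrow> 'a \<Rightarrow> real"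
  assumes f[measurable]: "\<And>k. f k \<in> borel_measurable M"
    and increments: "\<And>k. (\<integral>\<^sup>+x. ennreal \<bar>f (Suc k) x - f k x\<bar> \<partial>M) \<le> ennreal (a k)"
    and a: "summable a" "\<And>k. 0 \<le> a k"
  shows "AE x in M. convergent (\<lambda>k. f k x)"
proof -
  have "(\<integral>\<^sup>+x. (\<Sum>k. ennreal \<bar>f (Suc k) x - f k x\<bar>) \<partial>M)
      = (\<Sum>k. \<integral>\<^sup>+x. ennreal \<bar>f (Suc k) x - f k x\<bar> \<partial>M)"
    by (rule nn_integral_suminf) simp
  also have "\<dots> \<le> (\<Sum>k. ennreal (a k))" by (intro suminf_le increments summableI)
  also have "\<dots> = ennreal (\<Sum>k. a k)" by (rule suminf_ennreal2[OF a(2,1)])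
  also have "\<dots> < \<infinity>" by simp
  finally have "AE x in M. (\<Sum>k. ennreal \<bar>f (Suc k) x - f k x\<bar>) \<noteq> \<infinity>"
    by (intro nn_integral_noteq_infinite) auto
  then show ?thesis
  proof eventually_elim
    case (elim x)
    then have "summable (\<lambda>k. \<bar>f (Suc k) x - f k x\<bar>)" by (intro summable_suminf_not_top) auto
    then have "convergent (\<lambda>n. \<Sum>k<n. f (Suc k) x - f k x)"
      using summable_rabs_cancel summable_iff_convergent by blast
    then have "convergent (\<lambda>n. f n x - f 0 x)"
      by (simp only: sum_lessThan_telescope[of "\<lambda>k. f k x"])
    from convergent_add[OF this convergent_const[of "f 0 x"]] show ?case by simp
  qed
qed

text \<open>On the finite algebra generated by the first \<open>n\<close> generators the derivative is the ratio of
  the masses of the atoms. These ratios form an \<open>L\<^sup>2\<close>-bounded martingale; a subsequence chosen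
  measurably in the parameter converges almost everywhere for every parameter.\<close>

locale dominated_kernels =
  fixes \<Theta> :: "'t measure" and N :: "'y measure" and P \<nu> :: "'t \<Rightarrow> 'y measure" and U :: "nat \<Rightarrow> 'y set"
  assumes P: "P \<in> measurable \<Theta> (prob_algebra N)" and \<nu>: "\<nu> \<in> measurable \<Theta> (subprob_algebra N)"
    and dominated: "\<theta> \<in> space \<Theta> \<Longrightarrow> B \<in> sets N \<Longrightarrow> emeasure (\<nu> \<theta>) B \<le> emeasure (P \<theta>) B"
    and generator: "sets N = sigma_sets (space N) (range U)"
begin

definition itinerary :: "nat \<Rightarrow> 'y \<Rightarrow> nat set" where
  "itinerary n y = {i. i < n \<and> y \<in> U i}"

definition atom :: "nat \<Rightarrow> nat set \<Rightarrow> 'y set" where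
  "atom n J = {y \<in> space N. itinerary n y = J}"

definition ratio :: "nat \<Rightarrow> 't \<Rightarrow> 'y \<Rightarrow> real" where
  "ratio n \<theta> y = measure (\<nu> \<theta>) (atom n (itinerary n y)) / measure (P \<theta>) (atom n (itinerary n y))"

definition energy :: "'t \<Rightarrow> nat \<Rightarrow> real" where
  "energy \<theta> n = (\<Sum>J\<in>Pow {..<n}. (measure (\<nu> \<theta>) (atom n J))\<^sup>2 / measure (P \<theta>) (atom n J))"

definition stage :: "'t \<Rightarrow> nat \<Rightarrow> nat" where
  "stage \<theta> k = (LEAST n. k \<le> n \<and> (\<forall>m\<ge>n. energy \<theta> m - energy \<theta> n \<le> ((1/4)^k)\<^sup>2))"

definition derivative :: "'t \<Rightarrow> 'y \<Rightarrow> real" where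
  "derivative \<theta> y = max 0 (min 1 (lim (\<lambda>k. ratio (stage \<theta> k) \<theta> y)))"

lemma itinerary_in_Pow: "itinerary n y \<in> Pow {..<n}"
  by (auto simp: itinerary_def)

lemma itinerary_restrict: "n \<le> m \<Longrightarrow> itinerary n y = itinerary m y \<inter> {..<n}"
  by (auto simp: itinerary_def)

lemma sets_generator: "U i \<in> sets N"
  unfolding generator by blast

lemma sets_atom [measurable]: "atom n J \<in> sets N"
proof (cases "J \<subseteq> {..<n}")
  case True
  then have "atom n J = {y \<in> space N. \<forall>i<n. y \<in> U i \<longleftrightarrow> i \<in> J}" by (auto simp: atom_def itinerary_def)
  moreover have [measurable]: "U i \<in> sets N" for i by (rule sets_generator)
  have "{y \<in> space N. \<forall>i<n. y \<in> U i \<longleftrightarrow> i \<in> J} \<in> sets N" by measurable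
  ultimately show ?thesis by simp
next
  case False
  then have "atom n J = {}" by (auto simp: atom_def itinerary_def)
  then show ?thesis by simp
qed

lemma measurable_itinerary: "itinerary n \<in> measurable N (count_space (Pow {..<n}))"
proof -
  have "itinerary n -` {J} \<inter> space N = atom n J" for J by (auto simp: atom_def)
  then show ?thesis using itinerary_in_Pow by (subst measurable_count_space_eq2) auto
qed

lemma integral_of_itinerary:
  fixes G :: "nat set \<Rightarrow> real"
  assumes "finite_measure \<mu>" and sets_\<mu>[measurable_cong]: "sets \<mu> = sets N"
  shows "(\<integral>y. G (itinerary n y) \<partial>\<mu>) = (\<Sum>J\<in>Pow {..<n}. G J * measure \<mu> (atom n J))"
proof -
  interpret finite_measure \<mu> by fact
  have space_\<mu>: "space \<mu> = space N" by (rule sets_eq_imp_space_eq[OF sets_\<mu>])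
  have "G (itinerary n y) = (\<Sum>J\<in>Pow {..<n}. G J * indicator (atom n J) y)" if "y \<in> space N" for y
  proof -
    have "(\<Sum>J\<in>Pow {..<n}. G J * indicator (atom n J) y)
        = (\<Sum>J\<in>{itinerary n y}. G J * indicator (atom n J) y)"
      using itinerary_in_Pow by (intro sum.mono_neutral_right) (auto simp: atom_def indicator_def)
    then show ?thesis using that by (simp add: atom_def)
  qed
  then have "(\<integral>y. G (itinerary n y) \<partial>\<mu>) = (\<integral>y. (\<Sum>J\<in>Pow {..<n}. G J * indicator (atom n J) y) \<partial>\<mu>)"
    by (intro Bochner_Integration.integral_cong) (simp_all add: space_\<mu>)
  also have "\<dots> = (\<Sum>J\<in>Pow {..<n}. (\<integral>y. G J * indicator (atom n J) y \<partial>\<mu>))"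
    by (rule Bochner_Integration.integral_sum) (simp add: emeasure_eq_measure)
  also have "\<dots> = (\<Sum>J\<in>Pow {..<n}. G J * measure \<mu> (atom n J))"
    using sets.sets_into_space[OF sets_atom] by (simp add: space_\<mu> Int_absorb2)
  finally show ?thesis .
qed

lemma measurable_ratio: "(\<lambda>(\<theta>, y). ratio n \<theta> y) \<in> borel_measurable (\<Theta> \<Otimes>\<^sub>M N)"
proof -
  have [measurable]: "(\<lambda>\<theta>. measure (P \<theta>) (atom n J)) \<in> borel_measurable \<Theta>"
    "(\<lambda>\<theta>. measure (\<nu> \<theta>) (atom n J)) \<in> borel_measurable \<Theta>" for J
    by (rule measurable_compose[OF P] measurable_compose[OF \<nu>], measurable)+
  have "(\<lambda>(\<theta>, y). measure (\<nu> \<theta>) (atom n J) / measure (P \<theta>) (atom n J))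
      \<in> borel_measurable (\<Theta> \<Otimes>\<^sub>M N)" for J
    by measurable
  from measurable_compose_countable'[OF this
      measurable_compose[OF measurable_snd measurable_itinerary]]
  show ?thesis by (simp add: ratio_def split_beta' countable_finite)
qed

lemma measurable_derivative: "(\<lambda>(\<theta>, y). derivative \<theta> y) \<in> borel_measurable (\<Theta> \<Otimes>\<^sub>M N)"
proof -
  have [measurable]: "(\<lambda>\<theta>. measure (P \<theta>) (atom n J)) \<in> borel_measurable \<Theta>"
    "(\<lambda>\<theta>. measure (\<nu> \<theta>) (atom n J)) \<in> borel_measurable \<Theta>" for n J
    by (rule measurable_compose[OF P] measurable_compose[OF \<nu>], measurable)+
  have [measurable]: "(\<lambda>\<theta>. energy \<theta> n) \<in> borel_measurable \<Theta>" for n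
    unfolding energy_def by measurable
  have "(\<lambda>\<theta>. stage \<theta> k) \<in> measurable \<Theta> (count_space UNIV)" for k
    unfolding stage_def by measurable
  from measurable_compose_countable[OF measurable_ratio measurable_compose[OF measurable_fst this]]
  have [measurable]: "(\<lambda>z. ratio (stage (fst z) k) (fst z) (snd z))
      \<in> borel_measurable (\<Theta> \<Otimes>\<^sub>M N)" for k
    by (simp add: split_beta')
  show ?thesis unfolding derivative_def split_beta' by measurable
qed

lemma derivative_bounds: "0 \<le> derivative \<theta> y" "derivative \<theta> y \<le> 1"
  by (auto simp: derivative_def)

context
  fixes \<theta>
  assumes \<theta>: "\<theta> \<in> space \<Theta>"
begin

lemma P_in_space: "P \<theta> \<in> space (prob_algebra N)"
  by (rule measurable_space[OF P \<theta>])

interpretation P: prob_space "P \<theta>" by (rule prob_algebraD(1)[OF P_in_space])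

lemma sets_P [measurable_cong]: "sets (P \<theta>) = sets N"
  by (rule prob_algebraD(2)[OF P_in_space])

lemma sets_\<nu> [measurable_cong]: "sets (\<nu> \<theta>) = sets N"
  by (rule sets_kernel[OF \<nu> \<theta>])

lemma finite_measure_\<nu>: "finite_measure (\<nu> \<theta>)"
  by (rule subprob_space.axioms(1)[OF subprob_space_kernel[OF \<nu> \<theta>]])

lemma measure_atom_le: "measure (\<nu> \<theta>) (atom n J) \<le> measure (P \<theta>) (atom n J)"
  using dominated[OF \<theta> sets_atom]
  by (simp add: P.emeasure_eq_measure finite_measure.emeasure_eq_measure[OF finite_measure_\<nu>])

lemma ratio_bounds: "0 \<le> ratio n \<theta> y" "ratio n \<theta> y \<le> 1"
  using measure_atom_le by (auto simp: ratio_def divide_le_eq_1 measure_nonneg less_le)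

lemma measurable_ratio_section [measurable]: "ratio n \<theta> \<in> borel_measurable (P \<theta>)"
  using measurable_compose[OF measurable_Pair1'[OF \<theta>] measurable_ratio[of n]] by simp

lemma measurable_derivative_section [measurable]: "derivative \<theta> \<in> borel_measurable (P \<theta>)"
  using measurable_compose[OF measurable_Pair1'[OF \<theta>] measurable_derivative] by simp

lemma integral_itinerary_times_ratio:
  fixes G :: "nat set \<Rightarrow> real"
  assumes "n \<le> m"
  shows "(\<integral>y. G (itinerary n y) * ratio m \<theta> y \<partial>P \<theta>) = (\<integral>y. G (itinerary n y) \<partial>\<nu> \<theta>)"
proof -
  let ?G = "\<lambda>J. G (J \<inter> {..<n})" and ?p = "\<lambda>J. measure (P \<theta>) (atom m J)"
    and ?v = "\<lambda>J. measure (\<nu> \<theta>) (atom m J)"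
  have G: "G (itinerary n y) = ?G (itinerary m y)" for y
    by (simp add: itinerary_restrict[OF assms, of y])
  have "?v J / ?p J * ?p J = ?v J" for J
    using measure_atom_le[of m J] measure_nonneg[of "\<nu> \<theta>" "atom m J"] by (cases "?p J = 0") auto
  then have "?G J * (?v J / ?p J) * ?p J = ?G J * ?v J" for J by (simp only: mult.assoc)
  then have "(\<Sum>J\<in>Pow {..<m}. ?G J * (?v J / ?p J) * ?p J) = (\<Sum>J\<in>Pow {..<m}. ?G J * ?v J)"
    by (simp only:)
  then show ?thesis
    unfolding G ratio_def
    by (simp only: integral_of_itinerary[OF P.finite_measure_axioms
        sets_P, of "\<lambda>J. ?G J * (?v J / ?p J)"]
        integral_of_itinerary[OF finite_measure_\<nu> sets_\<nu>, of ?G])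
qed

lemma energy_eq_integral:
  assumes "n \<le> m"
  shows "energy \<theta> n = (\<integral>y. ratio n \<theta> y * ratio m \<theta> y \<partial>P \<theta>)"
proof -
  let ?r = "\<lambda>J. measure (\<nu> \<theta>) (atom n J) / measure (P \<theta>) (atom n J)"
  have "(\<integral>y. ratio n \<theta> y * ratio m \<theta> y \<partial>P \<theta>) = (\<integral>y. ?r (itinerary n y) \<partial>\<nu> \<theta>)"
    using integral_itinerary_times_ratio[OF assms, of ?r] by (simp only: ratio_def)
  also have "\<dots> = energy \<theta> n"
    by (simp only: integral_of_itinerary[OF finite_measure_\<nu> sets_\<nu>, of ?r] energy_def)
       (simp add: power2_eq_square)
  finally show ?thesis ..
qed

lemma integrable_bounded_by_1:
  fixes f :: "'y \<Rightarrow> real"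
  assumes "f \<in> borel_measurable (P \<theta>)" "\<And>y. \<bar>f y\<bar> \<le> 1"
  shows "integrable (P \<theta>) f"
  using assms by (intro P.integrable_const_bound[where B = 1]) auto

lemma integrable_ratio_mult: "integrable (P \<theta>) (\<lambda>y. ratio n \<theta> y * ratio m \<theta> y)"
  using ratio_bounds by (intro integrable_bounded_by_1) (auto simp: abs_mult mult_le_one)

lemma abs_ratio_diff_le_1: "\<bar>ratio m \<theta> y - ratio n \<theta> y\<bar> \<le> 1"
  using ratio_bounds[of m y] ratio_bounds[of n y] by linarith

lemma integral_ratio_diff_square:
  assumes "n \<le> m"
  shows "(\<integral>y. (ratio m \<theta> y - ratio n \<theta> y)\<^sup>2 \<partial>P \<theta>) = energy \<theta> m - energy \<theta> n"
proof -
  have "(\<integral>y. (ratio m \<theta> y - ratio n \<theta> y)\<^sup>2 \<partial>P \<theta>)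
      = (\<integral>y. ratio m \<theta> y * ratio m \<theta> y - 2 * (ratio n \<theta> y * ratio m \<theta> y)
          + ratio n \<theta> y * ratio n \<theta> y \<partial>P \<theta>)"
    by (simp add: power2_eq_square algebra_simps)
  also have "\<dots> = energy \<theta> m - 2 * energy \<theta> n + energy \<theta> n"
    by (simp add: integrable_ratio_mult energy_eq_integral[OF assms, symmetric]
        energy_eq_integral[OF order_refl, symmetric])
  finally show ?thesis by simp
qed

lemma incseq_energy: "incseq (energy \<theta>)"
proof (rule incseq_SucI)
  show "energy \<theta> n \<le> energy \<theta> (Suc n)" for n
    using integral_ratio_diff_square[of n "Suc n"]
      integral_nonneg_AE[of "\<lambda>y. (ratio (Suc n) \<theta> y - ratio n \<theta> y)\<^sup>2" "P \<theta>"] by simp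
qed

lemma energy_le_1: "energy \<theta> n \<le> 1"
proof -
  have "energy \<theta> n \<le> (\<integral>y. 1 \<partial>P \<theta>)"
    unfolding energy_eq_integral[OF order_refl]
    using ratio_bounds by (intro integral_mono integrable_ratio_mult) (auto simp: mult_le_one)
  then show ?thesis by (simp add: P.prob_space)
qed

lemma
  shows le_stage: "k \<le> stage \<theta> k"
    and energy_stage: "stage \<theta> k \<le> m \<Longrightarrow> energy \<theta> m - energy \<theta> (stage \<theta> k) \<le> ((1/4)^k)\<^sup>2"
proof -
  obtain l where l: "energy \<theta> \<longlonglongrightarrow> l" "\<And>n. energy \<theta> n \<le> l"
    using incseq_convergent[OF incseq_energy, of 1] energy_le_1 by blast
  have "\<forall>\<^sub>F n in sequentially. l - ((1/4)^k)\<^sup>2 < energy \<theta> n"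
    by (rule order_tendstoD(1)[OF l(1)]) simp
  then obtain n where "k \<le> n" "l - ((1/4)^k)\<^sup>2 < energy \<theta> n"
    unfolding eventually_sequentially by (meson nle_le)
  then have "k \<le> n \<and> (\<forall>m\<ge>n. energy \<theta> m - energy \<theta> n \<le> ((1/4)^k)\<^sup>2)"
    using l(2) by (smt (verit))
  then have "k \<le> stage \<theta> k \<and>
      (\<forall>m\<ge>stage \<theta> k. energy \<theta> m - energy \<theta> (stage \<theta> k) \<le> ((1/4)^k)\<^sup>2)"
    unfolding stage_def by (rule LeastI)
  then show "k \<le> stage \<theta> k"
    "stage \<theta> k \<le> m \<Longrightarrow> energy \<theta> m - energy \<theta> (stage \<theta> k) \<le> ((1/4)^k)\<^sup>2" by auto
qed

lemma stage_Suc: "stage \<theta> k \<le> stage \<theta> (Suc k)"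
proof -
  have "energy \<theta> m - energy \<theta> (stage \<theta> (Suc k)) \<le> ((1/4)^k)\<^sup>2" if "stage \<theta> (Suc k) \<le> m" for m
    using energy_stage[OF that] by (rule order_trans) (simp add: power_decreasing power_mono)
  then show ?thesis
    using le_stage[of "Suc k"] unfolding stage_def[of \<theta> k] by (intro Least_le) auto
qed

lemma integral_stage_increment:
  "(\<integral>\<^sup>+y. ennreal \<bar>ratio (stage \<theta> (Suc k)) \<theta> y - ratio (stage \<theta> k) \<theta> y\<bar> \<partial>P \<theta>) \<le> ennreal ((1/4)^k)"
proof -
  let ?d = "\<lambda>y. ratio (stage \<theta> (Suc k)) \<theta> y - ratio (stage \<theta> k) \<theta> y"
  have "(\<integral>y. \<bar>?d y\<bar> \<partial>P \<theta>)\<^sup>2 \<le> (\<integral>y. (?d y)\<^sup>2 \<partial>P \<theta>)"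
    using abs_ratio_diff_le_1
    by (intro P.square_expectation_abs_le integrable_bounded_by_1)
       (auto simp: power_le_one abs_square_le_1)
  also have "\<dots> \<le> ((1/4)^k)\<^sup>2"
    unfolding integral_ratio_diff_square[OF stage_Suc] by (rule energy_stage[OF stage_Suc])
  finally have "(\<integral>y. \<bar>?d y\<bar> \<partial>P \<theta>) \<le> (1/4)^k" by (rule power2_le_imp_le) simp
  moreover have "(\<integral>\<^sup>+y. ennreal \<bar>?d y\<bar> \<partial>P \<theta>) = ennreal (\<integral>y. \<bar>?d y\<bar> \<partial>P \<theta>)"
    using abs_ratio_diff_le_1 by (intro nn_integral_eq_integral integrable_bounded_by_1) auto
  ultimately show ?thesis by (simp add: ennreal_leI)
qed

lemma AE_ratio_tendsto_derivative:
  "AE y in P \<theta>. (\<lambda>k. ratio (stage \<theta> k) \<theta> y) \<longlonglongrightarrow> derivative \<theta> y"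
proof -
  have "AE y in P \<theta>. convergent (\<lambda>k. ratio (stage \<theta> k) \<theta> y)"
    by (rule AE_convergent_of_summable_increments[where a = "\<lambda>k. (1/4)^k"])
       (auto intro: summable_geometric integral_stage_increment)
  then show ?thesis
  proof eventually_elim
    case (elim y)
    let ?l = "lim (\<lambda>k. ratio (stage \<theta> k) \<theta> y)"
    have lim: "(\<lambda>k. ratio (stage \<theta> k) \<theta> y) \<longlonglongrightarrow> ?l" using elim by (simp add: convergent_LIMSEQ_iff)
    then have "0 \<le> ?l" "?l \<le> 1"
      using ratio_bounds by (auto intro: LIMSEQ_le_const LIMSEQ_le_const2)
    then have "derivative \<theta> y = ?l" by (simp add: derivative_def)
    then show ?case using lim by simp
  qed
qed

lemma integral_derivative_atom:
  "(\<integral>y. derivative \<theta> y * indicator (atom n J) y \<partial>P \<theta>) = measure (\<nu> \<theta>) (atom n J)"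
proof (rule LIMSEQ_unique)
  show "(\<lambda>k. \<integral>y. ratio (stage \<theta> k) \<theta> y * indicator (atom n J) y \<partial>P \<theta>)
      \<longlonglongrightarrow> (\<integral>y. derivative \<theta> y * indicator (atom n J) y \<partial>P \<theta>)"
  proof (rule integral_dominated_convergence[where w = "\<lambda>_. 1"])
    show "AE y in P \<theta>. (\<lambda>k. ratio (stage \<theta> k) \<theta> y * indicator (atom n J) y)
        \<longlonglongrightarrow> derivative \<theta> y * indicator (atom n J) y"
      using AE_ratio_tendsto_derivative by eventually_elim (intro tendsto_intros)
    show "AE y in P \<theta>. norm (ratio (stage \<theta> k) \<theta> y * indicator (atom n J) y) \<le> 1" for k
      using ratio_bounds by (intro AE_I2) (simp add: indicator_def)
  qed simp_all
  have "(\<integral>y. ratio (stage \<theta> k) \<theta> y * indicator (atom n J) y \<partial>P \<theta>) = measure (\<nu> \<theta>) (atom n J)"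
    if "n \<le> k" for k
  proof -
    have atom_eq: "y \<in> space N \<Longrightarrow> indicator (atom n J) y = (indicator {J} (itinerary n y) :: real)"
        for y
      by (simp add: indicator_def atom_def)
    have "(\<integral>y. ratio (stage \<theta> k) \<theta> y * indicator (atom n J) y \<partial>P \<theta>)
        = (\<integral>y. indicator {J} (itinerary n y) * ratio (stage \<theta> k) \<theta> y \<partial>P \<theta>)"
      using prob_algebraD(3)[OF P_in_space]
      by (intro Bochner_Integration.integral_cong) (simp_all add: atom_eq)
    also have "\<dots> = (\<integral>y. indicator {J} (itinerary n y) \<partial>\<nu> \<theta>)"
      by (rule integral_itinerary_times_ratio[OF order_trans[OF that le_stage]])
    also have "\<dots> = (\<integral>y. indicator (atom n J) y \<partial>\<nu> \<theta>)"
      using sets_eq_imp_space_eq[OF sets_\<nu>]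
      by (intro Bochner_Integration.integral_cong) (simp_all add: atom_eq)
    finally show ?thesis
      using sets.sets_into_space[OF sets_atom[of n J]] sets_eq_imp_space_eq[OF sets_\<nu>]
      by (simp add: Int_absorb2)
  qed
  then show "(\<lambda>k. \<integral>y. ratio (stage \<theta> k) \<theta> y * indicator (atom n J) y \<partial>P \<theta>)
      \<longlonglongrightarrow> measure (\<nu> \<theta>) (atom n J)"
    by (intro tendsto_eventually eventually_sequentiallyI[of n])
qed

lemma Int_stable_atoms: "Int_stable (range (\<lambda>(n, J). atom n J))"
proof -
  have nested: "atom n J \<inter> atom m K \<in> range (\<lambda>(n, J). atom n J)" if "n \<le> m" for n m J K
  proof (cases "K \<inter> {..<n} = J")
    case True
    then have "atom n J \<inter> atom m K = atom m K"
      using itinerary_restrict[OF that] by (auto simp: atom_def)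
    then show ?thesis by (auto intro: range_eqI[of _ _ "(m, K)"])
  next
    case False
    then have "atom n J \<inter> atom m K = {}" using itinerary_restrict[OF that] by (auto simp: atom_def)
    also have "{} = atom 0 {0}" by (auto simp: atom_def itinerary_def)
    finally show ?thesis by (auto intro: range_eqI[of _ _ "(0, {0})"])
  qed
  show ?thesis
  proof (rule Int_stableI)
    fix X Y assume "X \<in> range (\<lambda>(n, J). atom n J)" "Y \<in> range (\<lambda>(n, J). atom n J)"
    then obtain n J m K where "X = atom n J" "Y = atom m K" by auto
    then show "X \<inter> Y \<in> range (\<lambda>(n, J). atom n J)"
      using nested[of n m J K] nested[of m n K J] by (cases "n \<le> m") (simp_all add: Int_commute)
  qed
qed

lemma sets_eq_sigma_atoms: "sets N = sigma_sets (space N) (range (\<lambda>(n, J). atom n J))"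
proof (rule antisym)
  interpret atoms: sigma_algebra "space N" "sigma_sets (space N) (range (\<lambda>(n, J). atom n J))"
    by (rule sigma_algebra_sigma_sets) (auto simp: atom_def)
  have "U i \<in> sigma_sets (space N) (range (\<lambda>(n, J). atom n J))" for i
  proof -
    have "U i = (\<Union>J\<in>{J. J \<subseteq> {..<Suc i} \<and> i \<in> J}. atom (Suc i) J)"
      using sets.sets_into_space[OF sets_generator[of i]] by (auto simp: atom_def itinerary_def)
    also have "\<dots> \<in> sigma_sets (space N) (range (\<lambda>(n, J). atom n J))"
      by (intro atoms.finite_UN) (auto intro: sigma_sets.Basic range_eqI[of _ _ "(Suc i, J)" for J])
    finally show ?thesis .
  qed
  then show "sets N \<subseteq> sigma_sets (space N) (range (\<lambda>(n, J). atom n J))"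
    unfolding generator by (intro atoms.sigma_sets_subset) auto
  show "sigma_sets (space N) (range (\<lambda>(n, J). atom n J)) \<subseteq> sets N"
    by (intro sets.sigma_sets_subset) auto
qed

lemma density_derivative: "\<nu> \<theta> = density (P \<theta>) (\<lambda>y. ennreal (derivative \<theta> y))"
proof -
  let ?D = "density (P \<theta>) (\<lambda>y. ennreal (derivative \<theta> y))"
  have atoms: "emeasure (\<nu> \<theta>) (atom n J) = emeasure ?D (atom n J)" for n J
    using P.emeasure_density_bounded(2)[OF measurable_derivative_section _
        derivative_bounds, of "atom n J"]
    by (simp add: integral_derivative_atom finite_measure.emeasure_eq_measure[OF finite_measure_\<nu>])
  have "atom 0 {} = space N" by (auto simp: atom_def itinerary_def)
  then show ?thesis
    using atoms[of 0 "{}"] atoms sets_eq_sigma_atoms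
    by (intro finite_measure_eqI_Int_stable[OF Int_stable_atoms _ finite_measure_\<nu>])
       (auto simp: sets_\<nu> sets_P atom_def)
qed

end

end

theorem Radon_Nikodym_kernel:
  assumes "P \<in> measurable \<Theta> (prob_algebra N)" "\<nu> \<in> measurable \<Theta> (subprob_algebra N)"
    and "\<And>\<theta> B. \<theta> \<in> space \<Theta> \<Longrightarrow> B \<in> sets N \<Longrightarrow> emeasure (\<nu> \<theta>) B \<le> emeasure (P \<theta>) B"
    and "sets N = sigma_sets (space N) (range (U :: nat \<Rightarrow> 'y set))"
  obtains E :: "'t \<Rightarrow> 'y \<Rightarrow> real"
  where "(\<lambda>(\<theta>, y). E \<theta> y) \<in> borel_measurable (\<Theta> \<Otimes>\<^sub>M N)" "\<And>\<theta> y. 0 \<le> E \<theta> y" "\<And>\<theta> y. E \<theta> y \<le> 1"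
    "\<And>\<theta>. \<theta> \<in> space \<Theta> \<Longrightarrow> \<nu> \<theta> = density (P \<theta>) (\<lambda>y. ennreal (E \<theta> y))"
proof -
  interpret dominated_kernels \<Theta> N P \<nu> U using assms by unfold_locales
  show thesis
    by (rule that[OF measurable_derivative derivative_bounds density_derivative])
qed

section \<open>Disintegration of kernels\<close>

definition joint_law ::
  "'x measure \<Rightarrow> 'y measure \<Rightarrow> 'y measure \<Rightarrow> ('y \<Rightarrow> 'x measure) \<Rightarrow> ('x \<times> 'y) measure" where
  "joint_law M N P K = P \<bind> (\<lambda>y. distr (K y) (M \<Otimes>\<^sub>M N) (\<lambda>x. (x, y)))"

context
  fixes M :: "'x measure" and N P :: "'y measure" and K :: "'y \<Rightarrow> 'x measure"
  assumes P: "P \<in> space (prob_algebra N)" and K: "K \<in> measurable N (prob_algebra M)"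
begin

lemma measurable_joint_law_kernel:
  "(\<lambda>y. distr (K y) (M \<Otimes>\<^sub>M N) (\<lambda>x. (x, y))) \<in> measurable N (prob_algebra (M \<Otimes>\<^sub>M N))"
  by (rule measurable_distr_prob_space2[OF K]) measurable

lemma joint_law_in_space_prob_algebra: "joint_law M N P K \<in> space (prob_algebra (M \<Otimes>\<^sub>M N))"
  unfolding joint_law_def by (rule bind_in_space_prob_algebra[OF P measurable_joint_law_kernel])

lemma emeasure_joint_law_Times:
  assumes A: "A \<in> sets M" and B: "B \<in> sets N"
  shows "emeasure (joint_law M N P K) (A \<times> B) = (\<integral>\<^sup>+y. emeasure (K y) A * indicator B y \<partial>P)"
proof -
  have "emeasure (distr (K y) (M \<Otimes>\<^sub>M N) (\<lambda>x. (x, y))) (A \<times> B) = emeasure (K y) A * indicator B y"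
    if "y \<in> space N" for y
  proof -
    have K_y: "K y \<in> space (prob_algebra M)" by (rule measurable_space[OF K that])
    have "(\<lambda>x. (x, y)) -` (A \<times> B) \<inter> space (K y) = (if y \<in> B then A else {})"
      using sets.sets_into_space[OF A] by (auto simp: prob_algebraD(3)[OF K_y])
    then show ?thesis
      using A B that
      by (subst emeasure_distr) (auto simp: measurable_prob_algebra_cong[OF K_y])
  qed
  then show ?thesis
    using A B prob_algebraD(3)[OF P] unfolding joint_law_def
    by (subst emeasure_bind_prob_algebra[OF P measurable_joint_law_kernel])
       (auto intro!: nn_integral_cong)
qed

lemma distr_fst_joint_law:
  assumes f: "f \<in> measurable M M'"
  shows "distr (joint_law M N P K) (M' \<Otimes>\<^sub>M N) (\<lambda>(x, y). (f x, y))
      = joint_law M' N P (\<lambda>y. distr (K y) M' f)"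
proof -
  have "(\<lambda>(x, y). (f x, y)) \<in> measurable (M \<Otimes>\<^sub>M N) (M' \<Otimes>\<^sub>M N)" using f by measurable
  note distr_bind_prob_algebra[OF P measurable_joint_law_kernel this]
  also have "P \<bind> (\<lambda>y. distr (distr (K y) (M \<Otimes>\<^sub>M N) (\<lambda>x. (x, y))) (M' \<Otimes>\<^sub>M N) (\<lambda>(x, y). (f x, y)))
      = P \<bind> (\<lambda>y. distr (distr (K y) M' f) (M' \<Otimes>\<^sub>M N) (\<lambda>x. (x, y)))"
  proof (rule bind_cong[OF refl])
    fix y assume "y \<in> space P"
    then have y: "y \<in> space N" by (simp add: prob_algebraD(3)[OF P])
    have [simp]: "measurable (K y) L = measurable M L" for L :: "'z measure"
      by (rule measurable_prob_algebra_cong[OF measurable_space[OF K y]])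
    show "distr (distr (K y) (M \<Otimes>\<^sub>M N) (\<lambda>x. (x, y))) (M' \<Otimes>\<^sub>M N) (\<lambda>(x, y). (f x, y))
        = distr (distr (K y) M' f) (M' \<Otimes>\<^sub>M N) (\<lambda>x. (x, y))"
      using f y measurable_prob_algebra_cong[OF measurable_space[OF K y]]
      by (subst (1 2) distr_distr) (auto simp: o_def)
  qed
  finally show ?thesis unfolding joint_law_def .
qed

lemma nn_integral_uext_joint_law:
  assumes G: "G \<in> borel_measurable (univ_alg (M \<Otimes>\<^sub>M N))"
  shows "(\<integral>\<^sup>+w. G w \<partial>uext (joint_law M N P K)) = (\<integral>\<^sup>+y. \<integral>\<^sup>+x. G (x, y) \<partial>uext (K y) \<partial>uext P)"
proof -
  let ?k = "\<lambda>y. distr (K y) (M \<Otimes>\<^sub>M N) (\<lambda>x. (x, y))"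
  have "(\<integral>\<^sup>+w. G w \<partial>uext (joint_law M N P K)) = (\<integral>\<^sup>+y. \<integral>\<^sup>+w. G w \<partial>uext (?k y) \<partial>uext P)"
    unfolding joint_law_def uext_bind[OF P measurable_joint_law_kernel, symmetric]
    by (rule nn_integral_bind_uext[OF P measurable_uext_kernel[OF measurable_joint_law_kernel] G])
  also have "\<dots> = (\<integral>\<^sup>+y. \<integral>\<^sup>+x. G (x, y) \<partial>uext (K y) \<partial>uext P)"
  proof (rule nn_integral_cong)
    fix y assume "y \<in> space (uext P)"
    then have y: "y \<in> space N" by (simp add: prob_algebraD(3)[OF P])
    show "(\<integral>\<^sup>+w. G w \<partial>uext (?k y)) = (\<integral>\<^sup>+x. G (x, y) \<partial>uext (K y))"
      by (rule nn_integral_uext_distr[OF measurable_space[OF K y] measurable_Pair2'[OF y] G])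
  qed
  finally show ?thesis .
qed

end

subsection \<open>Slices\<close>

definition slice :: "'y measure \<Rightarrow> 'x set \<Rightarrow> ('x \<times> 'y) measure \<Rightarrow> 'y measure" where
  "slice N A W = distr (density W (indicator (A \<times> space N))) N snd"

lemma sets_slice [simp]: "sets (slice N A W) = sets N"
  by (simp add: slice_def)

lemma space_slice [simp]: "space (slice N A W) = space N"
  by (simp add: slice_def)

lemma emeasure_slice:
  assumes W: "W \<in> space (prob_algebra (M \<Otimes>\<^sub>M N))" and A: "A \<in> sets M" and B: "B \<in> sets N"
  shows "emeasure (slice N A W) B = emeasure W (A \<times> B)"
proof -
  have [measurable_cong]: "sets W = sets (M \<Otimes>\<^sub>M N)" by (rule prob_algebraD(2)[OF W])
  note [measurable] = A B
  let ?S = "snd -` B \<inter> space W"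
  have S: "?S \<in> sets W" by measurable
  have "emeasure (slice N A W) B = (\<integral>\<^sup>+w. indicator (A \<times> space N) w * indicator ?S w \<partial>W)"
    using S by (simp add: slice_def emeasure_distr emeasure_density)
  also have "\<dots> = (\<integral>\<^sup>+w. indicator (A \<times> B) w \<partial>W)"
    using sets.sets_into_space[OF B] prob_algebraD(3)[OF W]
    by (intro nn_integral_cong) (auto simp: space_pair_measure split: split_indicator)
  finally show ?thesis by simp
qed

lemma measurable_slice:
  assumes W: "W \<in> measurable \<Theta> (prob_algebra (M \<Otimes>\<^sub>M N))" and A: "A \<in> sets M"
  shows "(\<lambda>\<theta>. slice N A (W \<theta>)) \<in> measurable \<Theta> (subprob_algebra N)"
proof (rule measurable_subprob_algebra)
  fix \<theta> assume "\<theta> \<in> space \<Theta>"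
  then have W\<theta>: "W \<theta> \<in> space (prob_algebra (M \<Otimes>\<^sub>M N))" by (rule measurable_space[OF W])
  interpret prob_space "W \<theta>" by (rule prob_algebraD[OF W\<theta>])
  have "space N \<noteq> {}"
    using not_empty prob_algebraD(3)[OF W\<theta>] by (auto simp: space_pair_measure)
  then show "subprob_space (slice N A (W \<theta>))"
    using emeasure_slice[OF W\<theta> A] emeasure_le_1 by (intro subprob_spaceI) simp_all
next
  fix B assume B: "B \<in> sets N"
  have "(\<lambda>\<theta>. emeasure (W \<theta>) (A \<times> B)) \<in> borel_measurable \<Theta>"
    using A B by (intro measurable_emeasure_kernel[OF measurable_prob_algebraD[OF W]]) auto
  then show "(\<lambda>\<theta>. emeasure (slice N A (W \<theta>)) B) \<in> borel_measurable \<Theta>"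
    by (rule measurable_cong[THEN iffD1, rotated])
       (rule emeasure_slice[OF measurable_space[OF W] A B, symmetric])
qed simp

lemma emeasure_slice_le_marginal:
  assumes W: "W \<in> space (prob_algebra (M \<Otimes>\<^sub>M N))" and A: "A \<in> sets M" and B: "B \<in> sets N"
  shows "emeasure (slice N A W) B \<le> emeasure (distr W N snd) B"
proof -
  have [measurable_cong]: "sets W = sets (M \<Otimes>\<^sub>M N)" by (rule prob_algebraD(2)[OF W])
  note [measurable] = A B
  have "emeasure W (A \<times> B) \<le> emeasure W (snd -` B \<inter> space W)"
    using sets.sets_into_space[OF A] sets.sets_into_space[OF B] prob_algebraD(3)[OF W]
    by (intro emeasure_mono) (auto simp: space_pair_measure)
  then show ?thesis by (simp add: emeasure_slice[OF W A B] emeasure_distr)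
qed

lemma (in prob_space) AE_le_of_density_le:
  fixes f g :: "'a \<Rightarrow> real"
  assumes f: "f \<in> borel_measurable M" "\<And>x. 0 \<le> f x" "\<And>x. f x \<le> 1"
    and g: "g \<in> borel_measurable M" "\<And>x. 0 \<le> g x" "\<And>x. g x \<le> 1"
    and le: "\<And>B. B \<in> sets M \<Longrightarrow>
      emeasure (density M (\<lambda>x. ennreal (f x))) B \<le> emeasure (density M (\<lambda>x. ennreal (g x))) B"
  shows "AE x in M. f x \<le> g x"
proof -
  have "AE x in M. 0 \<le> g x - f x"
  proof (rule density_nonneg)
    have "integrable M f" "integrable M g"
      using f g by (auto intro!: integrable_const_bound[where B = 1])
    then show "integrable M (\<lambda>x. g x - f x)" by simp
    fix B assume B: "B \<in> sets M"
    note f_B = emeasure_density_bounded[OF f(1) B f(2,3)]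
      and g_B = emeasure_density_bounded[OF g(1) B g(2,3)]
    have "0 \<le> (\<integral>x. g x * indicator B x \<partial>M)" using g(2) by (intro integral_nonneg_AE) auto
    then have "(\<integral>x. f x * indicator B x \<partial>M) \<le> (\<integral>x. g x * indicator B x \<partial>M)"
      using le[OF B] unfolding f_B(2) g_B(2) by (simp add: ennreal_le_iff)
    then have "0 \<le> (\<integral>x. g x * indicator B x - f x * indicator B x \<partial>M)"
      by (simp add: Bochner_Integration.integral_diff[OF g_B(1) f_B(1)])
    then show "0 \<le> (LINT x:B|M. g x - f x)"
      by (simp add: set_lebesgue_integral_def left_diff_distrib mult.commute[of "indicator B _"])
  qed
  then show ?thesis by eventually_elim simp
qed

lemma prob_measure_eqI_rat_rays_Times:
  assumes P: "P \<in> space (prob_algebra (borel \<Otimes>\<^sub>M N))" and Q: "Q \<in> space (prob_algebra (borel \<Otimes>\<^sub>M N))"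
    and eq: "\<And>r B. B \<in> sets N \<Longrightarrow>
      emeasure P ({..real_of_rat r} \<times> B) = emeasure Q ({..real_of_rat r} \<times> B)"
  shows "P = Q"
proof (rule prob_measure_eqI_Int_stable[OF _ _ _ P Q])
  let ?\<E> = "{A \<times> B | A B. A \<in> range (\<lambda>r. {..real_of_rat r}) \<and> B \<in> sets N}"
  show "Int_stable ?\<E>"
  proof (rule Int_stableI)
    fix X Y assume "X \<in> ?\<E>" "Y \<in> ?\<E>"
    then obtain A B A' B' where "X = A \<times> B" "Y = A' \<times> B'" and B: "B \<in> sets N" "B' \<in> sets N"
      and A: "A \<in> range (\<lambda>r. {..real_of_rat r})" "A' \<in> range (\<lambda>r. {..real_of_rat r})" by blast
    then have "X \<inter> Y = (A \<inter> A') \<times> (B \<inter> B')" by blast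
    with B Int_stableD[OF Int_stable_rat_rays A] show "X \<inter> Y \<in> ?\<E>" by blast
  qed
  show subset: "?\<E> \<subseteq> Pow (space (borel \<Otimes>\<^sub>M N))"
    using sets.sets_into_space[of _ N] by (auto simp: space_pair_measure)
  have "sets (borel \<Otimes>\<^sub>M N) = sets (sigma (space borel \<times> space N) ?\<E>)"
  proof (rule sets_pair_eq)
    show "sets borel = sigma_sets (space borel) (range (\<lambda>r. {..real_of_rat r}))"
      by (simp add: sets_borel_eq_rat_rays)
    show "sets N = sigma_sets (space N) (sets N)" by (rule sets.sigma_sets_eq[symmetric])
    show "\<Union>(range (\<lambda>n. {..real_of_rat (of_nat n)})) = space borel" using real_arch_simple by auto
    show "range (\<lambda>n. {..real_of_rat (of_nat n)}) \<subseteq> range (\<lambda>r. {..real_of_rat r})" by blast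
    show "countable {space N}" "{space N} \<subseteq> sets N" "\<Union>{space N} = space N" by auto
  qed (use sets.space_closed in auto)
  then show "sets (borel \<Otimes>\<^sub>M N) = sigma_sets (space (borel \<Otimes>\<^sub>M N)) ?\<E>"
    using subset by (simp add: space_pair_measure)
qed (use eq in blast)

lemma INT_rat_rays: "(\<Inter>n. {..real_of_rat (r + 1 / of_nat (Suc n))}) = {..real_of_rat r}"
proof (intro equalityI subsetI)
  fix x assume x: "x \<in> (\<Inter>n. {..real_of_rat (r + 1 / of_nat (Suc n))})"
  have "x \<le> real_of_rat r + \<epsilon>" if \<epsilon>: "0 < \<epsilon>" for \<epsilon> :: real
  proof -
    obtain n where "inverse (real (Suc n)) < \<epsilon>" using reals_Archimedean[OF \<epsilon>] by blast
    moreover have "x \<le> real_of_rat r + inverse (real (Suc n))"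
      using x by (auto simp: of_rat_add of_rat_divide inverse_eq_divide dest!: spec[of _ n])
    ultimately show ?thesis by linarith
  qed
  then show "x \<in> {..real_of_rat r}" by (simp add: field_le_epsilon)
qed (auto simp: of_rat_add of_rat_divide intro: order_trans)

subsection \<open>Conditional laws on the unit interval\<close>

context
  fixes W :: "(real \<times> 'y) measure" and N :: "'y measure" and E :: "rat \<Rightarrow> 'y \<Rightarrow> real"
  assumes W: "W \<in> space (prob_algebra (borel \<Otimes>\<^sub>M N))" and support: "AE w in W. fst w \<in> {0..1}"
    and E: "\<And>r. E r \<in> borel_measurable N" "\<And>r y. 0 \<le> E r y" "\<And>r y. E r y \<le> 1"
    and slice: "\<And>r. slice N {..real_of_rat r} W = density (distr W N snd) (\<lambda>y. ennreal (E r y))"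
begin

interpretation W: prob_space W by (rule prob_algebraD[OF W])

lemma marginal_in_space: "distr W N snd \<in> space (prob_algebra N)"
  by (rule distr_in_space_prob_algebra[OF W measurable_snd])

interpretation P: prob_space "distr W N snd" by (rule prob_algebraD[OF marginal_in_space])

lemma emeasure_density_slice:
  "B \<in> sets N \<Longrightarrow> emeasure (density (distr W N snd) (\<lambda>y. ennreal (E r y))) B
    = emeasure W ({..real_of_rat r} \<times> B)"
  unfolding slice[symmetric] by (rule emeasure_slice[OF W]) simp_all

lemma sets_ray_Times: "B \<in> sets N \<Longrightarrow> {..x} \<times> B \<in> sets W"
  by (simp add: prob_algebraD(2)[OF W])

lemma AE_slice_mono:
  assumes "r \<le> s"
  shows "AE y in distr W N snd. E r y \<le> E s y"
proof (rule P.AE_le_of_density_le)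
  fix B assume "B \<in> sets (distr W N snd)"
  then have B: "B \<in> sets N" by simp
  have "{..real_of_rat r} \<times> B \<subseteq> {..real_of_rat s} \<times> B"
    using assms by (auto simp: of_rat_less_eq intro: order_trans)
  then show "emeasure (density (distr W N snd) (\<lambda>y. ennreal (E r y))) B
      \<le> emeasure (density (distr W N snd) (\<lambda>y. ennreal (E s y))) B"
    unfolding emeasure_density_slice[OF B] by (intro emeasure_mono sets_ray_Times B)
qed (use E in auto)

lemma AE_slice_eq_0:
  assumes "r < 0"
  shows "AE y in distr W N snd. E r y = 0"
proof -
  have "AE y in distr W N snd. E r y \<le> 0"
  proof (rule P.AE_le_of_density_le)
    fix B assume "B \<in> sets (distr W N snd)"
    then have B: "B \<in> sets N" by simp
    from support have "AE w in W. w \<notin> {..real_of_rat r} \<times> B"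
      by eventually_elim (use less_0_of_le_of_rat[OF _ assms] in fastforce)
    then have "emeasure W ({..real_of_rat r} \<times> B) = 0"
      using sets_ray_Times[OF B] by (simp add: AE_iff_null_sets[symmetric] null_setsD1)
    then show "emeasure (density (distr W N snd) (\<lambda>y. ennreal (E r y))) B
        \<le> emeasure (density (distr W N snd) (\<lambda>y. ennreal 0)) B"
      by (simp add: emeasure_density_slice[OF B])
  qed (use E in auto)
  then show ?thesis using E(2) by (auto intro: antisym)
qed

lemma AE_slice_eq_1:
  assumes "1 \<le> r"
  shows "AE y in distr W N snd. E r y = 1"
proof -
  have "AE y in distr W N snd. 1 \<le> E r y"
  proof (rule P.AE_le_of_density_le)
    fix B assume "B \<in> sets (distr W N snd)"
    then have B: "B \<in> sets N" by simp
    have snd_W: "snd \<in> measurable W N" by (simp add: measurable_prob_algebra_cong[OF W])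
    from support have "AE w in W. w \<in> snd -` B \<inter> space W \<longrightarrow> w \<in> {..real_of_rat r} \<times> B"
      by eventually_elim (use le_of_rat_of_le_1[OF _ assms] in \<open>auto simp: mem_Times_iff\<close>)
    then have "emeasure W (snd -` B \<inter> space W) \<le> emeasure W ({..real_of_rat r} \<times> B)"
      by (rule emeasure_mono_AE[OF _ sets_ray_Times[OF B]])
    then show "emeasure (density (distr W N snd) (\<lambda>y. ennreal 1)) B
        \<le> emeasure (density (distr W N snd) (\<lambda>y. ennreal (E r y))) B"
      using B snd_W by (simp add: emeasure_density_slice[OF B] density_1 emeasure_distr)
  qed (use E in auto)
  then show ?thesis using E(3) by (auto intro: antisym)
qed

lemma AE_slice_right_continuous:
  "AE y in distr W N snd. (INF n. E (r + 1 / of_nat (Suc n)) y) \<le> E r y"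
proof (rule P.AE_le_of_density_le)
  let ?r = "\<lambda>n. r + 1 / of_nat (Suc n)"
  have bdd: "bdd_below (range (\<lambda>n. E (?r n) y))" for y using E by (intro bdd_belowI[of _ 0]) auto
  have lower: "(INF n. E (?r n) y) \<le> E (?r n) y" for n y by (intro cINF_lower bdd) simp
  show meas_INF: "(\<lambda>y. INF n. E (?r n) y) \<in> borel_measurable (distr W N snd)"
    using E by (intro borel_measurable_cINF_real) auto
  show "0 \<le> (INF n. E (?r n) y)" for y using E by (intro cINF_greatest) auto
  show "(INF n. E (?r n) y) \<le> 1" for y using lower[of y 0] E(3) by (rule order_trans)
  fix B assume "B \<in> sets (distr W N snd)"
  then have B: "B \<in> sets N" by simp
  have "emeasure (density (distr W N snd) (\<lambda>y. ennreal (INF n. E (?r n) y))) B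
      \<le> emeasure W ({..real_of_rat (?r n)} \<times> B)" for n
    unfolding emeasure_density_slice[OF B, symmetric]
    using B E meas_INF
    by (auto simp: emeasure_density simp del: of_nat_Suc
        intro!: nn_integral_mono mult_right_mono ennreal_leI lower)
  then have "emeasure (density (distr W N snd) (\<lambda>y. ennreal (INF n. E (?r n) y))) B
      \<le> (INF n. emeasure W ({..real_of_rat (?r n)} \<times> B))"
    by (rule INF_greatest)
  also have "\<dots> = emeasure W (\<Inter>n. {..real_of_rat (?r n)} \<times> B)"
  proof (rule INF_emeasure_decseq)
    show "decseq (\<lambda>n. {..real_of_rat (?r n)} \<times> B)"
      unfolding decseq_def
    proof (intro allI impI Sigma_mono order_refl)
      fix m n :: nat assume "m \<le> n"
      then have "?r n \<le> ?r m" by (simp add: frac_le)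
      then show "{..real_of_rat (?r n)} \<subseteq> {..real_of_rat (?r m)}"
        by (simp only: atMost_subset_iff of_rat_less_eq)
    qed
  qed (use sets_ray_Times[OF B] in auto)
  also have "(\<Inter>n. {..real_of_rat (?r n)} \<times> B) = {..real_of_rat r} \<times> B"
    by (subst INT_rat_rays[of r, symmetric]) blast
  finally show "emeasure (density (distr W N snd) (\<lambda>y. ennreal (INF n. E (?r n) y))) B
      \<le> emeasure (density (distr W N snd) (\<lambda>y. ennreal (E r y))) B"
    by (simp add: emeasure_density_slice[OF B])
qed (use E in auto)

lemma AE_unit_cdf_slice: "AE y in distr W N snd. unit_cdf (\<lambda>r. E r y)"
proof -
  have "AE y in distr W N snd. (\<forall>r s. r \<le> s \<longrightarrow> E r y \<le> E s y) \<and> (\<forall>r. r < 0 \<longrightarrow> E r y = 0) \<and>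
      (\<forall>r. 1 \<le> r \<longrightarrow> E r y = 1) \<and> (\<forall>r. (INF n. E (r + 1 / of_nat (Suc n)) y) \<le> E r y)"
    using AE_slice_mono AE_slice_eq_0 AE_slice_eq_1 AE_slice_right_continuous
    by (simp add: AE_all_countable AE_conj_iff AE_impI)
  then show ?thesis
  proof eventually_elim
    case (elim y)
    show ?case
    proof (rule unit_cdfI)
      fix r and \<epsilon> :: real assume "0 < \<epsilon>"
      then have "(INF n. E (r + 1 / of_nat (Suc n)) y) < E r y + \<epsilon>"
        using elim by (metis add.right_neutral add_le_less_mono)
      then obtain n where "E (r + 1 / of_nat (Suc n)) y < E r y + \<epsilon>"
        by (subst (asm) cINF_less_iff) (use E in \<open>auto intro!: bdd_belowI[of _ 0]\<close>)
      moreover have "r < r + 1 / of_nat (Suc n)" by simp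
      ultimately show "\<exists>s>r. E s y < E r y + \<epsilon>" by blast
    qed (use elim in auto)
  qed
qed

abbreviation (input) slice_law :: "'y \<Rightarrow> real measure" where
  "slice_law y \<equiv> unit_cdf_measure (\<lambda>r. E r y)"

lemma measurable_slice_law: "slice_law \<in> measurable N (prob_algebra borel)"
  by (intro measurable_compose[OF measurable_coordinatewise_then_product
      measurable_unit_cdf_measure] E)

lemma joint_law_slice_law: "W = joint_law borel N (distr W N snd) slice_law"
proof (rule prob_measure_eqI_rat_rays_Times[OF W])
  show "joint_law borel N (distr W N snd) slice_law \<in> space (prob_algebra (borel \<Otimes>\<^sub>M N))"
    by (rule joint_law_in_space_prob_algebra[OF marginal_in_space measurable_slice_law])
  fix r B assume B: "B \<in> sets N"
  have "emeasure (joint_law borel N (distr W N snd) slice_law) ({..real_of_rat r} \<times> B)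
      = (\<integral>\<^sup>+y. emeasure (slice_law y) {..real_of_rat r} * indicator B y \<partial>distr W N snd)"
    using B by (simp add: emeasure_joint_law_Times[OF marginal_in_space measurable_slice_law])
  also have "\<dots> = (\<integral>\<^sup>+y. ennreal (E r y) * indicator B y \<partial>distr W N snd)"
  proof (rule nn_integral_cong_AE)
    show "AE y in distr W N snd. emeasure (slice_law y) {..real_of_rat r} * indicator B y
        = ennreal (E r y) * indicator B y"
      using AE_unit_cdf_slice by eventually_elim (simp add: emeasure_unit_cdf_measure)
  qed
  also have "\<dots> = emeasure W ({..real_of_rat r} \<times> B)"
    using B E(1) unfolding emeasure_density_slice[OF B, symmetric] by (simp add: emeasure_density)
  finally show "emeasure W ({..real_of_rat r} \<times> B)
      = emeasure (joint_law borel N (distr W N snd) slice_law) ({..real_of_rat r} \<times> B)" ..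
qed

end

lemma kernel_disintegration_unit_interval:
  fixes W :: "'t \<Rightarrow> (real \<times> 'y) measure" and U :: "nat \<Rightarrow> 'y set"
  assumes W: "W \<in> measurable \<Theta> (prob_algebra (borel \<Otimes>\<^sub>M N))"
    and generator: "sets N = sigma_sets (space N) (range U)"
    and support: "\<And>\<theta>. \<theta> \<in> space \<Theta> \<Longrightarrow> AE w in W \<theta>. fst w \<in> {0..1}"
  obtains K :: "'t \<Rightarrow> 'y \<Rightarrow> real measure"
  where "(\<lambda>(\<theta>, y). K \<theta> y) \<in> measurable (\<Theta> \<Otimes>\<^sub>M N) (prob_algebra borel)"
    "\<And>\<theta>. \<theta> \<in> space \<Theta> \<Longrightarrow> W \<theta> = joint_law borel N (distr (W \<theta>) N snd) (K \<theta>)"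
proof -
  let ?P = "\<lambda>\<theta>. distr (W \<theta>) N snd"
  have P: "?P \<in> measurable \<Theta> (prob_algebra N)"
    by (rule measurable_compose[OF W measurable_distr_prob_space[OF measurable_snd]])
  have "\<exists>E. (\<lambda>(\<theta>, y). E \<theta> y) \<in> borel_measurable (\<Theta> \<Otimes>\<^sub>M N) \<and> (\<forall>\<theta> y. 0 \<le> E \<theta> y \<and> E \<theta> y \<le> 1) \<and>
      (\<forall>\<theta>\<in>space \<Theta>. slice N {..real_of_rat r} (W \<theta>) = density (?P \<theta>) (\<lambda>y. ennreal (E \<theta> y)))" for r
  proof -
    have slice_le: "emeasure (slice N {..real_of_rat r} (W \<theta>)) B \<le> emeasure (?P \<theta>) B"
      if "\<theta> \<in> space \<Theta>" "B \<in> sets N" for \<theta> B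
      using that by (intro emeasure_slice_le_marginal[OF measurable_space[OF W]]) simp_all
    obtain E where "(\<lambda>(\<theta>, y). E \<theta> y) \<in> borel_measurable (\<Theta> \<Otimes>\<^sub>M N)"
      "\<And>\<theta> y. 0 \<le> E \<theta> y" "\<And>\<theta> y. E \<theta> y \<le> 1"
      "\<And>\<theta>. \<theta> \<in> space \<Theta> \<Longrightarrow>
        slice N {..real_of_rat r} (W \<theta>) = density (?P \<theta>) (\<lambda>y. ennreal (E \<theta> y))"
      by (rule Radon_Nikodym_kernel[OF P measurable_slice[OF W] slice_le generator]) simp_all
    then show ?thesis by (intro exI[of _ E]) simp
  qed
  then obtain E :: "rat \<Rightarrow> 't \<Rightarrow> 'y \<Rightarrow> real"
    where E_meas: "\<And>r. (\<lambda>(\<theta>, y). E r \<theta> y) \<in> borel_measurable (\<Theta> \<Otimes>\<^sub>M N)"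
      and E_bounds: "\<And>r \<theta> y. 0 \<le> E r \<theta> y" "\<And>r \<theta> y. E r \<theta> y \<le> 1"
      and slice: "\<And>r \<theta>. \<theta> \<in> space \<Theta> \<Longrightarrow>
        slice N {..real_of_rat r} (W \<theta>) = density (?P \<theta>) (\<lambda>y. ennreal (E r \<theta> y))"
    by metis
  show thesis
  proof (rule that[of "\<lambda>\<theta> y. unit_cdf_measure (\<lambda>r. E r \<theta> y)"])
    have "(\<lambda>z r. E r (fst z) (snd z)) \<in> borel_measurable (\<Theta> \<Otimes>\<^sub>M N)"
      using E_meas by (intro measurable_coordinatewise_then_product) (simp add: split_beta')
    from measurable_compose[OF this measurable_unit_cdf_measure]
    show "(\<lambda>(\<theta>, y). unit_cdf_measure (\<lambda>r. E r \<theta> y)) \<in> measurable (\<Theta> \<Otimes>\<^sub>M N) (prob_algebra borel)"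
      by (simp add: split_beta')
    fix \<theta> assume \<theta>: "\<theta> \<in> space \<Theta>"
    have "E r \<theta> \<in> borel_measurable N" for r
      using measurable_compose[OF measurable_Pair1'[OF \<theta>] E_meas[of r]] by simp
    then show "W \<theta> = joint_law borel N (?P \<theta>) (\<lambda>y. unit_cdf_measure (\<lambda>r. E r \<theta> y))"
      by (rule joint_law_slice_law[OF measurable_space[OF W \<theta>]
          support[OF \<theta>] _ E_bounds slice[OF \<theta>]])
  qed
qed

theorem kernel_disintegration:
  fixes W :: "'t \<Rightarrow> ('x::polish_space \<times> 'y) measure" and U :: "nat \<Rightarrow> 'y set"
  assumes W: "W \<in> measurable \<Theta> (prob_algebra (borel \<Otimes>\<^sub>M N))"
    and generator: "sets N = sigma_sets (space N) (range U)"
  obtains K :: "'t \<Rightarrow> 'y \<Rightarrow> 'x measure"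
  where "(\<lambda>(\<theta>, y). K \<theta> y) \<in> measurable (\<Theta> \<Otimes>\<^sub>M N) (prob_algebra borel)"
    "\<And>\<theta>. \<theta> \<in> space \<Theta> \<Longrightarrow> W \<theta> = joint_law borel N (distr (W \<theta>) N snd) (K \<theta>)"
proof -
  obtain f :: "'x \<Rightarrow> real" and g where f[measurable]: "f \<in> borel_measurable borel"
    and g[measurable]: "g \<in> borel_measurable borel"
    and g_f: "\<And>x. g (f x) = x" and f_bounds: "\<And>x. f x \<in> {0..1}"
    using polish_embedding_unit_interval by blast
  let ?code = "\<lambda>w. (f (fst w), snd w)"
  define V where "V \<theta> = distr (W \<theta>) (borel \<Otimes>\<^sub>M N) ?code" for \<theta>
  have code: "?code \<in> measurable (borel \<Otimes>\<^sub>M N) (borel \<Otimes>\<^sub>M N)" by measurable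
  have V: "V \<in> measurable \<Theta> (prob_algebra (borel \<Otimes>\<^sub>M N))"
    unfolding V_def by (rule measurable_compose[OF W measurable_distr_prob_space[OF code]])
  have code_W: "?code \<in> measurable (W \<theta>) (borel \<Otimes>\<^sub>M N)" if "\<theta> \<in> space \<Theta>" for \<theta>
    using code by (simp add: measurable_prob_algebra_cong[OF measurable_space[OF W that]])
  have "AE w in V \<theta>. fst w \<in> {0..1}" if "\<theta> \<in> space \<Theta>" for \<theta>
    unfolding V_def using f_bounds by (subst AE_distr_iff[OF code_W[OF that]]) auto
  from kernel_disintegration_unit_interval[OF V generator this]
  obtain K :: "'t \<Rightarrow> 'y \<Rightarrow> real measure"
    where K: "(\<lambda>(\<theta>, y). K \<theta> y) \<in> measurable (\<Theta> \<Otimes>\<^sub>M N) (prob_algebra borel)"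
      and V_eq: "\<And>\<theta>. \<theta> \<in> space \<Theta> \<Longrightarrow> V \<theta> = joint_law borel N (distr (V \<theta>) N snd) (K \<theta>)"
    by blast
  show thesis
  proof (rule that[of "\<lambda>\<theta> y. distr (K \<theta> y) borel g"])
    show "(\<lambda>(\<theta>, y). distr (K \<theta> y) borel g) \<in> measurable (\<Theta> \<Otimes>\<^sub>M N) (prob_algebra borel)"
      using measurable_compose[OF K measurable_distr_prob_space[OF g]] by (simp add: split_beta')
    fix \<theta> assume \<theta>: "\<theta> \<in> space \<Theta>"
    have K\<theta>: "K \<theta> \<in> measurable N (prob_algebra borel)"
      using measurable_compose[OF measurable_Pair1'[OF \<theta>] K] by simp
    have snd_V: "distr (V \<theta>) N snd = distr (W \<theta>) N snd"
      unfolding V_def using code_W[OF \<theta>] by (subst distr_distr) (auto simp: o_def)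
    have "W \<theta> = distr (V \<theta>) (borel \<Otimes>\<^sub>M N) (\<lambda>(x, y). (g x, y))"
      unfolding V_def using code_W[OF \<theta>] prob_algebraD(2)[OF measurable_space[OF W \<theta>]]
      by (subst distr_distr) (auto simp: o_def g_f split_beta' intro!: distr_id2[symmetric])
    also have "\<dots> = joint_law borel N (distr (W \<theta>) N snd) (\<lambda>y. distr (K \<theta> y) borel g)"
      unfolding V_eq[OF \<theta>, unfolded snd_V]
      by (rule distr_fst_joint_law[OF _ K\<theta> g])
         (rule distr_in_space_prob_algebra[OF measurable_space[OF W \<theta>] measurable_snd])
    finally show "W \<theta> = joint_law borel N (distr (W \<theta>) N snd) (\<lambda>y. distr (K \<theta> y) borel g)" .
  qed
qed

section \<open>Hitting probabilities of Markov chains\<close>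

locale markov_chain =
  fixes N :: "'z measure" and \<kappa> :: "'z \<Rightarrow> 'z measure" and z0 :: 'z
  assumes kernel: "\<kappa> \<in> measurable N (prob_algebra N)" and start: "z0 \<in> space N"
begin

definition transition :: "nat \<Rightarrow> (nat \<Rightarrow> 'z) \<Rightarrow> 'z measure" where
  "transition i \<omega> = (if i = 0 then return N z0 else \<kappa> (\<omega> (i - 1)))"

lemma transition_0: "transition 0 \<omega> = return N z0"
  by (simp add: transition_def)

lemma transition_Suc: "transition (Suc n) \<omega> = \<kappa> (\<omega> n)"
  by (simp add: transition_def)

abbreviation prefix_space :: "nat \<Rightarrow> (nat \<Rightarrow> 'z) measure" where
  "prefix_space n \<equiv> PiM {0..<n} (\<lambda>_. N)"

lemma measurable_prefix_coord: "i < n \<Longrightarrow> (\<lambda>\<omega>. \<omega> i) \<in> measurable (prefix_space n) N"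
  by (intro measurable_component_singleton) auto

lemma measurable_transition: "transition i \<in> measurable (prefix_space i) (prob_algebra N)"
proof (cases "i = 0")
  case True
  then show ?thesis
    using return_in_space_prob_algebra[OF start] by (simp add: transition_def[abs_def])
next
  case False
  then show ?thesis
    using measurable_compose[OF measurable_prefix_coord[of "i - 1" i] kernel]
    by (simp add: transition_def[abs_def])
qed

sublocale IT: Ionescu_Tulcea transition "\<lambda>_. N"
  using prob_algebraD(1)[OF measurable_space[OF measurable_transition]]
  by (intro Ionescu_Tulcea.intro measurable_prob_algebraD measurable_transition)

abbreviation "paths \<equiv> IT.PF.lim"

definition prefix_law :: "nat \<Rightarrow> (nat \<Rightarrow> 'z) measure" where
  "prefix_law n = IT.C 0 n (\<lambda>_. undefined)"

lemma undefined_in_prefix_space_0 [simp]: "(\<lambda>_. undefined) \<in> space (prefix_space 0)"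
  by (simp add: space_PiM)

lemma prefix_law_in_space: "prefix_law n \<in> space (prob_algebra (prefix_space n))"
  using IT.sets_C[OF undefined_in_prefix_space_0, of n]
      IT.prob_space_C[OF undefined_in_prefix_space_0, of n]
  by (simp add: space_prob_algebra prefix_law_def)

lemma distr_paths_restrict: "distr paths (prefix_space n) (\<lambda>\<omega>. restrict \<omega> {0..<n}) = prefix_law n"
proof -
  have "IT.CI {0..<n} = prefix_law n"
  proof (rule measure_eqI)
    show "sets (IT.CI {0..<n}) = sets (prefix_law n)"
      by (simp add: IT.CI_def prob_algebraD(2)[OF prefix_law_in_space])
    fix X assume "X \<in> sets (IT.CI {0..<n})"
    then have X: "X \<in> sets (prefix_space n)" by (simp add: IT.CI_def)
    then have "prod_emb {0..<n} (\<lambda>_. N) {0..<n} X = X"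
      using sets.sets_into_space[OF X] by (intro prod_emb_id) (simp add: space_PiM)
    then show "emeasure (IT.CI {0..<n}) X = emeasure (prefix_law n) X"
      using IT.emeasure_CI[OF order_refl X] by (simp add: prefix_law_def)
  qed
  then show ?thesis by (simp add: IT.distr_lim)
qed

lemma measurable_restrict_paths: "(\<lambda>\<omega>. restrict \<omega> {0..<n}) \<in> measurable paths (prefix_space n)"
  by (subst measurable_cong_sets[OF IT.PF.sets_lim refl]) (rule measurable_restrict_subset, simp)

lemma prob_space_paths: "prob_space paths"
  using prob_algebraD(1)[OF prefix_law_in_space[of 0]]
  by (intro prob_space_distrD[OF measurable_restrict_paths[of 0]]) (simp only: distr_paths_restrict)

lemma nn_integral_paths_restrict:
  assumes "f \<in> borel_measurable (prefix_space n)"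
  shows "(\<integral>\<^sup>+\<omega>. f (restrict \<omega> {0..<n}) \<partial>paths) = (\<integral>\<^sup>+\<omega>. f \<omega> \<partial>prefix_law n)"
  unfolding distr_paths_restrict[symmetric]
  using assms by (intro nn_integral_distr[symmetric] measurable_restrict_paths) simp

lemma nn_integral_prefix_law_Suc:
  assumes f: "f \<in> borel_measurable (prefix_space (Suc n))"
  shows "(\<integral>\<^sup>+\<omega>. f \<omega> \<partial>prefix_law (Suc n))
      = (\<integral>\<^sup>+\<omega>. \<integral>\<^sup>+z. f (fun_upd \<omega> n z) \<partial>transition n \<omega> \<partial>prefix_law n)"
proof -
  have "IT.eP n \<in> measurable (prefix_law n) (subprob_algebra (prefix_space (Suc n)))"
    using IT.measurable_eP[of n] by (simp add: measurable_prob_algebra_cong[OF prefix_law_in_space])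
  then have "(\<integral>\<^sup>+\<omega>. f \<omega> \<partial>prefix_law (Suc n)) = (\<integral>\<^sup>+\<omega>. \<integral>\<^sup>+x. f x \<partial>IT.eP n \<omega> \<partial>prefix_law n)"
    by (simp only: prefix_law_def IT.C.simps add_0) (rule nn_integral_bind[OF f])
  also have "\<dots> = (\<integral>\<^sup>+\<omega>. \<integral>\<^sup>+z. f (fun_upd \<omega> n z) \<partial>transition n \<omega> \<partial>prefix_law n)"
    by (intro nn_integral_cong IT.nn_integral_eP f)
       (simp add: prob_algebraD(3)[OF prefix_law_in_space])
  finally show ?thesis .
qed

lemma AE_paths_prefixI:
  assumes Q: "Measurable.pred (prefix_space (Suc n)) Q"
    and AE: "\<And>\<omega>. \<omega> \<in> space (prefix_space n) \<Longrightarrow> AE z in transition n \<omega>. Q (fun_upd \<omega> n z)"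
  shows "AE \<omega> in paths. Q (restrict \<omega> {0..<Suc n})"
proof -
  let ?bad = "{\<omega> \<in> space (prefix_space (Suc n)). \<not> Q \<omega>}"
  have bad: "?bad \<in> sets (prefix_space (Suc n))" using Q by measurable
  have "(\<integral>\<^sup>+\<omega>. indicator ?bad \<omega> \<partial>prefix_law (Suc n))
      = (\<integral>\<^sup>+\<omega>. \<integral>\<^sup>+z. indicator ?bad (fun_upd \<omega> n z) \<partial>transition n \<omega> \<partial>prefix_law n)"
    using bad by (intro nn_integral_prefix_law_Suc) simp
  also have "\<dots> = (\<integral>\<^sup>+\<omega>. 0 \<partial>prefix_law n)"
  proof (rule nn_integral_cong)
    fix \<omega> assume "\<omega> \<in> space (prefix_law n)"
    then have "\<omega> \<in> space (prefix_space n)" by (simp add: prob_algebraD(3)[OF prefix_law_in_space])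
    then have "AE z in transition n \<omega>. indicator ?bad (fun_upd \<omega> n z) = (0 :: ennreal)"
      by (rule AE_mp[OF AE]) (auto simp: indicator_def)
    then show "(\<integral>\<^sup>+z. indicator ?bad (fun_upd \<omega> n z) \<partial>transition n \<omega>) = 0"
      by (simp cong: nn_integral_cong_AE)
  qed
  finally have "?bad \<in> null_sets (prefix_law (Suc n))"
    using bad prob_algebraD(2)[OF prefix_law_in_space] by (auto simp: null_sets_def)
  moreover have "{\<omega> \<in> space (prefix_law (Suc n)). \<not> Q \<omega>} \<subseteq> ?bad"
    by (simp add: prob_algebraD(3)[OF prefix_law_in_space])
  ultimately have "AE \<omega> in prefix_law (Suc n). Q \<omega>" by (rule AE_I')
  then show ?thesis
    unfolding distr_paths_restrict[symmetric]
    using Q by (subst (asm) AE_distr_iff[OF measurable_restrict_paths]) (simp_all add: pred_def)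
qed

lemma AE_paths_start:
  assumes Q: "Measurable.pred N Q" and z0: "Q z0"
  shows "AE \<omega> in paths. Q (\<omega> 0)"
proof -
  have "AE z in return N z0. Q z" using z0 start Q by (subst AE_return) simp_all
  then have "AE \<omega> in paths. Q (restrict \<omega> {0..<Suc 0} 0)"
    by (intro AE_paths_prefixI measurable_compose[OF measurable_prefix_coord Q])
       (simp_all only: transition_0 fun_upd_same lessI)
  then show ?thesis by simp
qed

lemma AE_paths_step:
  assumes Q: "Measurable.pred (N \<Otimes>\<^sub>M N) (\<lambda>(z, z'). Q z z')"
    and step: "\<And>z. z \<in> space N \<Longrightarrow> AE z' in \<kappa> z. Q z z'"
  shows "AE \<omega> in paths. \<forall>n. Q (\<omega> n) (\<omega> (Suc n))"
  unfolding AE_all_countable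
proof
  fix n
  have "(\<lambda>\<omega>. (\<omega> n, \<omega> (Suc n))) \<in> measurable (prefix_space (Suc (Suc n))) (N \<Otimes>\<^sub>M N)"
    by (intro measurable_Pair measurable_prefix_coord) simp_all
  from measurable_compose[OF this Q]
  have "Measurable.pred (prefix_space (Suc (Suc n))) (\<lambda>\<omega>. Q (\<omega> n) (\<omega> (Suc n)))" by simp
  then have "AE \<omega> in paths.
      Q (restrict \<omega> {0..<Suc (Suc n)} n) (restrict \<omega> {0..<Suc (Suc n)} (Suc n))"
  proof (rule AE_paths_prefixI)
    fix \<omega> assume "\<omega> \<in> space (prefix_space (Suc n))"
    from step[OF measurable_space[OF measurable_prefix_coord[OF lessI] this]]
    show "AE z in transition (Suc n) \<omega>. Q (fun_upd \<omega> (Suc n) z n) (fun_upd \<omega> (Suc n) z (Suc n))"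
      unfolding transition_Suc by simp
  qed
  then show "AE \<omega> in paths. Q (\<omega> n) (\<omega> (Suc n))" by simp
qed

definition stopped_value :: "'z set \<Rightarrow> (nat \<Rightarrow> 'z \<Rightarrow> ennreal) \<Rightarrow> nat \<Rightarrow> nat \<Rightarrow> (nat \<Rightarrow> 'z) \<Rightarrow> ennreal"
  where "stopped_value B v n l \<omega> = (if \<exists>i<n. \<omega> i \<in> B then 1 else v l (\<omega> n))"

context
  fixes B :: "'z set" and v :: "nat \<Rightarrow> 'z \<Rightarrow> ennreal"
  assumes B: "B \<in> sets N" and v: "\<And>l. v l \<in> borel_measurable N"
    and v_0: "\<And>z. z \<in> space N \<Longrightarrow> v 0 z \<le> indicator B z"
    and v_le_1: "\<And>l z. z \<in> space N \<Longrightarrow> v l z \<le> 1"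
    and v_Suc: "\<And>l z. z \<in> space N \<Longrightarrow> z \<notin> B \<Longrightarrow> v (Suc l) z \<le> (\<integral>\<^sup>+z'. v l z' \<partial>\<kappa> z)"
begin

lemma measurable_stopped_value: "stopped_value B v n l \<in> borel_measurable (prefix_space (Suc n))"
proof -
  have "{\<omega> \<in> space (prefix_space (Suc n)). \<omega> i \<in> B} \<in> sets (prefix_space (Suc n))" if "i < n" for i
    using measurable_sets[OF measurable_prefix_coord B, of i "Suc n"] that
    by (simp add: vimage_def Int_def conj_commute)
  then have "(\<Union>i<n. {\<omega> \<in> space (prefix_space (Suc n)). \<omega> i \<in> B}) \<in> sets (prefix_space (Suc n))"
    by auto
  also have "(\<Union>i<n. {\<omega> \<in> space (prefix_space (Suc n)). \<omega> i \<in> B})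
      = {\<omega> \<in> space (prefix_space (Suc n)). \<exists>i<n. \<omega> i \<in> B}" by auto
  finally have hit: "{\<omega> \<in> space (prefix_space (Suc n)). \<exists>i<n. \<omega> i \<in> B}
      \<in> sets (prefix_space (Suc n))" .
  have "(\<lambda>\<omega>. v l (\<omega> n)) \<in> borel_measurable (prefix_space (Suc n))"
    by (rule measurable_compose[OF measurable_prefix_coord v]) simp
  from measurable_const[of 1] this hit show ?thesis
    unfolding stopped_value_def[abs_def] by (rule measurable_If) simp
qed

lemma stopped_value_le_step:
  assumes \<omega>: "\<omega> \<in> space (prefix_space (Suc n))"
  shows "stopped_value B v n (Suc l) \<omega>
      \<le> (\<integral>\<^sup>+z. stopped_value B v (Suc n) l (fun_upd \<omega> (Suc n) z) \<partial>\<kappa> (\<omega> n))"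
proof -
  have \<omega>_n: "\<omega> n \<in> space N" by (rule measurable_space[OF measurable_prefix_coord \<omega>]) simp
  interpret prob_space "\<kappa> (\<omega> n)" by (rule prob_algebraD(1)[OF measurable_space[OF kernel \<omega>_n]])
  have hit_upd: "(\<exists>i<Suc n. (fun_upd \<omega> (Suc n) z) i \<in> B) \<longleftrightarrow> (\<exists>i<Suc n. \<omega> i \<in> B)" for z
    by (intro ex_cong1 conj_cong refl) simp
  show ?thesis
  proof (cases "\<exists>i<Suc n. \<omega> i \<in> B")
    case True
    then have "stopped_value B v (Suc n) l (fun_upd \<omega> (Suc n) z) = 1" for z
      unfolding stopped_value_def hit_upd by (simp only: if_True)
    moreover have "stopped_value B v n (Suc l) \<omega> \<le> 1"
      using v_le_1[OF \<omega>_n] by (simp add: stopped_value_def)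
    ultimately show ?thesis using emeasure_space_1 by simp
  next
    case False
    then have "stopped_value B v (Suc n) l (fun_upd \<omega> (Suc n) z) = v l z" for z
      unfolding stopped_value_def hit_upd by (simp only: if_False fun_upd_same)
    moreover have "\<not> (\<exists>i<n. \<omega> i \<in> B)" and outside: "\<omega> n \<notin> B"
      using False by (blast intro: less_SucI)+
    then have "stopped_value B v n (Suc l) \<omega> = v (Suc l) (\<omega> n)"
      unfolding stopped_value_def by (simp only: if_False)
    ultimately show ?thesis using v_Suc[OF \<omega>_n outside] by simp
  qed
qed

lemma value_le_integral_stopped_value:
  "v (n + l) z0 \<le> (\<integral>\<^sup>+\<omega>. stopped_value B v n l \<omega> \<partial>prefix_law (Suc n))"
proof (induction n arbitrary: l)
  case 0
  interpret prob_space "prefix_law 0" by (rule prob_algebraD(1)[OF prefix_law_in_space])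
  have "(\<integral>\<^sup>+\<omega>. stopped_value B v 0 l \<omega> \<partial>prefix_law (Suc 0))
      = (\<integral>\<^sup>+\<omega>. \<integral>\<^sup>+z. v l z \<partial>return N z0 \<partial>prefix_law 0)"
    by (subst nn_integral_prefix_law_Suc[OF measurable_stopped_value])
       (simp add: stopped_value_def transition_0)
  also have "\<dots> = v l z0" using v start emeasure_space_1 by (simp add: nn_integral_return)
  finally show ?case by simp
next
  case (Suc n)
  have "v (Suc n + l) z0 \<le> (\<integral>\<^sup>+\<omega>. stopped_value B v n (Suc l) \<omega> \<partial>prefix_law (Suc n))"
    using Suc[of "Suc l"] by simp
  also have "\<dots>
      \<le> (\<integral>\<^sup>+\<omega>. \<integral>\<^sup>+z. stopped_value B v (Suc n) l (fun_upd \<omega> (Suc n) z) \<partial>transition (Suc n) \<omega>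
          \<partial>prefix_law (Suc n))"
    using stopped_value_le_step prob_algebraD(3)[OF prefix_law_in_space]
    by (intro nn_integral_mono) (simp add: transition_Suc)
  also have "\<dots> = (\<integral>\<^sup>+\<omega>. stopped_value B v (Suc n) l \<omega> \<partial>prefix_law (Suc (Suc n)))"
    by (rule nn_integral_prefix_law_Suc[OF measurable_stopped_value, symmetric])
  finally show ?case .
qed

theorem value_le_hitting_probability:
  "v n z0 \<le> emeasure paths {\<omega> \<in> space paths. \<exists>i\<le>n. \<omega> i \<in> B}"
proof -
  have hit: "{\<omega> \<in> space paths. \<exists>i\<le>n. \<omega> i \<in> B} \<in> sets paths"
  proof -
    have "{\<omega> \<in> space paths. \<omega> i \<in> B} \<in> sets paths" for i
      using measurable_sets[OF measurable_component_singleton[of i UNIV "\<lambda>_. N"] B]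
      by (simp add: vimage_def Int_def conj_commute)
    then have "(\<Union>i\<le>n. {\<omega> \<in> space paths. \<omega> i \<in> B}) \<in> sets paths" by blast
    also have "(\<Union>i\<le>n. {\<omega> \<in> space paths. \<omega> i \<in> B}) = {\<omega> \<in> space paths. \<exists>i\<le>n. \<omega> i \<in> B}" by auto
    finally show ?thesis .
  qed
  have "v n z0 \<le> (\<integral>\<^sup>+\<omega>. stopped_value B v n 0 (restrict \<omega> {0..<Suc n}) \<partial>paths)"
    unfolding nn_integral_paths_restrict[OF measurable_stopped_value]
    using value_le_integral_stopped_value[of n 0] by simp
  also have "\<dots> \<le> (\<integral>\<^sup>+\<omega>. indicator {\<omega> \<in> space paths. \<exists>i\<le>n. \<omega> i \<in> B} \<omega> \<partial>paths)"
  proof (rule nn_integral_mono)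
    fix \<omega> assume \<omega>: "\<omega> \<in> space paths"
    then have \<omega>_n: "\<omega> n \<in> space N" by (simp add: space_PiM PiE_iff)
    show "stopped_value B v n 0 (restrict \<omega> {0..<Suc n})
        \<le> indicator {\<omega> \<in> space paths. \<exists>i\<le>n. \<omega> i \<in> B} \<omega>"
    proof (cases "\<exists>i\<le>n. \<omega> i \<in> B")
      case True
      with \<omega> have "indicator {\<omega> \<in> space paths. \<exists>i\<le>n. \<omega> i \<in> B} \<omega> = (1 :: ennreal)"
        by (simp only: indicator_simps mem_Collect_eq simp_thms)
      then show ?thesis using v_le_1[OF \<omega>_n] by (simp add: stopped_value_def)
    next
      case False
      then have "stopped_value B v n 0 (restrict \<omega> {0..<Suc n}) = v 0 (\<omega> n)"
        by (auto simp: stopped_value_def)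
      also have "\<dots> \<le> 0" using v_0[OF \<omega>_n] False by simp
      finally show ?thesis by simp
    qed
  qed
  also have "\<dots> = emeasure paths {\<omega> \<in> space paths. \<exists>i\<le>n. \<omega> i \<in> B}"
    by (rule nn_integral_indicator[OF hit])
  finally show ?thesis .
qed

end

end

section \<open>Value iteration\<close>

lemma measurable_count_space_apply2:
  fixes f :: "'a \<Rightarrow> 'q::countable"
  assumes f: "f \<in> measurable M (count_space UNIV)" and g: "g \<in> measurable M (count_space UNIV)"
  shows "(\<lambda>x. h (f x) (g x)) \<in> measurable M (count_space UNIV)"
  by (intro measurable_compose_countable[OF measurable_compose[OF g] f]) simp

lemma measurable_trans:
  assumes "is_gmdp M" "f \<in> borel_measurable N" "g \<in> borel_measurable N"
  shows "(\<lambda>z. trans M (f z) (g z)) \<in> measurable N (prob_algebra borel)"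
proof -
  have "(\<lambda>z. (f z, g z)) \<in> borel_measurable N" using assms(2,3) by simp
  moreover have "(\<lambda>(x, u). trans M x u) \<in> measurable borel (prob_algebra borel)"
    using assms(1) by (simp add: is_gmdp_def)
  ultimately have "(\<lambda>z. case (f z, g z) of (x, u) \<Rightarrow> trans M x u)
      \<in> measurable N (prob_algebra borel)"
    by (rule measurable_compose)
  then show ?thesis by simp
qed

lemma measurable_trans_input: "is_gmdp M \<Longrightarrow> trans M x \<in> measurable borel (prob_algebra borel)"
  by (rule measurable_trans) simp_all

lemma trans_in_space_prob_algebra: "is_gmdp M \<Longrightarrow> trans M x u \<in> space (prob_algebra borel)"
  by (rule measurable_space[OF measurable_trans_input]) simp_all

lemma measurable_label:
  assumes "is_gmdp M" "L \<in> measurable borel (count_space UNIV)" "f \<in> borel_measurable N"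
  shows "(\<lambda>z. L (out M (f z))) \<in> measurable N (count_space UNIV)"
  using assms by (intro measurable_compose[OF measurable_compose[OF _ _] assms(2)])
     (auto simp: is_gmdp_def)

locale abstract_model =
  fixes Mh :: "('x::polish_space, 'u::polish_space, 'y::metric_space) gmdp"
    and L :: "'y \<Rightarrow> 'ap::finite set" and F :: "'q::finite set" and \<tau> :: "'q \<Rightarrow> 'ap set \<Rightarrow> 'q"
    and \<mu> :: "'x \<times> 'q \<Rightarrow> 'u measure" and \<delta> :: real
  assumes Mh: "is_gmdp Mh" and L: "L \<in> measurable borel (count_space UNIV)"
    and policy: "is_policy \<mu>" and \<delta>: "0 \<le> \<delta>"
begin

lemma measurable_policy: "\<mu> \<in> measurable (univ_alg XQ) (prob_algebra borel)"
  using policy by (simp add: is_policy_def)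

lemma policy_in_space_prob_algebra: "\<mu> s \<in> space (prob_algebra borel)"
  by (rule measurable_space[OF measurable_policy]) (simp add: space_pair_measure)

definition successor :: "'q \<Rightarrow> 'x \<Rightarrow> 'x \<times> 'q" where
  "successor q x' = (x', \<tau> q (L (out Mh x')))"

lemma measurable_successor:
  assumes "f \<in> measurable N (count_space UNIV)" "g \<in> borel_measurable N"
  shows "(\<lambda>z. successor (f z) (g z)) \<in> measurable N XQ"
  unfolding successor_def
  by (rule measurable_Pair[OF assms(2)
      measurable_count_space_apply2[OF assms(1) measurable_label[OF Mh L assms(2)]]])

lemma measurable_successor_state: "successor q \<in> measurable borel XQ"
  by (rule measurable_successor) simp_all

abbreviation "policy_kernel s \<equiv> prod_kernel Mh L \<tau> s (\<mu> s)"

lemma policy_kernel_eq: "policy_kernel (x, q) = distr (\<mu> (x, q) \<bind> trans Mh x) XQ (successor q)"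
  by (simp add: prod_kernel_def kmix_def successor_def[abs_def]
    distr_bind_prob_algebra[OF policy_in_space_prob_algebra measurable_trans_input[OF Mh]
      measurable_successor_state[unfolded successor_def[abs_def]]])

lemma measurable_policy_kernel: "policy_kernel \<in> measurable (univ_alg XQ) (prob_algebra XQ)"
proof -
  have state: "fst \<in> borel_measurable (univ_alg XQ)"
    and mode: "snd \<in> measurable (univ_alg XQ) (count_space UNIV)"
    by (auto intro: measurable_univ_algI1)
  have "(\<lambda>(s, u). trans Mh (fst s) u) \<in> measurable (univ_alg XQ \<Otimes>\<^sub>M borel) (prob_algebra borel)"
    unfolding split_beta'
    by (intro measurable_trans[OF Mh] measurable_compose[OF measurable_fst state] measurable_snd)
  then have "(\<lambda>s. \<mu> s \<bind> trans Mh (fst s)) \<in> measurable (univ_alg XQ) (prob_algebra borel)"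
    by (rule measurable_bind_prob_space2[OF measurable_policy])
  moreover have "(\<lambda>(s, x'). successor (snd s) x') \<in> measurable (univ_alg XQ \<Otimes>\<^sub>M borel) XQ"
    unfolding split_beta'
    by (intro measurable_successor measurable_compose[OF measurable_fst mode] measurable_snd)
  ultimately have "(\<lambda>s. distr (\<mu> s \<bind> trans Mh (fst s)) XQ (successor (snd s)))
      \<in> measurable (univ_alg XQ) (prob_algebra XQ)"
    by (rule measurable_distr_prob_space2)
  moreover have "policy_kernel s = distr (\<mu> s \<bind> trans Mh (fst s)) XQ (successor (snd s))" for s
    by (cases s) (simp add: policy_kernel_eq)
  ultimately show ?thesis by simp
qed

lemma policy_kernel_in_space_prob_algebra: "policy_kernel s \<in> space (prob_algebra XQ)"
  by (rule measurable_space[OF measurable_policy_kernel]) (simp add: space_pair_measure)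

definition payoff :: "('x \<times> 'q \<Rightarrow> real) \<Rightarrow> 'x \<times> 'q \<Rightarrow> real" where
  "payoff V s = max (indicator F (snd s)) (V s)"

definition admissible :: "('x \<times> 'q \<Rightarrow> real) \<Rightarrow> bool" where
  "admissible V \<longleftrightarrow> V \<in> borel_measurable (univ_alg XQ) \<and> (\<forall>s. 0 \<le> V s \<and> V s \<le> 1)"

lemma admissible_payoff: "admissible V \<Longrightarrow> admissible (payoff V)"
proof -
  assume V: "admissible V"
  have "(\<lambda>s. indicat_real F (snd s)) \<in> borel_measurable (univ_alg XQ)"
    by (rule measurable_compose[OF measurable_univ_algI1[OF measurable_snd]]) simp
  then show ?thesis
    using V
    by (auto simp: admissible_def payoff_def[abs_def] indicator_def intro!: borel_measurable_max)
qed

context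
  fixes V :: "'x \<times> 'q \<Rightarrow> real"
  assumes V: "admissible V"
begin

lemma measurable_payoff: "payoff V \<in> borel_measurable (univ_alg XQ)"
  using admissible_payoff[OF V] by (simp add: admissible_def)

lemma payoff_bounds: "0 \<le> payoff V s" "payoff V s \<le> 1"
  using admissible_payoff[OF V] unfolding admissible_def by blast+

lemma Tmu_eq: "Tmu Mh L F \<tau> \<mu> V s = (\<integral>s'. payoff V s' \<partial>uext (policy_kernel s))"
  unfolding integral_uext[OF policy_kernel_in_space_prob_algebra measurable_payoff]
  by (simp add: Tmu_def payoff_def[abs_def])

lemma integrable_payoff: "integrable (uext (policy_kernel s)) (payoff V)"
proof -
  interpret prob_space "uext (policy_kernel s)"
    by (rule prob_space_uext[OF prob_algebraD(1)[OF policy_kernel_in_space_prob_algebra]])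
  show ?thesis
    using payoff_bounds measurable_payoff
    by (intro integrable_const_bound[where B = 1])
       (auto simp: measurable_uext_cong[OF policy_kernel_in_space_prob_algebra])
qed

lemma ennreal_Tmu:
  "ennreal (Tmu Mh L F \<tau> \<mu> V s) = (\<integral>\<^sup>+s'. ennreal (payoff V s') \<partial>uext (policy_kernel s))"
  unfolding Tmu_eq using payoff_bounds
  by (intro nn_integral_eq_integral[symmetric] integrable_payoff) auto

lemma ennreal_Tmu_successor:
  "ennreal (Tmu Mh L F \<tau> \<mu> V (x, q))
    = (\<integral>\<^sup>+x'. ennreal (payoff V (successor q x')) \<partial>uext (\<mu> (x, q) \<bind> trans Mh x))"
  unfolding ennreal_Tmu policy_kernel_eq
  by (rule nn_integral_uext_distr[OF bind_in_space_prob_algebra[OF policy_in_space_prob_algebra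
        measurable_trans_input[OF Mh]] measurable_successor_state
        measurable_compose[OF measurable_payoff measurable_ennreal]])

lemma Tmu_nonneg: "0 \<le> Tmu Mh L F \<tau> \<mu> V s"
  unfolding Tmu_eq using payoff_bounds by (intro integral_nonneg_AE) auto

lemma admissible_Tmu_delta: "admissible (Tmu_delta Mh L F \<tau> \<mu> \<delta> V)"
proof -
  have "(\<lambda>s. \<integral>\<^sup>+s'. ennreal (payoff V s') \<partial>uext (policy_kernel s)) \<in> borel_measurable (univ_alg XQ)"
    using measurable_payoff
    by (intro measurable_compose[OF measurable_prob_algebraD[OF
        measurable_uext_univ_kernel[OF measurable_policy_kernel]]
      nn_integral_measurable_subprob_algebra]) auto
  then have "(\<lambda>s. enn2real (ennreal (Tmu Mh L F \<tau> \<mu> V s))) \<in> borel_measurable (univ_alg XQ)"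
    unfolding ennreal_Tmu by (rule borel_measurable_enn2real)
  then have "Tmu Mh L F \<tau> \<mu> V \<in> borel_measurable (univ_alg XQ)" by (simp add: Tmu_nonneg)
  then show ?thesis unfolding admissible_def Tmu_delta_def[abs_def] clip01_def by auto
qed

end

lemma Tmu_delta_mono:
  assumes V: "admissible V" and W: "admissible W" and V_le_W: "\<And>s. V s \<le> W s"
  shows "Tmu_delta Mh L F \<tau> \<mu> \<delta> V s \<le> Tmu_delta Mh L F \<tau> \<mu> \<delta> W s"
proof -
  have "Tmu Mh L F \<tau> \<mu> V s \<le> Tmu Mh L F \<tau> \<mu> W s"
    unfolding Tmu_eq[OF V] Tmu_eq[OF W]
    by (intro integral_mono integrable_payoff V W) (simp add: payoff_def V_le_W max.coboundedI2)
  then show ?thesis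
    unfolding Tmu_delta_def clip01_def by (intro min.mono max.mono order_refl diff_right_mono)
qed

definition value_iterate :: "nat \<Rightarrow> 'x \<times> 'q \<Rightarrow> real" where
  "value_iterate l = (Tmu_delta Mh L F \<tau> \<mu> \<delta> ^^ l) (\<lambda>_. 0)"

lemma value_iterate_0: "value_iterate 0 = (\<lambda>_. 0)"
  by (simp add: value_iterate_def)

lemma value_iterate_Suc: "value_iterate (Suc l) = Tmu_delta Mh L F \<tau> \<mu> \<delta> (value_iterate l)"
  by (simp add: value_iterate_def)

lemma admissible_value_iterate: "admissible (value_iterate l)"
  by (induction l)
     (simp add: admissible_def value_iterate_0, simp add: value_iterate_Suc admissible_Tmu_delta)

lemma value_iterate_bounds: "0 \<le> value_iterate l s" "value_iterate l s \<le> 1"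
  using admissible_value_iterate[of l] unfolding admissible_def by blast+

lemma incseq_value_iterate: "incseq (\<lambda>l. value_iterate l s)"
proof (rule incseq_SucI)
  show "value_iterate l s \<le> value_iterate (Suc l) s" for l
  proof (induction l arbitrary: s)
    case 0
    then show ?case by (simp add: value_iterate_0 value_iterate_bounds)
  next
    case (Suc l)
    then show ?case
      unfolding value_iterate_Suc[of l] value_iterate_Suc[of "Suc l"]
      by (intro Tmu_delta_mono admissible_Tmu_delta admissible_value_iterate)
  qed
qed

lemma V_inf_le:
  assumes "\<And>l. value_iterate l s \<le> c"
  shows "V_inf Mh L F \<tau> \<mu> \<delta> s \<le> c"
proof -
  obtain v where v: "(\<lambda>l. value_iterate l s) \<longlonglongrightarrow> v"
    using incseq_convergent[OF incseq_value_iterate] assms by blast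
  then have "V_inf Mh L F \<tau> \<mu> \<delta> s = v"
    unfolding V_inf_def value_iterate_def[symmetric] by (rule limI)
  then show ?thesis using LIMSEQ_le_const2[OF v] assms by blast
qed

lemma value_iterate_Suc_le:
  assumes "ennreal (Tmu Mh L F \<tau> \<mu> (value_iterate l) s) \<le> J + ennreal \<delta>"
  shows "ennreal (value_iterate (Suc l) s) \<le> J"
proof (cases J)
  case (real j)
  then have "Tmu Mh L F \<tau> \<mu> (value_iterate l) s \<le> j + \<delta>"
    using assms \<delta> by (simp flip: ennreal_plus)
  then have "value_iterate (Suc l) s \<le> j"
    unfolding value_iterate_Suc Tmu_delta_def clip01_def using real by simp
  then show ?thesis using real by (simp add: ennreal_leI)
qed simp

lemma robust_sat_prob_le_0:
  assumes "F = {}"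
  shows "robust_sat_prob Mh L q0 F \<tau> \<mu> \<delta> \<le> 0"
proof -
  have "value_iterate l = (\<lambda>_. 0)" for l
  proof (induction l)
    case (Suc l)
    then show ?case
      using \<delta> assms unfolding value_iterate_Suc Tmu_delta_def[abs_def] Tmu_def
      by (simp add: clip01_def)
  qed (rule value_iterate_0)
  then have "V_inf Mh L F \<tau> \<mu> \<delta> s \<le> 0" for s by (intro V_inf_le) simp
  then show ?thesis by (simp add: robust_sat_prob_def assms)
qed

end

section \<open>Automaton runs\<close>

lemma measurable_dfa_run:
  fixes \<tau> :: "'q::finite \<Rightarrow> 'ap::finite set \<Rightarrow> 'q"
  assumes "\<And>i. (\<lambda>\<omega>. w \<omega> i) \<in> measurable S (count_space UNIV)"
  shows "(\<lambda>\<omega>. dfa_run \<tau> q0 (w \<omega>) n) \<in> measurable S (count_space UNIV)"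
proof (induction n)
  case (Suc n)
  then show ?case unfolding dfa_run.simps by (rule measurable_count_space_apply2[OF _ assms])
qed simp

lemma sets_dfa_accepts:
  fixes \<tau> :: "'q::finite \<Rightarrow> 'ap::finite set \<Rightarrow> 'q"
  assumes "\<And>i. (\<lambda>\<omega>. w \<omega> i) \<in> measurable S (count_space UNIV)"
  shows "{\<omega> \<in> space S. dfa_accepts q0 F \<tau> (w \<omega>)} \<in> sets S"
proof -
  have "(\<lambda>\<omega>. dfa_run \<tau> q0 (w \<omega>) n) -` F \<inter> space S \<in> sets S" for n
    by (rule measurable_sets[OF measurable_dfa_run[OF assms]]) simp
  then have "(\<Union>n. (\<lambda>\<omega>. dfa_run \<tau> q0 (w \<omega>) n) -` F \<inter> space S) \<in> sets S" by blast
  also have "(\<Union>n. (\<lambda>\<omega>. dfa_run \<tau> q0 (w \<omega>) n) -` F \<inter> space S)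
      = {\<omega> \<in> space S. dfa_accepts q0 F \<tau> (w \<omega>)}"
    by (auto simp: dfa_accepts_def)
  finally show ?thesis .
qed

lemma dfa_accepts_if_restarted_run_hits:
  assumes start: "q 0 \<in> F" and step: "\<And>i. q (Suc i) = \<tau> (if q i \<in> F then q0 else q i) (w i)"
    and hit: "q (Suc n) \<in> F"
  shows "dfa_accepts q0 F \<tau> w"
proof -
  define k where "k = (LEAST i. q (Suc i) \<in> F)"
  have q_k: "q (Suc k) \<in> F" unfolding k_def by (rule LeastI[of _ n]) (rule hit)
  have before_k: "q (Suc j) \<notin> F" if "j < k" for j
    using not_less_Least[OF that[unfolded k_def]] .
  have "q (Suc j) = dfa_run \<tau> q0 w (Suc j)" if "j \<le> k" for j
    using that
  proof (induction j)
    case 0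
    then show ?case using start by (simp add: step[of 0])
  next
    case (Suc j)
    then show ?case using before_k[of j] by (simp add: step[of "Suc j"])
  qed
  then show ?thesis using q_k unfolding dfa_accepts_def by (metis order_refl)
qed

section \<open>Closed loops\<close>

context
  fixes Mm :: "'m measure" and C :: "('m, 'xc::polish_space, 'uc::polish_space) strategy"
    and M :: "('xc, 'uc, 'y::metric_space) gmdp"
  assumes C: "is_strategy Mm C" and M: "is_gmdp M"
begin

abbreviation (input) "loop_space \<equiv> univ_alg (Mm \<Otimes>\<^sub>M (borel :: 'xc measure))"

definition plant_step :: "'xc \<Rightarrow> 'm \<Rightarrow> 'uc \<Rightarrow> ('m \<times> 'xc) measure" where
  "plant_step x m u = uext (trans M x u) \<bind> (\<lambda>x'. return loop_space (m, x'))"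

definition input_step :: "'xc \<Rightarrow> 'm \<Rightarrow> ('m \<times> 'xc) measure" where
  "input_step x m = uext (cout C m) \<bind> plant_step x m"

lemma cl_step_eq: "cl_step Mm C M z = uext (ctrans C (fst z) (snd z)) \<bind> input_step (snd z)"
  unfolding cl_step_def input_step_def[abs_def] plant_step_def[abs_def] ..

lemma measurable_plant_step:
  "(\<lambda>((x, m), u). plant_step x m u)
      \<in> measurable (univ_alg ((borel \<Otimes>\<^sub>M Mm) \<Otimes>\<^sub>M borel)) (prob_algebra loop_space)"
proof -
  have "(\<lambda>s. trans M (fst (fst s)) (snd s))
      \<in> measurable ((borel \<Otimes>\<^sub>M Mm) \<Otimes>\<^sub>M borel) (prob_algebra borel)"
    by (rule measurable_trans[OF M]) simp_all
  moreover have "(\<lambda>t. (snd (fst (fst t)), snd t))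
      \<in> measurable (((borel \<Otimes>\<^sub>M Mm) \<Otimes>\<^sub>M borel) \<Otimes>\<^sub>M borel) (Mm \<Otimes>\<^sub>M borel)"
    by measurable
  from measurable_compose[OF measurable_univ_alg_univ_alg[OF this] measurable_return_prob_space]
  have "(\<lambda>(s, x'). return loop_space (snd (fst s), x'))
      \<in> measurable (univ_alg (((borel \<Otimes>\<^sub>M Mm) \<Otimes>\<^sub>M borel) \<Otimes>\<^sub>M borel)) (prob_algebra loop_space)"
    by (simp add: split_beta')
  ultimately have "(\<lambda>s. uext (trans M (fst (fst s)) (snd s))
      \<bind> (\<lambda>x'. return loop_space (snd (fst s), x')))
      \<in> measurable (univ_alg ((borel \<Otimes>\<^sub>M Mm) \<Otimes>\<^sub>M borel)) (prob_algebra loop_space)"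
    by (rule measurable_bind_uext[OF measurable_univ_algI1])
  then show ?thesis by (simp add: plant_step_def split_beta')
qed

lemma measurable_cout: "cout C \<in> measurable (univ_alg Mm) (prob_algebra borel)"
  using C by (simp add: is_strategy_def)

lemma measurable_input_step:
  "(\<lambda>(x, m). input_step x m) \<in> measurable (univ_alg (borel \<Otimes>\<^sub>M Mm)) (prob_algebra loop_space)"
proof -
  have "(\<lambda>(s, u). plant_step (fst s) (snd s) u)
      \<in> measurable (univ_alg ((borel \<Otimes>\<^sub>M Mm) \<Otimes>\<^sub>M borel)) (prob_algebra loop_space)"
    using measurable_plant_step by (simp add: split_beta')
  from measurable_bind_uext[OF measurable_compose_univ_alg[OF measurable_snd measurable_cout] this]
  show ?thesis by (simp add: input_step_def split_beta')
qed

lemma measurable_ctrans: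
  "(\<lambda>z. ctrans C (fst z) (snd z)) \<in> measurable (univ_alg (Mm \<Otimes>\<^sub>M borel)) (prob_algebra Mm)"
  using C by (simp add: is_strategy_def split_beta')

lemma measurable_cl_step: "cl_step Mm C M \<in> measurable loop_space (prob_algebra loop_space)"
proof -
  have "(\<lambda>t. (snd (fst t), snd t)) \<in> measurable ((Mm \<Otimes>\<^sub>M borel) \<Otimes>\<^sub>M Mm) (borel \<Otimes>\<^sub>M Mm)" by measurable
  from measurable_compose_univ_alg[OF this measurable_input_step]
  have "(\<lambda>(z, m). input_step (snd z) m)
      \<in> measurable (univ_alg ((Mm \<Otimes>\<^sub>M borel) \<Otimes>\<^sub>M Mm)) (prob_algebra loop_space)"
    by (simp add: split_beta')
  from measurable_bind_uext[OF measurable_ctrans this] show ?thesis unfolding cl_step_eq[abs_def] .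
qed

lemma cl_step_in_space_prob_algebra:
  "z \<in> space (Mm \<Otimes>\<^sub>M borel) \<Longrightarrow> cl_step Mm C M z \<in> space (prob_algebra loop_space)"
  by (rule measurable_space[OF measurable_cl_step]) simp

context
  fixes f :: "'m \<times> 'xc \<Rightarrow> ennreal"
  assumes f: "f \<in> borel_measurable loop_space"
begin

lemma nn_integral_plant_step:
  assumes m: "m \<in> space Mm"
  shows "(\<integral>\<^sup>+z. f z \<partial>plant_step x m u) = (\<integral>\<^sup>+x'. f (m, x') \<partial>uext (trans M x u))"
proof -
  have "(\<lambda>x'. return loop_space (m, x')) \<in> measurable (univ_alg borel) (prob_algebra loop_space)"
    by (rule measurable_Pair_univ_alg[OF m measurable_return_prob_space])
  then have "(\<integral>\<^sup>+z. f z \<partial>plant_step x m u)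
      = (\<integral>\<^sup>+x'. \<integral>\<^sup>+z. f z \<partial>return loop_space (m, x') \<partial>uext (trans M x u))"
    unfolding plant_step_def
    by (rule nn_integral_bind_uext[OF trans_in_space_prob_algebra[OF M] _ f])
  also have "\<dots> = (\<integral>\<^sup>+x'. f (m, x') \<partial>uext (trans M x u))"
    using m by (intro nn_integral_cong nn_integral_return f) (simp add: space_pair_measure)
  finally show ?thesis .
qed

lemma nn_integral_input_step:
  assumes m: "m \<in> space Mm"
  shows "(\<integral>\<^sup>+z. f z \<partial>input_step x m) = (\<integral>\<^sup>+u. \<integral>\<^sup>+x'. f (m, x') \<partial>uext (trans M x u) \<partial>uext (cout C m))"
proof -
  have "plant_step x m \<in> measurable (univ_alg borel) (prob_algebra loop_space)"
    using m measurable_Pair_univ_alg[OF _ measurable_plant_step, of "(x, m)"]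
    by (simp add: space_pair_measure)
  then show ?thesis
    unfolding input_step_def
    using m by (simp add: nn_integral_bind_uext[OF measurable_space[OF measurable_cout] _ f]
        nn_integral_plant_step)
qed

lemma nn_integral_cl_step:
  assumes z: "z \<in> space (Mm \<Otimes>\<^sub>M borel)"
  shows "(\<integral>\<^sup>+z'. f z' \<partial>cl_step Mm C M z) = (\<integral>\<^sup>+m'. \<integral>\<^sup>+u. \<integral>\<^sup>+x'. f (m', x')
          \<partial>uext (trans M (snd z) u) \<partial>uext (cout C m') \<partial>uext (ctrans C (fst z) (snd z)))"
proof -
  have ctrans: "ctrans C (fst z) (snd z) \<in> space (prob_algebra Mm)"
    using measurable_space[OF measurable_ctrans] z by simp
  have "input_step (snd z) \<in> measurable (univ_alg Mm) (prob_algebra loop_space)"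
    using measurable_Pair_univ_alg[OF _ measurable_input_step, of "snd z"] by simp
  then have "(\<integral>\<^sup>+z'. f z' \<partial>cl_step Mm C M z)
      = (\<integral>\<^sup>+m'. \<integral>\<^sup>+z'. f z' \<partial>input_step (snd z) m' \<partial>uext (ctrans C (fst z) (snd z)))"
    unfolding cl_step_eq by (rule nn_integral_bind_uext[OF ctrans _ f])
  also have "\<dots> = (\<integral>\<^sup>+m'. \<integral>\<^sup>+u. \<integral>\<^sup>+x'. f (m', x')
          \<partial>uext (trans M (snd z) u) \<partial>uext (cout C m') \<partial>uext (ctrans C (fst z) (snd z)))"
    using prob_algebraD(3)[OF ctrans] by (intro nn_integral_cong nn_integral_input_step) simp
  finally show ?thesis .
qed

end

lemma AE_cl_step_memory:
  assumes z: "z \<in> space (Mm \<Otimes>\<^sub>M borel)" and Q: "Measurable.pred (univ_alg Mm) Q"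
    and AE: "AE m' in uext (ctrans C (fst z) (snd z)). Q m'"
  shows "AE z' in cl_step Mm C M z. Q (fst z')"
proof -
  let ?bad = "\<lambda>m'. indicator {m' \<in> space Mm. \<not> Q m'} m' :: ennreal"
  have "{m' \<in> space Mm. \<not> Q m'} \<in> sets (univ_alg Mm)"
    using Q sets.sets_Collect_neg[of "univ_alg Mm" Q] by (simp add: pred_def)
  then have bad: "(\<lambda>z'. ?bad (fst z')) \<in> borel_measurable loop_space"
    by (intro measurable_compose_univ_alg[OF measurable_fst]) simp
  have "(\<integral>\<^sup>+z'. ?bad (fst z') \<partial>cl_step Mm C M z) = (\<integral>\<^sup>+m'. \<integral>\<^sup>+u. \<integral>\<^sup>+x'. ?bad m'
          \<partial>uext (trans M (snd z) u) \<partial>uext (cout C m') \<partial>uext (ctrans C (fst z) (snd z)))"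
    unfolding nn_integral_cl_step[OF bad z] by simp
  also have "\<dots> = (\<integral>\<^sup>+m'. 0 \<partial>uext (ctrans C (fst z) (snd z)))"
    by (rule nn_integral_cong_AE, rule AE_mp[OF AE]) (auto simp: indicator_def)
  finally have "AE z' in cl_step Mm C M z. ?bad (fst z') = 0"
    using bad nn_integral_0_iff_AE[of "\<lambda>z'. ?bad (fst z')" "cl_step Mm C M z"]
    by (simp add: measurable_prob_algebra_cong[OF cl_step_in_space_prob_algebra[OF z]])
  then show ?thesis
    using AE_space
  proof eventually_elim
    case (elim z')
    then show ?case
      by (auto simp: prob_algebraD(3)[OF cl_step_in_space_prob_algebra[OF z]]
          space_pair_measure indicator_def
          split: if_splits)
  qed
qed

context
  assumes cinit: "cinit C \<in> space Mm"
begin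

lemma markov_chain_cl_step: "markov_chain loop_space (cl_step Mm C M) (cinit C, init M)"
  using cinit by (intro markov_chain.intro measurable_cl_step) (simp add: space_pair_measure)

interpretation loop: markov_chain loop_space "cl_step Mm C M" "(cinit C, init M)"
  by (rule markov_chain_cl_step)

lemma cl_path_measure_eq: "cl_path_measure Mm C M = loop.paths"
proof -
  have "cl_kernels Mm C M = loop.transition"
    by (intro ext) (simp add: cl_kernels_def loop.transition_def)
  then show ?thesis by (simp add: cl_path_measure_def)
qed

lemma measurable_path_state: "(\<lambda>\<omega>. snd (\<omega> i)) \<in> borel_measurable loop.paths"
proof -
  have "(\<lambda>\<omega>. \<omega> i) \<in> measurable loop.paths loop_space"
    by (subst measurable_cong_sets[OF loop.IT.PF.sets_lim refl])
       (rule measurable_component_singleton, simp)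
  from measurable_compose[OF this measurable_univ_algI1[OF measurable_snd]] show ?thesis .
qed

lemma sets_accepted_paths:
  fixes L :: "'y \<Rightarrow> 'ap::finite set" and \<tau> :: "'q::finite \<Rightarrow> 'ap set \<Rightarrow> 'q"
  assumes "L \<in> measurable borel (count_space UNIV)"
  shows "{\<omega> \<in> space loop.paths. dfa_accepts q0 F \<tau> (\<lambda>i. L (out M (snd (\<omega> i))))} \<in> sets loop.paths"
  by (intro sets_dfa_accepts measurable_label[OF M assms] measurable_path_state)

lemma sat_prob_eq:
  fixes L :: "'y \<Rightarrow> 'ap::finite set" and \<tau> :: "'q::finite \<Rightarrow> 'ap set \<Rightarrow> 'q"
  assumes L: "L \<in> measurable borel (count_space UNIV)"
    and accepts: "\<And>w. dfa_accepts q0 F \<tau> w \<longleftrightarrow> scsat w 0 \<psi>"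
  shows "sat_prob Mm C M L \<psi> = measure loop.paths
    {\<omega> \<in> space loop.paths. dfa_accepts q0 F \<tau> (\<lambda>i. L (out M (snd (\<omega> i))))}"
proof -
  let ?traces = "PiM UNIV (\<lambda>_::nat. borel) :: (nat \<Rightarrow> 'y) measure"
  let ?output = "\<lambda>\<omega> i. out M (snd (\<omega> i))"
  have "out M \<in> measurable borel borel" using M by (simp add: is_gmdp_def)
  from measurable_compose[OF measurable_path_state this]
  have measurable_output: "?output \<in> measurable loop.paths ?traces"
    by (intro measurable_PiM_single') simp_all
  have "(\<lambda>ys. L (ys i)) \<in> measurable ?traces (count_space UNIV)" for i
    by (rule measurable_compose[OF _ L], rule measurable_component_singleton) simp
  from sets_dfa_accepts[of "\<lambda>ys i. L (ys i)", OF this]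
  have "{ys \<in> space ?traces. scsat (\<lambda>i. L (ys i)) 0 \<psi>} \<in> sets ?traces" by (simp flip: accepts)
  from measure_distr[OF measurable_output this] show ?thesis
    unfolding sat_prob_def cl_trace_measure_def cl_path_measure_eq
    using measurable_space[OF measurable_output]
    by (simp add: accepts vimage_def Int_def conj_commute cong: conj_cong)
qed

end

end

section \<open>Measurable interfaces\<close>

theorem measurable_mixture_selection:
  fixes t :: "'z::polish_space \<Rightarrow> 'u::polish_space \<Rightarrow> 'v::second_countable_topology measure"
  assumes t: "(\<lambda>(z, u). t z u) \<in> measurable (borel \<Otimes>\<^sub>M borel) (prob_algebra borel)"
    and \<rho>: "\<rho> \<in> measurable borel (prob_algebra borel)"
  obtains \<sigma> where "\<sigma> \<in> measurable (univ_alg borel) (prob_algebra borel)"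
    "\<And>z \<nu>. \<nu> \<in> space (prob_algebra borel) \<Longrightarrow> \<nu> \<bind> t z = \<rho> z \<Longrightarrow> \<sigma> z \<bind> t z = \<rho> z"
proof -
  obtain decode :: "(rat \<Rightarrow> real) \<Rightarrow> 'u measure"
    where decode: "decode \<in> measurable borel (prob_algebra borel)"
    and onto: "\<And>\<nu>. \<nu> \<in> space (prob_algebra borel) \<Longrightarrow> \<exists>e. decode e = \<nu>"
    using polish_prob_measure_coding by blast
  let ?code_space = "borel \<Otimes>\<^sub>M borel :: ('z \<times> (rat \<Rightarrow> real)) measure"
  define G where "G = {y \<in> space ?code_space. decode (snd y) \<bind> t (fst y) = \<rho> (fst y)}"
  have "(\<lambda>x. (fst (fst x), snd x))
      \<in> measurable (?code_space \<Otimes>\<^sub>M (borel :: 'u measure)) (borel \<Otimes>\<^sub>M borel)"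
    by measurable
  from measurable_compose[OF this t]
  have "(\<lambda>(y, u). t (fst y) u) \<in> measurable (?code_space \<Otimes>\<^sub>M borel) (prob_algebra borel)"
    by (simp add: split_beta')
  from measurable_bind_prob_space2[OF measurable_compose[OF measurable_snd decode] this]
  have "(\<lambda>y. decode (snd y) \<bind> t (fst y)) \<in> measurable ?code_space (prob_algebra borel)" .
  then have "G \<in> sets ?code_space"
    unfolding G_def by (rule measurable_kernel_eq[OF _ measurable_compose[OF measurable_fst \<rho>]])
  then have "G \<in> sets borel" by (simp only: borel_prod)
  then obtain s where s: "s \<in> measurable (univ_alg borel) borel"
    and select: "\<And>z e. (z, e) \<in> G \<Longrightarrow> (z, s z) \<in> G"
    using Jankov_von_Neumann by blast
  show thesis
  proof (rule that[of "\<lambda>z. decode (s z)"])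
    show "(\<lambda>z. decode (s z)) \<in> measurable (univ_alg borel) (prob_algebra borel)"
      by (rule measurable_compose[OF s decode])
    fix z \<nu> assume "\<nu> \<in> space (prob_algebra borel)" and solution: "\<nu> \<bind> t z = \<rho> z"
    then obtain e where "decode e = \<nu>" using onto by blast
    then have "(z, e) \<in> G" using solution by (simp add: G_def space_pair_measure)
    from select[OF this] show "decode (s z) \<bind> t z = \<rho> z" by (simp add: G_def)
  qed
qed

section \<open>Exact simulation\<close>

lemma distr_eqI:
  assumes "f \<in> measurable P M" "sets Q = sets M"
    and "\<And>A. A \<in> sets M \<Longrightarrow> emeasure P (f -` A \<inter> space P) = emeasure Q A"
  shows "distr P M f = Q"
  using assms by (intro measure_eqI) (simp_all add: emeasure_distr)

lemma nn_integral_uext_distr_fst_le: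
  assumes P: "P \<in> space (prob_algebra (M \<Otimes>\<^sub>M N))"
    and R: "R \<in> sets (M \<Otimes>\<^sub>M N)" "emeasure P (space P - R) \<le> \<epsilon>"
    and f: "f \<in> borel_measurable (univ_alg M)" "\<And>x. f x \<le> 1"
    and g: "g \<in> borel_measurable (univ_alg (M \<Otimes>\<^sub>M N))" "\<And>x y. (x, y) \<in> R \<Longrightarrow> f x \<le> g (x, y)"
  shows "(\<integral>\<^sup>+x. f x \<partial>uext (distr P M fst)) \<le> (\<integral>\<^sup>+w. g w \<partial>uext P) + \<epsilon>"
proof -
  have compl: "space P - R \<in> sets P" using R(1) prob_algebraD(2)[OF P] by auto
  have "(\<integral>\<^sup>+x. f x \<partial>uext (distr P M fst)) = (\<integral>\<^sup>+w. f (fst w) \<partial>uext P)"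
    by (rule nn_integral_uext_distr[OF P measurable_fst f(1)])
  also have "\<dots> \<le> (\<integral>\<^sup>+w. g w + indicator (space P - R) w \<partial>uext P)"
  proof (rule nn_integral_mono)
    fix w assume "w \<in> space (uext P)"
    then show "f (fst w) \<le> g w + indicator (space P - R) w"
      using g(2)[of "fst w" "snd w"] f(2)[of "fst w"]
      by (cases "w \<in> R") (auto simp: add_increasing)
  qed
  also have "\<dots> = (\<integral>\<^sup>+w. g w \<partial>uext P) + emeasure (uext P) (space P - R)"
  proof -
    have "g \<in> borel_measurable (uext P)" using g(1) by (simp add: measurable_uext_cong[OF P])
    moreover have "space P - R \<in> sets (uext P)"
      using compl by (simp add: sets_uext sets_imp_univ_sets)
    ultimately show ?thesis by (simp add: nn_integral_add)
  qed
  also have "emeasure (uext P) (space P - R) \<le> \<epsilon>"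
    using R(2) emeasure_uext_sets[OF prob_algebraD(1)[OF P] compl] by simp
  finally show ?thesis by (simp add: add_left_mono)
qed

locale exact_simulation = abstract_model Mh L F \<tau> \<mu> \<delta>
  for Mh :: "('x::polish_space, 'u::polish_space, 'y::metric_space) gmdp"
    and L :: "'y \<Rightarrow> 'ap::finite set" and F :: "'q::finite set" and \<tau> :: "'q \<Rightarrow> 'ap set \<Rightarrow> 'q"
    and \<mu> :: "'x \<times> 'q \<Rightarrow> 'u measure" and \<delta> :: real +
  fixes q0 :: 'q and M :: "('xc::polish_space, 'uc::polish_space, 'y) gmdp"
    and Uv :: "'u \<Rightarrow> 'x \<Rightarrow> 'xc \<Rightarrow> 'uc measure" and R :: "('x \<times> 'xc) set"
    and W :: "'u \<Rightarrow> 'x \<Rightarrow> 'xc \<Rightarrow> ('x \<times> 'xc) measure"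
  assumes M: "is_gmdp M" and Uv: "Uv u x xc \<in> space (prob_algebra borel)" and R: "R \<in> sets borel"
    and W: "(\<lambda>(u, x, xc). W u x xc) \<in> measurable borel (prob_algebra borel)"
    and init_related: "(init Mh, init M) \<in> R"
    and out_eq: "(x, xc) \<in> R \<Longrightarrow> out Mh x = out M xc"
    and distr_W_fst: "(x, xc) \<in> R \<Longrightarrow> distr (W u x xc) borel fst = trans Mh x u"
    and distr_W_snd: "(x, xc) \<in> R \<Longrightarrow> distr (W u x xc) borel snd = Uv u x xc \<bind> trans M xc"
    and W_R: "(x, xc) \<in> R \<Longrightarrow> 1 - \<delta> \<le> measure (W u x xc) R"

lemma (in abstract_model) approx_sim_exact_simulation:
  fixes M :: "('xc::polish_space, 'uc::polish_space, 'y) gmdp"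
  assumes sim: "approx_sim \<delta> 0 Mh M" and M: "is_gmdp M"
  obtains Uv :: "'u \<Rightarrow> 'x \<Rightarrow> 'xc \<Rightarrow> 'uc measure" and R W
  where "exact_simulation Mh L \<mu> \<delta> M Uv R W"
proof -
  obtain Uv :: "'u \<Rightarrow> 'x \<Rightarrow> 'xc \<Rightarrow> 'uc measure" and R :: "('x \<times> 'xc) set"
    and W :: "'u \<Rightarrow> 'x \<Rightarrow> 'xc \<Rightarrow> ('x \<times> 'xc) measure"
    where Uv: "\<And>u x xc. Uv u x xc \<in> space (prob_algebra borel)" and R: "R \<in> sets borel"
    and W: "(\<lambda>(u, x, xc). W u x xc) \<in> measurable borel (prob_algebra borel)"
    and init: "(init Mh, init M) \<in> R"
    and related: "\<forall>(x, xc) \<in> R. dist (out Mh x) (out M xc) \<le> 0 \<and>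
       (\<forall>u. (\<forall>A \<in> sets borel. emeasure (W u x xc) (A \<times> UNIV) = emeasure (trans Mh x u) A) \<and>
            (\<forall>A \<in> sets borel. emeasure (W u x xc) (UNIV \<times> A)
                               = emeasure (kmix (trans M) xc (Uv u x xc)) A) \<and>
            measure (W u x xc) R \<ge> 1 - \<delta>)"
    using sim unfolding approx_sim_def by blast
  have W_space: "W u x xc \<in> space (prob_algebra (borel \<Otimes>\<^sub>M borel))" for u x xc
    using measurable_space[OF W, of "(u, x, xc)"] by (simp add: borel_prod)
  have cylinders: "fst -` A \<inter> space (W u x xc) = A \<times> UNIV" "snd -` B \<inter> space (W u x xc) = UNIV \<times> B"
    for u x xc A B by (auto simp: prob_algebraD(3)[OF W_space] space_pair_measure)
  show thesis
  proof (rule that, unfold_locales)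
    fix u x xc assume r: "(x, xc) \<in> R"
    show "out Mh x = out M xc" using related r by fastforce
    show "distr (W u x xc) borel fst = trans Mh x u"
      using related r prob_algebraD(2)[OF trans_in_space_prob_algebra[OF Mh]]
      by (intro distr_eqI) (auto simp: cylinders measurable_prob_algebra_cong[OF W_space])
    show "distr (W u x xc) borel snd = Uv u x xc \<bind> trans M xc"
      using related r sets_bind'[OF Uv measurable_trans_input[OF M]]
      by (intro distr_eqI) (auto simp: cylinders kmix_def measurable_prob_algebra_cong[OF W_space])
    show "1 - \<delta> \<le> measure (W u x xc) R" using related r by blast
  qed (fact M Uv R W init)+
qed

context exact_simulation
begin

abbreviation "memory_space \<equiv>
  (borel :: 'x measure) \<Otimes>\<^sub>M ((count_space UNIV :: 'q measure) \<Otimes>\<^sub>M (borel :: 'xc measure))"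

abbreviation (input) mode :: "'x \<times> 'q \<times> 'xc \<Rightarrow> 'q" where "mode m \<equiv> fst (snd m)"

lemma space_memory_space: "space memory_space = UNIV"
  by (simp add: space_pair_measure)

lemma measurable_W:
  "(\<lambda>(u, x, xc). W u x xc) \<in> measurable (borel \<Otimes>\<^sub>M (borel \<Otimes>\<^sub>M borel)) (prob_algebra (borel \<Otimes>\<^sub>M borel))"
  using W by (simp only: borel_prod)

lemma measurable_W_input: "(\<lambda>u. W u x xc) \<in> measurable borel (prob_algebra (borel \<Otimes>\<^sub>M borel))"
  using measurable_compose[OF _ measurable_W, of "\<lambda>u. (u, x, xc)"] by simp

lemma W_in_space_prob_algebra: "W u x xc \<in> space (prob_algebra (borel \<Otimes>\<^sub>M borel))"
  by (rule measurable_space[OF measurable_W_input]) simp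

subsection \<open>The interface\<close>

lemma ex_interface:
  "\<exists>\<sigma>. \<sigma> \<in> measurable (univ_alg borel) (prob_algebra borel) \<and>
    (\<forall>u x xc. (x, xc) \<in> R \<longrightarrow> \<sigma> (u, x, xc) \<bind> trans M xc = distr (W u x xc) borel snd)"
proof -
  let ?t = "\<lambda>z :: 'u \<times> 'x \<times> 'xc. trans M (snd (snd z))"
  let ?\<rho> = "\<lambda>(u, x, xc). distr (W u x xc) borel snd"
  have "(\<lambda>(z, u). ?t z u) \<in> measurable (borel \<Otimes>\<^sub>M borel) (prob_algebra borel)"
    unfolding split_beta' borel_prod[symmetric] by (intro measurable_trans[OF M]) measurable
  moreover have "?\<rho> \<in> measurable borel (prob_algebra borel)"
    using measurable_compose[OF measurable_W measurable_distr_prob_space[OF measurable_snd]]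
    by (simp add: split_beta' borel_prod)
  ultimately obtain \<sigma> where \<sigma>: "\<sigma> \<in> measurable (univ_alg borel) (prob_algebra borel)"
    and select: "\<And>z \<nu>. \<nu> \<in> space (prob_algebra borel) \<Longrightarrow> \<nu> \<bind> ?t z = ?\<rho> z \<Longrightarrow> \<sigma> z \<bind> ?t z = ?\<rho> z"
    by (rule measurable_mixture_selection) blast
  have "\<sigma> (u, x, xc) \<bind> trans M xc = distr (W u x xc) borel snd" if "(x, xc) \<in> R" for u x xc
    using select[OF Uv, of u x xc "(u, x, xc)"] distr_W_snd[OF that, of u] by simp
  with \<sigma> show ?thesis by blast
qed

definition interface :: "'u \<times> 'x \<times> 'xc \<Rightarrow> 'uc measure" where
  "interface = (SOME \<sigma>. \<sigma> \<in> measurable (univ_alg borel) (prob_algebra borel) \<and>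
    (\<forall>u x xc. (x, xc) \<in> R \<longrightarrow> \<sigma> (u, x, xc) \<bind> trans M xc = distr (W u x xc) borel snd))"

lemma measurable_interface:
  "interface \<in> measurable (univ_alg (borel \<Otimes>\<^sub>M (borel \<Otimes>\<^sub>M borel))) (prob_algebra borel)"
  unfolding interface_def borel_prod using someI_ex[OF ex_interface] by blast

lemma interface_bind_trans:
  "(x, xc) \<in> R \<Longrightarrow> interface (u, x, xc) \<bind> trans M xc = distr (W u x xc) borel snd"
  unfolding interface_def using someI_ex[OF ex_interface] by blast

subsection \<open>The coupling\<close>

definition coupling :: "'x \<times> 'q \<times> 'xc \<Rightarrow> ('x \<times> 'xc) measure" where
  "coupling = (\<lambda>(x, q, xc). \<mu> (x, q) \<bind> (\<lambda>u. W u x xc))"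

lemma measurable_policy_memory:
  "(\<lambda>m. \<mu> (fst m, mode m)) \<in> measurable (univ_alg memory_space) (prob_algebra borel)"
  by (rule measurable_compose_univ_alg[OF _ measurable_policy]) measurable

lemma measurable_coupling:
  "coupling \<in> measurable (univ_alg memory_space) (prob_algebra (borel \<Otimes>\<^sub>M borel))"
proof -
  have "(\<lambda>m. (fst m, snd (snd m))) \<in> measurable (univ_alg memory_space) (borel \<Otimes>\<^sub>M borel)"
    by (rule measurable_univ_algI1) measurable
  then have "(\<lambda>z. (snd z, fst (fst z), snd (snd (fst z))))
      \<in> measurable (univ_alg memory_space \<Otimes>\<^sub>M borel) (borel \<Otimes>\<^sub>M (borel \<Otimes>\<^sub>M borel))"
    by (intro measurable_Pair measurable_snd measurable_compose[OF measurable_fst])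
       (simp_all add: measurable_pair_iff comp_def)
  from measurable_compose[OF this measurable_W]
  have "(\<lambda>(m, u). W u (fst m) (snd (snd m)))
      \<in> measurable (univ_alg memory_space \<Otimes>\<^sub>M borel) (prob_algebra (borel \<Otimes>\<^sub>M borel))"
    by (simp add: split_beta')
  from measurable_bind_prob_space2[OF measurable_policy_memory this]
  show ?thesis by (simp add: coupling_def split_beta')
qed

lemma coupling_in_space_prob_algebra: "coupling m \<in> space (prob_algebra (borel \<Otimes>\<^sub>M borel))"
  by (rule measurable_space[OF measurable_coupling]) (simp add: space_memory_space)

lemma distr_coupling:
  assumes "f \<in> measurable (borel \<Otimes>\<^sub>M borel) N"
  shows "distr (coupling (x, q, xc)) N f = \<mu> (x, q) \<bind> (\<lambda>u. distr (W u x xc) N f)"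
  unfolding coupling_def prod.case
  by (rule distr_bind_prob_algebra[OF policy_in_space_prob_algebra measurable_W_input assms])

lemma distr_coupling_fst:
  "(x, xc) \<in> R \<Longrightarrow> distr (coupling (x, q, xc)) borel fst = \<mu> (x, q) \<bind> trans Mh x"
  by (simp add: distr_coupling distr_W_fst)

lemma R_sets_pair: "R \<in> sets (borel \<Otimes>\<^sub>M borel)"
  using R by (simp only: borel_prod)

lemma emeasure_coupling_compl_R:
  assumes r: "(x, xc) \<in> R"
  shows "emeasure (coupling (x, q, xc)) (space (coupling (x, q, xc)) - R) \<le> ennreal \<delta>"
proof -
  interpret prob_space "\<mu> (x, q)" by (rule prob_algebraD(1)[OF policy_in_space_prob_algebra])
  have W_compl_R: "emeasure (W u x xc) (UNIV - R) \<le> ennreal \<delta>" for u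
  proof -
    interpret W: prob_space "W u x xc" by (rule prob_algebraD(1)[OF W_in_space_prob_algebra])
    have "measure (W u x xc) (UNIV - R) = 1 - measure (W u x xc) R"
      using W.prob_compl[of R] R_sets_pair prob_algebraD(2,3)[OF W_in_space_prob_algebra, of u x xc]
      by (simp add: space_pair_measure)
    then show ?thesis using W_R[OF r, of u] by (simp add: W.emeasure_eq_measure ennreal_leI)
  qed
  have "UNIV - R \<in> sets (borel \<Otimes>\<^sub>M borel)"
    using sets.compl_sets[OF R_sets_pair] by (simp add: space_pair_measure)
  then have "emeasure (coupling (x, q, xc)) (UNIV - R)
      = (\<integral>\<^sup>+u. emeasure (W u x xc) (UNIV - R) \<partial>\<mu> (x, q))"
    unfolding coupling_def prod.case
    by (rule emeasure_bind_prob_algebra[OF policy_in_space_prob_algebra measurable_W_input])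
  also have "\<dots> \<le> (\<integral>\<^sup>+u. ennreal \<delta> \<partial>\<mu> (x, q))" by (intro nn_integral_mono W_compl_R)
  finally show ?thesis
    using emeasure_space_1 prob_algebraD(3)[OF coupling_in_space_prob_algebra]
    by (simp add: space_pair_measure)
qed

lemma ex_conditional:
  "\<exists>K. (\<lambda>(m, y). K m y) \<in> measurable (univ_alg memory_space \<Otimes>\<^sub>M borel) (prob_algebra borel) \<and>
    (\<forall>m. coupling m = joint_law borel borel (distr (coupling m) borel snd) (K m))"
proof -
  obtain U :: "nat \<Rightarrow> 'xc set" where "sets borel = sigma_sets UNIV (range U)"
    by (rule countable_Int_stable_generator)
  then have "sets (borel :: 'xc measure) = sigma_sets (space borel) (range U)" by simp
  from kernel_disintegration[OF measurable_coupling this]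
  show ?thesis by (metis space_univ_alg space_memory_space UNIV_I)
qed

definition conditional :: "'x \<times> 'q \<times> 'xc \<Rightarrow> 'xc \<Rightarrow> 'x measure" where
  "conditional = (SOME K. (\<lambda>(m, y). K m y)
      \<in> measurable (univ_alg memory_space \<Otimes>\<^sub>M borel) (prob_algebra borel) \<and>
    (\<forall>m. coupling m = joint_law borel borel (distr (coupling m) borel snd) (K m)))"

lemma measurable_conditional:
  "(\<lambda>z. conditional (fst z) (snd z))
      \<in> measurable (univ_alg memory_space \<Otimes>\<^sub>M borel) (prob_algebra borel)"
  unfolding conditional_def using someI_ex[OF ex_conditional] by (simp add: split_beta')

lemma coupling_eq_joint_law:
  "coupling m = joint_law borel borel (distr (coupling m) borel snd) (conditional m)"
  unfolding conditional_def using someI_ex[OF ex_conditional] by blast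

lemma nn_integral_uext_coupling:
  assumes "g \<in> borel_measurable (univ_alg (borel \<Otimes>\<^sub>M borel))"
  shows "(\<integral>\<^sup>+w. g w \<partial>uext (coupling m))
    = (\<integral>\<^sup>+y. \<integral>\<^sup>+x. g (x, y) \<partial>uext (conditional m y) \<partial>uext (distr (coupling m) borel snd))"
proof -
  have "conditional m \<in> measurable borel (prob_algebra borel)"
    using measurable_compose[OF measurable_Pair1' measurable_conditional, of m]
    by (simp add: space_memory_space)
  with assms show ?thesis
    by (subst coupling_eq_joint_law)
       (intro nn_integral_uext_joint_law measurable_snd
          distr_in_space_prob_algebra[OF coupling_in_space_prob_algebra])
qed

subsection \<open>The strategy\<close>

definition next_mode :: "'q \<Rightarrow> 'xc \<Rightarrow> 'q" where
  "next_mode q xc = \<tau> (if q \<in> F then q0 else q) (L (out M xc))"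

lemma measurable_next_mode:
  assumes f: "f \<in> measurable N (count_space UNIV)" and g: "g \<in> borel_measurable N"
  shows "(\<lambda>z. next_mode (f z) (g z)) \<in> measurable N (count_space UNIV)"
proof -
  have "(\<lambda>z. if f z \<in> F then q0 else f z) \<in> measurable N (count_space UNIV)"
    by (rule measurable_compose[OF f]) simp
  from measurable_count_space_apply2[OF this measurable_label[OF M L g]]
  show ?thesis unfolding next_mode_def .
qed

text \<open>After acceptance the memory is irrelevant, so memory states with accepting mode are free to
  serve as initial memory: from there the abstract state is reset to its initial value. If
  \<open>F\<close> is empty the initial mode is arbitrary, but then the bound to be proved is trivial.\<close>

definition resample :: "'x \<times> 'q \<times> 'xc \<Rightarrow> 'xc \<Rightarrow> 'x measure" where
  "resample m xc = (if mode m \<in> F then return borel (init Mh) else conditional m xc)"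

definition controller :: "('x \<times> 'q \<times> 'xc, 'xc, 'uc) strategy" where
  "controller = \<lparr>cinit = (init Mh, SOME q. q \<in> F, init M),
    ctrans = \<lambda>m xc. distr (resample m xc) memory_space (\<lambda>x. (x, next_mode (mode m) xc, xc)),
    cout = \<lambda>m. uext (\<mu> (fst m, mode m)) \<bind> (\<lambda>u. interface (u, fst m, snd (snd m)))\<rparr>"

lemma measurable_mode: "mode \<in> measurable (univ_alg memory_space) (count_space UNIV)"
  by (rule measurable_univ_algI1) measurable

lemma measurable_resample:
  "(\<lambda>z. resample (fst z) (snd z))
      \<in> measurable (univ_alg memory_space \<Otimes>\<^sub>M borel) (prob_algebra borel)"
proof -
  have "{z \<in> space (univ_alg memory_space \<Otimes>\<^sub>M (borel :: 'xc measure)). mode (fst z) \<in> F}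
      \<in> sets (univ_alg memory_space \<Otimes>\<^sub>M borel)"
    using measurable_compose[OF measurable_fst measurable_mode] by measurable
  then show ?thesis
    unfolding resample_def
    by (intro measurable_If measurable_conditional measurable_const
        return_in_space_prob_algebra) simp_all
qed

lemma resample_in_space_prob_algebra: "resample m xc \<in> space (prob_algebra borel)"
  using measurable_space[OF measurable_resample, of "(m, xc)"] by (simp add: space_pair_measure)

lemma measurable_ctrans_controller:
  "(\<lambda>(m, x). ctrans controller m x)
      \<in> measurable (loop_space memory_space) (prob_algebra memory_space)"
proof -
  have "(\<lambda>(z, x). (x, next_mode (mode (fst z)) (snd z), snd z))
      \<in> measurable ((univ_alg memory_space \<Otimes>\<^sub>M borel) \<Otimes>\<^sub>M borel) memory_space"
    unfolding split_beta'
    by (intro measurable_Pair measurable_next_mode measurable_snd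
        measurable_compose[OF measurable_fst] measurable_compose[OF _ measurable_mode]
        measurable_fst)
  from measurable_distr_prob_space2[OF measurable_resample this]
  have "(\<lambda>z. distr (resample (fst z) (snd z)) memory_space
      (\<lambda>x. (x, next_mode (mode (fst z)) (snd z), snd z)))
      \<in> measurable (univ_alg memory_space \<Otimes>\<^sub>M borel) (prob_algebra memory_space)" .
  from measurable_compose[OF measurable_univ_alg_pair this]
  show ?thesis by (simp add: controller_def split_beta')
qed

lemma measurable_cout_controller:
  "cout controller \<in> measurable (univ_alg memory_space) (prob_algebra borel)"
proof -
  have "(\<lambda>z. (snd z, fst (fst z), snd (snd (fst z))))
      \<in> measurable (memory_space \<Otimes>\<^sub>M borel) (borel \<Otimes>\<^sub>M (borel \<Otimes>\<^sub>M borel))"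
    by measurable
  from measurable_compose_univ_alg[OF this measurable_interface]
  have "(\<lambda>(m, u). interface (u, fst m, snd (snd m)))
      \<in> measurable (univ_alg (memory_space \<Otimes>\<^sub>M borel)) (prob_algebra borel)"
    by (simp add: split_beta')
  from measurable_bind_uext[OF measurable_policy_memory this] show ?thesis
    by (simp add: controller_def)
qed

lemma is_strategy_controller: "is_strategy memory_space controller"
  using measurable_ctrans_controller measurable_cout_controller by (simp add: is_strategy_def)

lemma ctrans_controller:
  "ctrans controller m xc = distr (resample m xc) memory_space (\<lambda>x. (x, next_mode (mode m) xc, xc))"
  by (simp add: controller_def)

lemma nn_integral_uext_ctrans_controller:
  "f \<in> borel_measurable (univ_alg memory_space) \<Longrightarrow>
    (\<integral>\<^sup>+m'. f m' \<partial>uext (ctrans controller m xc))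
      = (\<integral>\<^sup>+x. f (x, next_mode (mode m) xc, xc) \<partial>uext (resample m xc))"
  unfolding ctrans_controller
  by (rule nn_integral_uext_distr[OF resample_in_space_prob_algebra]) simp_all

lemma AE_uext_ctrans_controller:
  "AE m' in uext (ctrans controller m xc). snd m' = (next_mode (mode m) xc, xc)"
proof -
  have update: "(\<lambda>x. (x, next_mode (mode m) xc, xc)) \<in> measurable borel memory_space" by simp
  have "UNIV \<times> {next_mode (mode m) xc} \<times> {xc} \<in> sets memory_space" by (intro pair_measureI) simp_all
  also have "UNIV \<times> {next_mode (mode m) xc} \<times> {xc}
      = {m' \<in> space (univ_alg memory_space). snd m' = (next_mode (mode m) xc, xc)}"
    by (auto simp: space_memory_space)
  finally have "{m' \<in> space (univ_alg memory_space). snd m' = (next_mode (mode m) xc, xc)}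
      \<in> sets (univ_alg memory_space)"
    by (simp add: sets_univ_alg sets_imp_univ_sets)
  then show ?thesis
    unfolding ctrans_controller uext_distr[OF resample_in_space_prob_algebra update]
    using measurable_univ_alg_univ_alg[OF update]
    by (subst AE_distr_iff) (simp_all add: measurable_uext_cong[OF resample_in_space_prob_algebra])
qed

lemma cout_controller_bind_trans:
  assumes r: "(x, xc) \<in> R"
  shows "cout controller (x, q, xc) \<bind> trans M xc = distr (coupling (x, q, xc)) borel snd"
proof -
  have "(\<lambda>u. interface (u, x, xc)) \<in> measurable (univ_alg borel) (prob_algebra borel)"
    by (rule measurable_compose_univ_alg[OF _ measurable_interface]) simp
  then have "(\<lambda>u. interface (u, x, xc)) \<in> measurable (uext (\<mu> (x, q))) (subprob_algebra borel)"
    by (simp add: measurable_uext_cong[OF policy_in_space_prob_algebra] measurable_prob_algebraD)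
  from bind_assoc[OF this measurable_prob_algebraD[OF measurable_trans_input[OF M]]]
  have "cout controller (x, q, xc) \<bind> trans M xc
      = uext (\<mu> (x, q)) \<bind> (\<lambda>u. interface (u, x, xc) \<bind> trans M xc)"
    by (simp add: controller_def)
  also have "\<dots> = uext (\<mu> (x, q)) \<bind> (\<lambda>u. distr (W u x xc) borel snd)"
    by (simp add: interface_bind_trans[OF r])
  also have "\<dots> = \<mu> (x, q) \<bind> (\<lambda>u. distr (W u x xc) borel snd)"
    by (rule uext_bind_borel_kernel[OF policy_in_space_prob_algebra
          measurable_compose[OF measurable_W_input measurable_distr_prob_space[OF measurable_snd]]])
  also have "\<dots> = distr (coupling (x, q, xc)) borel snd"
    by (rule distr_coupling[OF measurable_snd, symmetric])
  finally show ?thesis .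
qed

subsection \<open>The coupled value function\<close>

definition coupled_payoff :: "nat \<Rightarrow> 'x \<times> 'q \<times> 'xc \<Rightarrow> ennreal" where
  "coupled_payoff l
      = (\<lambda>(x, q, xc). indicator R (x, xc) * ennreal (payoff (value_iterate l) (x, q)))"

lemma payoff_value_iterate_le_1: "ennreal (payoff (value_iterate l) s) \<le> 1"
  using payoff_bounds(2)[OF admissible_value_iterate] by simp

lemma measurable_ennreal_payoff:
  "(\<lambda>s. ennreal (payoff (value_iterate l) s)) \<in> borel_measurable (univ_alg XQ)"
  by (rule measurable_compose[OF measurable_payoff[OF admissible_value_iterate] measurable_ennreal])

lemma coupled_payoff_le_1: "coupled_payoff l m \<le> 1"
  using payoff_value_iterate_le_1 by (cases m) (simp add: coupled_payoff_def indicator_def)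

lemma measurable_coupled_payoff: "coupled_payoff l \<in> borel_measurable (univ_alg memory_space)"
proof -
  have "(\<lambda>m. (fst m, snd (snd m))) \<in> measurable memory_space (borel \<Otimes>\<^sub>M borel)" by measurable
  from measurable_compose[OF measurable_univ_algI1[OF this]
      borel_measurable_indicator[OF R_sets_pair]]
  have "(\<lambda>m. indicator R (fst m, snd (snd m)) :: ennreal)
      \<in> borel_measurable (univ_alg memory_space)" .
  moreover have "(\<lambda>m. ennreal (payoff (value_iterate l) (fst m, mode m)))
      \<in> borel_measurable (univ_alg memory_space)"
    by (rule measurable_compose_univ_alg[OF _ measurable_ennreal_payoff]) measurable
  ultimately show ?thesis by (simp add: coupled_payoff_def split_beta')
qed

definition expected_payoff :: "nat \<Rightarrow> ('x \<times> 'q \<times> 'xc) \<times> 'xc \<Rightarrow> ennreal" where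
  "expected_payoff l z = (\<integral>\<^sup>+m'. coupled_payoff l m' \<partial>uext (ctrans controller (fst z) (snd z)))"

lemma measurable_expected_payoff: "expected_payoff l \<in> borel_measurable (loop_space memory_space)"
proof -
  have "(\<lambda>z. ctrans controller (fst z) (snd z))
      \<in> measurable (loop_space memory_space) (prob_algebra memory_space)"
    using measurable_ctrans_controller by (simp add: split_beta')
  from measurable_compose[OF measurable_prob_algebraD[OF measurable_uext_univ_kernel[OF this]]
      nn_integral_measurable_subprob_algebra[OF measurable_coupled_payoff]]
  show ?thesis by (simp add: expected_payoff_def[abs_def])
qed

lemma expected_payoff_eq:
  "expected_payoff l (m, xc)
      = (\<integral>\<^sup>+x. coupled_payoff l (x, next_mode (mode m) xc, xc) \<partial>uext (resample m xc))"
  by (simp add: expected_payoff_def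
      nn_integral_uext_ctrans_controller[OF measurable_coupled_payoff])

lemma expected_payoff_le_1: "expected_payoff l z \<le> 1"
  by (cases z) (simp add: expected_payoff_eq coupled_payoff_le_1
    nn_integral_prob_le_1[OF prob_space_uext[OF
        prob_algebraD(1)[OF resample_in_space_prob_algebra]]])

lemma cout_controller_in_space_prob_algebra: "cout controller m \<in> space (prob_algebra borel)"
  by (rule measurable_space[OF measurable_cout_controller]) (simp add: space_memory_space)

context
  fixes l :: nat and q :: 'q
  assumes q: "q \<notin> F"
begin

abbreviation (input) next_payoff :: "'x \<times> 'xc \<Rightarrow> ennreal" where
  "next_payoff w \<equiv> coupled_payoff l (fst w, next_mode q (snd w), snd w)"

lemma measurable_next_payoff: "next_payoff \<in> borel_measurable (univ_alg (borel \<Otimes>\<^sub>M borel))"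
  by (intro measurable_compose_univ_alg[OF _ measurable_coupled_payoff] measurable_Pair
      measurable_next_mode measurable_const measurable_fst measurable_snd) simp

lemma nn_integral_expected_payoff:
  assumes r: "(x, xc) \<in> R"
  shows "(\<integral>\<^sup>+u. \<integral>\<^sup>+xc'. expected_payoff l ((x, q, xc), xc') \<partial>uext (trans M xc u)
      \<partial>uext (cout controller (x, q, xc)))
    = (\<integral>\<^sup>+w. next_payoff w \<partial>uext (coupling (x, q, xc)))"
proof -
  let ?m = "(x, q, xc)"
  have "(\<lambda>xc'. expected_payoff l (?m, xc')) \<in> borel_measurable (univ_alg borel)"
    by (rule measurable_Pair_univ_alg[OF _ measurable_expected_payoff])
       (simp add: space_memory_space)
  then have "(\<integral>\<^sup>+u. \<integral>\<^sup>+xc'. expected_payoff l (?m, xc') \<partial>uext (trans M xc u)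
      \<partial>uext (cout controller ?m))
      = (\<integral>\<^sup>+xc'. expected_payoff l (?m, xc')
          \<partial>(uext (cout controller ?m) \<bind> (\<lambda>u. uext (trans M xc u))))"
    by (rule nn_integral_bind_uext[OF cout_controller_in_space_prob_algebra
          measurable_uext_kernel[OF measurable_trans_input[OF M]], symmetric])
  also have "\<dots> = (\<integral>\<^sup>+xc'. expected_payoff l (?m, xc') \<partial>uext (distr (coupling ?m) borel snd))"
    unfolding uext_bind[OF cout_controller_in_space_prob_algebra measurable_trans_input[OF M]]
      cout_controller_bind_trans[OF r] ..
  also have "\<dots> = (\<integral>\<^sup>+w. next_payoff w \<partial>uext (coupling ?m))"
    unfolding nn_integral_uext_coupling[OF measurable_next_payoff]
    using q by (simp add: expected_payoff_eq resample_def)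
  finally show ?thesis .
qed

lemma value_iterate_Suc_le_next_payoff:
  assumes r: "(x, xc) \<in> R"
  shows "ennreal (value_iterate (Suc l) (x, q)) \<le> (\<integral>\<^sup>+w. next_payoff w \<partial>uext (coupling (x, q, xc)))"
proof (rule value_iterate_Suc_le)
  have "(\<lambda>x'. ennreal (payoff (value_iterate l) (successor q x')))
      \<in> borel_measurable (univ_alg borel)"
    by (rule measurable_compose_univ_alg[OF measurable_successor_state measurable_ennreal_payoff])
  moreover have "ennreal (payoff (value_iterate l) (successor q x')) \<le> next_payoff (x', y)"
      if "(x', y) \<in> R" for x' y
    using q that by (simp add: coupled_payoff_def successor_def next_mode_def out_eq[OF that])
  ultimately show "ennreal (Tmu Mh L F \<tau> \<mu> (value_iterate l) (x, q))
      \<le> (\<integral>\<^sup>+w. next_payoff w \<partial>uext (coupling (x, q, xc))) + ennreal \<delta>"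
    unfolding ennreal_Tmu_successor[OF admissible_value_iterate] distr_coupling_fst[OF r, symmetric]
    by (intro nn_integral_uext_distr_fst_le[OF coupling_in_space_prob_algebra R_sets_pair
          emeasure_coupling_compl_R[OF r]] payoff_value_iterate_le_1 measurable_next_payoff)
qed

end

definition accepting_states :: "(('x \<times> 'q \<times> 'xc) \<times> 'xc) set" where
  "accepting_states = {z. next_mode (mode (fst z)) (snd z) \<in> F}"

lemma measurable_loop_mode:
  "(\<lambda>z. mode (fst z)) \<in> measurable (loop_space memory_space) (count_space UNIV)"
  by (rule measurable_compose_univ_alg[OF measurable_fst measurable_mode])

lemma measurable_loop_next_mode:
  "(\<lambda>z. next_mode (mode (fst z)) (snd z)) \<in> measurable (loop_space memory_space) (count_space UNIV)"
  by (rule measurable_next_mode[OF measurable_loop_mode measurable_univ_algI1[OF measurable_snd]])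

lemma sets_accepting_states: "accepting_states \<in> sets (loop_space memory_space)"
  using measurable_sets[OF measurable_loop_next_mode, of F]
  by (simp add: accepting_states_def vimage_def space_pair_measure)

lemma expected_payoff_0_le: "expected_payoff 0 z \<le> indicator accepting_states z"
proof (cases "z \<in> accepting_states")
  case True
  then show ?thesis using expected_payoff_le_1 by simp
next
  case False
  then have "coupled_payoff 0 (x, next_mode (mode (fst z)) (snd z), snd z) = 0" for x
    by (simp add: accepting_states_def coupled_payoff_def payoff_def value_iterate_0)
  then show ?thesis using expected_payoff_eq[of 0 "fst z" "snd z"] by simp
qed

lemma expected_payoff_Suc_le:
  assumes "z \<notin> accepting_states"
  shows "expected_payoff (Suc l) z
      \<le> (\<integral>\<^sup>+z'. expected_payoff l z' \<partial>cl_step memory_space controller M z)"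
proof -
  obtain m xc where z: "z = (m, xc)" by (cases z)
  let ?q = "next_mode (mode m) xc"
  let ?step = "\<lambda>m'. \<integral>\<^sup>+u. \<integral>\<^sup>+xc'. expected_payoff l (m', xc') \<partial>uext (trans M xc u)
      \<partial>uext (cout controller m')"
  have q: "?q \<notin> F" using assms by (simp add: accepting_states_def z)
  have step: "coupled_payoff (Suc l) (x, ?q, xc) \<le> ?step (x, ?q, xc)" for x
  proof (cases "(x, xc) \<in> R")
    case True
    then have "coupled_payoff (Suc l) (x, ?q, xc) = ennreal (value_iterate (Suc l) (x, ?q))"
      using q value_iterate_bounds(1) by (simp add: coupled_payoff_def payoff_def max_absorb2)
    also have "\<dots> \<le> ?step (x, ?q, xc)"
      unfolding nn_integral_expected_payoff[OF q True]
      by (rule value_iterate_Suc_le_next_payoff[OF q True])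
    finally show ?thesis .
  qed (simp add: coupled_payoff_def)
  have "AE m' in uext (ctrans controller m xc). coupled_payoff (Suc l) m' \<le> ?step m'"
    using AE_uext_ctrans_controller[of m xc] by eventually_elim (use step in \<open>metis prod.collapse\<close>)
  then have "expected_payoff (Suc l) z \<le> (\<integral>\<^sup>+m'. ?step m' \<partial>uext (ctrans controller m xc))"
    unfolding z expected_payoff_def fst_conv snd_conv by (rule nn_integral_mono_AE)
  also have "\<dots> = (\<integral>\<^sup>+z'. expected_payoff l z' \<partial>cl_step memory_space controller M z)"
    unfolding z
    by (simp add: nn_integral_cl_step[OF is_strategy_controller M measurable_expected_payoff]
        space_pair_measure)
  finally show ?thesis .
qed

subsection \<open>The satisfaction bound\<close>

lemma markov_chain_controller:
  "markov_chain (loop_space memory_space) (cl_step memory_space controller M)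
      (cinit controller, init M)"
  by (rule markov_chain_cl_step[OF is_strategy_controller M]) (simp add: space_memory_space)

interpretation loop: markov_chain "loop_space memory_space" "cl_step memory_space controller M"
    "(cinit controller, init M)"
  by (rule markov_chain_controller)

lemma AE_paths_mode:
  "AE \<omega> in loop.paths. \<forall>i. mode (fst (\<omega> (Suc i))) = next_mode (mode (fst (\<omega> i))) (snd (\<omega> i))"
proof (rule loop.AE_paths_step)
  have "Measurable.pred (loop_space memory_space \<Otimes>\<^sub>M loop_space memory_space)
      (\<lambda>z. mode (fst (snd z)) = q)" for q
    by (rule measurable_compose[OF measurable_compose[OF measurable_snd measurable_loop_mode]]) simp
  from measurable_compose_countable[OF this
      measurable_compose[OF measurable_fst measurable_loop_next_mode]]
  show "Measurable.pred (loop_space memory_space \<Otimes>\<^sub>M loop_space memory_space)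
      (\<lambda>(z, z'). mode (fst z') = next_mode (mode (fst z)) (snd z))"
    by (simp add: split_beta')
  fix z
  have "Measurable.pred (univ_alg memory_space) (\<lambda>m'. mode m' = next_mode (mode (fst z)) (snd z))"
    by (rule measurable_compose[OF measurable_mode]) simp
  moreover have "AE m' in uext (ctrans controller (fst z) (snd z)).
      mode m' = next_mode (mode (fst z)) (snd z)"
    using AE_uext_ctrans_controller[of "fst z" "snd z"] by eventually_elim simp
  ultimately show "AE z' in cl_step memory_space controller M z.
      mode (fst z') = next_mode (mode (fst z)) (snd z)"
    by (intro AE_cl_step_memory[OF is_strategy_controller M]) (simp add: space_pair_measure)
qed

context
  assumes F: "F \<noteq> {}"
begin

lemma mode_cinit_controller: "mode (cinit controller) \<in> F"
  using F by (simp add: controller_def some_in_eq)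

lemma AE_paths_accepts:
  "AE \<omega> in loop.paths. (\<exists>i. \<omega> i \<in> accepting_states) \<longrightarrow>
      dfa_accepts q0 F \<tau> (\<lambda>i. L (out M (snd (\<omega> i))))"
proof -
  have "AE \<omega> in loop.paths. mode (fst (\<omega> 0)) \<in> F"
    by (rule loop.AE_paths_start[OF measurable_compose[OF measurable_loop_mode]])
       (simp_all add: mode_cinit_controller)
  then show ?thesis
    using AE_paths_mode
  proof eventually_elim
    case (elim \<omega>)
    show ?case
    proof
      assume "\<exists>i. \<omega> i \<in> accepting_states"
      then obtain n where "next_mode (mode (fst (\<omega> n))) (snd (\<omega> n)) \<in> F"
        by (auto simp: accepting_states_def)
      then have "mode (fst (\<omega> (Suc n))) \<in> F" using elim(2) by simp
      with elim show "dfa_accepts q0 F \<tau> (\<lambda>i. L (out M (snd (\<omega> i))))"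
        by (intro dfa_accepts_if_restarted_run_hits[of "\<lambda>i. mode (fst (\<omega> i))"])
           (simp_all add: next_mode_def)
    qed
  qed
qed

lemma expected_payoff_init:
  "expected_payoff l (cinit controller, init M)
    = ennreal (payoff (value_iterate l) (init Mh, \<tau> q0 (L (out Mh (init Mh)))))"
proof -
  let ?q = "\<tau> q0 (L (out Mh (init Mh)))"
  have "(\<lambda>x. coupled_payoff l (x, ?q, init M)) \<in> borel_measurable (univ_alg borel)"
    by (rule measurable_compose_univ_alg[OF _ measurable_coupled_payoff]) simp
  then show ?thesis
    using mode_cinit_controller init_related out_eq[OF init_related]
    by (simp add: expected_payoff_eq resample_def next_mode_def uext_return nn_integral_return
        coupled_payoff_def)
qed

end

theorem satisfaction_lower_bound:
  assumes accepts: "\<And>w. dfa_accepts q0 F \<tau> w \<longleftrightarrow> scsat w 0 \<psi>"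
  shows "robust_sat_prob Mh L q0 F \<tau> \<mu> \<delta> \<le> sat_prob memory_space controller M L \<psi>"
proof (cases "F = {}")
  case True
  then show ?thesis
    using robust_sat_prob_le_0 order_trans[OF _ measure_nonneg] unfolding sat_prob_def by blast
next
  case F: False
  interpret P: prob_space loop.paths by (rule loop.prob_space_paths)
  let ?sat = "sat_prob memory_space controller M L \<psi>"
  let ?accepted = "{\<omega> \<in> space loop.paths. dfa_accepts q0 F \<tau> (\<lambda>i. L (out M (snd (\<omega> i))))}"
  have sat: "?sat = measure loop.paths ?accepted"
    by (rule sat_prob_eq[OF is_strategy_controller M _ L accepts]) (simp add: space_memory_space)
  have accepted: "?accepted \<in> sets loop.paths"
    by (rule sets_accepted_paths[OF is_strategy_controller M _ L]) (simp add: space_memory_space)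
  have payoff_le: "payoff (value_iterate l) (init Mh, \<tau> q0 (L (out Mh (init Mh)))) \<le> ?sat" for l
  proof -
    have "expected_payoff l (cinit controller, init M)
        \<le> emeasure loop.paths {\<omega> \<in> space loop.paths. \<exists>i\<le>l. \<omega> i \<in> accepting_states}"
      by (intro loop.value_le_hitting_probability sets_accepting_states measurable_expected_payoff
        expected_payoff_0_le expected_payoff_le_1 expected_payoff_Suc_le)
    also have "\<dots> \<le> emeasure loop.paths ?accepted"
      using AE_paths_accepts[OF F]
      by (intro emeasure_mono_AE accepted) (auto elim!: eventually_mono)
    finally show ?thesis
      unfolding expected_payoff_init[OF F] sat by (simp add: P.emeasure_eq_measure ennreal_le_iff)
  qed
  then have "V_inf Mh L F \<tau> \<mu> \<delta> (init Mh, \<tau> q0 (L (out Mh (init Mh)))) \<le> ?sat"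
    by (intro V_inf_le) (simp add: payoff_def)
  moreover have "indicator F (\<tau> q0 (L (out Mh (init Mh)))) \<le> ?sat"
    using payoff_le[of 0] by (simp add: payoff_def)
  ultimately show ?thesis by (simp add: robust_sat_prob_def Let_def)
qed

end

theorem theorem2:
  fixes Mh :: "('x::polish_space, 'u::polish_space, 'y::metric_space) gmdp"
    and L :: "'y \<Rightarrow> 'ap::finite set"
    and \<psi> :: "'ap scltl"
    and q0 :: "'q::finite" and F :: "'q set" and \<tau> :: "'q \<Rightarrow> 'ap set \<Rightarrow> 'q"
    and \<mu> :: "'x \<times> 'q \<Rightarrow> 'u measure"
    and \<delta> :: real
  assumes "is_gmdp Mh"
    and "L \<in> measurable borel (count_space UNIV)"
    and "\<forall>w. dfa_accepts q0 F \<tau> w \<longleftrightarrow> scsat w 0 \<psi>"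
    and "\<delta> \<ge> 0"
    and "is_policy \<mu>"
  shows "\<forall>M :: ('xc::polish_space, 'uc::polish_space, 'y) gmdp.
           is_gmdp M \<and> approx_sim \<delta> 0 Mh M \<longrightarrow>
           (\<exists>C :: ('x \<times> 'q \<times> 'xc, 'xc, 'uc) strategy.
              is_strategy (borel \<Otimes>\<^sub>M (count_space UNIV \<Otimes>\<^sub>M borel)) C \<and>
              sat_prob (borel \<Otimes>\<^sub>M (count_space UNIV \<Otimes>\<^sub>M borel)) C M L \<psi>
                \<ge> robust_sat_prob Mh L q0 F \<tau> \<mu> \<delta>)"
proof (intro allI impI, elim conjE)
  fix M :: "('xc, 'uc, 'y) gmdp"
  assume M: "is_gmdp M" and sim: "approx_sim \<delta> 0 Mh M"
  interpret abstract_model Mh L F \<tau> \<mu> \<delta> by (rule abstract_model.intro[OF assms(1,2,5,4)])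
  obtain Uv :: "'u \<Rightarrow> 'x \<Rightarrow> 'xc \<Rightarrow> 'uc measure" and R W
    where "exact_simulation Mh L \<mu> \<delta> M Uv R W"
    by (rule approx_sim_exact_simulation[OF sim M])
  then interpret exact_simulation Mh L F \<tau> \<mu> \<delta> q0 M Uv R W .
  show "\<exists>C :: ('x \<times> 'q \<times> 'xc, 'xc, 'uc) strategy.
      is_strategy (borel \<Otimes>\<^sub>M (count_space UNIV \<Otimes>\<^sub>M borel)) C \<and>
      sat_prob (borel \<Otimes>\<^sub>M (count_space UNIV \<Otimes>\<^sub>M borel)) C M L \<psi> \<ge> robust_sat_prob Mh L q0 F \<tau> \<mu> \<delta>"
    using is_strategy_controller satisfaction_lower_bound assms(3) by blast
qed

end
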